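(* Assume Lang's conjecture in the form: there is an absolute constant $c_L>0$ such that $\hat{h}(P)\ge c_L\max\{h(j_E),h(\Delta_E)\}$ for every elliptic curve $E/\mathbb{Q}$ and every non-torsion $P\in E(\mathbb{Q})$. Then there exist absolute constants $A>1$, $C>0$ such that for every elliptic curve $E/\mathbb{Q}$ of rank $r$, and every sequence $\{P_1,\dots,P_N\}$ of integral points (i.e. points with $x(P_i),y(P_i)\in\mathbb{Z}$ on the model $y^2=x^3+A'x+B$ described in the context) in $x$-arithmetic progression, one has $N\le C A^r$.
   Context: $j_E$, $\Delta_E$ are the $j$-invariant and minimal discriminant of $E$; $h$ is the absolute logarithmic Weil height; $\hat{h}(P)=\lim_{n\to\infty}h(x(2^nP))/4^n$ (not normalized by $1/2$). The model $y^2=x^3+A'x+B$ ($A',B\in\mathbb{Z}$) is obtained from a global minimal Weierstrass equation $y^2+a_1xy+a_3y=x^3+a_2x^2+a_4x+a_6$ of $E$ by the substitution $x\mapsto \frac{1}{36}(x-3b_2)$, $y\mapsto \frac12(\frac{y}{108}-\frac{a_1}{36}(x-3b_2)-a_3)$. A sequence $\{P_1,\dots,P_N\}\subseteq E(\mathbb{Q})$ is in $x$-arithmetic progression if $x(P_1),\dots,x(P_N)$ are $N$ distinct rationals forming an arithmetic progression. *)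

theory Defs
  imports Complex_Main
begin

text \<open>A Weierstrass equation y^2 + a1 xy + a3 y = x^3 + a2 x^2 + a4 x + a6
  with integer coefficients.\<close>
record wmodel =
  a1 :: int
  a2 :: int
  a3 :: int
  a4 :: int
  a6 :: int

definition disc_q :: "rat \<Rightarrow> rat \<Rightarrow> rat \<Rightarrow> rat \<Rightarrow> rat \<Rightarrow> rat" where
  "disc_q c1 c2 c3 c4 c6 =
    (let b2 = c1^2 + 4*c2; b4 = 2*c4 + c1*c3; b6 = c3^2 + 4*c6;
         b8 = c1^2*c6 + 4*c2*c6 - c1*c3*c4 + c2*c3^2 - c4^2
     in - (b2^2*b8) - 8*b4^3 - 27*b6^2 + 9*b2*b4*b6)"

definition b2 :: "wmodel \<Rightarrow> int" where
  "b2 E = a1 E ^ 2 + 4 * a2 E"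

definition b4 :: "wmodel \<Rightarrow> int" where
  "b4 E = 2 * a4 E + a1 E * a3 E"

definition disc :: "wmodel \<Rightarrow> int" where
  "disc E = (let b6 = a3 E ^ 2 + 4 * a6 E;
                 b8 = a1 E ^2 * a6 E + 4 * a2 E * a6 E - a1 E * a3 E * a4 E
                      + a2 E * a3 E ^ 2 - a4 E ^ 2
             in - (b2 E ^2 * b8) - 8 * b4 E ^ 3 - 27 * b6 ^ 2 + 9 * b2 E * b4 E * b6)"

definition c4 :: "wmodel \<Rightarrow> int" where
  "c4 E = b2 E ^ 2 - 24 * b4 E"

definition jinv :: "wmodel \<Rightarrow> rat" where
  "jinv E = of_int (c4 E ^ 3) / of_int (disc E)"

text \<open>Global minimal Weierstrass equation of an elliptic curve over Q:
  nonsingular, integral, and among all integral Weierstrass equations obtained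
  by an admissible change of variables x = u^2 x' + r, y = u^3 y' + s u^2 x' + t
  (u, r, s, t rational, u nonzero) its discriminant has least absolute value.\<close>
definition global_minimal :: "wmodel \<Rightarrow> bool" where
  "global_minimal E \<longleftrightarrow> disc E \<noteq> 0 \<and>
     (\<forall>u r s t :: rat. u \<noteq> 0 \<longrightarrow>
        (let A1 = of_int (a1 E); A2 = of_int (a2 E); A3 = of_int (a3 E);
             A4 = of_int (a4 E); A6 = of_int (a6 E);
             a1' = (A1 + 2*s) / u;
             a2' = (A2 - s*A1 + 3*r - s^2) / u^2;
             a3' = (A3 + r*A1 + 2*t) / u^3;
             a4' = (A4 - s*A3 + 2*r*A2 - (t + r*s)*A1 + 3*r^2 - 2*s*t) / u^4;
             a6' = (A6 + r*A4 + r^2*A2 + r^3 - t*A3 - t^2 - r*t*A1) / u^6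
         in (a1' \<in> \<int> \<and> a2' \<in> \<int> \<and> a3' \<in> \<int> \<and> a4' \<in> \<int> \<and> a6' \<in> \<int>) \<longrightarrow>
            \<bar>of_int (disc E)\<bar> \<le> \<bar>disc_q a1' a2' a3' a4' a6'\<bar>))"

text \<open>Rational points: None is the point at infinity O.\<close>
type_synonym rpt = "(rat \<times> rat) option"

definition on_curve :: "wmodel \<Rightarrow> rat \<Rightarrow> rat \<Rightarrow> bool" where
  "on_curve E x y \<longleftrightarrow>
     y^2 + of_int (a1 E) * x * y + of_int (a3 E) * y
       = x^3 + of_int (a2 E) * x^2 + of_int (a4 E) * x + of_int (a6 E)"

definition ratpts :: "wmodel \<Rightarrow> rpt set" where
  "ratpts E = insert None {Some (x, y) | x y. on_curve E x y}"

fun pneg :: "wmodel \<Rightarrow> rpt \<Rightarrow> rpt" where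
  "pneg E None = None"
| "pneg E (Some (x, y)) = Some (x, - y - of_int (a1 E) * x - of_int (a3 E))"

fun padd :: "wmodel \<Rightarrow> rpt \<Rightarrow> rpt \<Rightarrow> rpt" where
  "padd E None Q = Q"
| "padd E (Some p) None = Some p"
| "padd E (Some (x1, y1)) (Some (x2, y2)) =
    (if x1 = x2 \<and> y1 + y2 + of_int (a1 E) * x2 + of_int (a3 E) = 0 then None
     else
       (let l = (if x1 \<noteq> x2 then (y2 - y1) / (x2 - x1)
                 else (3*x1^2 + 2*of_int (a2 E)*x1 + of_int (a4 E) - of_int (a1 E)*y1)
                      / (2*y1 + of_int (a1 E)*x1 + of_int (a3 E)));
            v = y1 - l * x1;
            x3 = l^2 + of_int (a1 E) * l - of_int (a2 E) - x1 - x2;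
            y3 = - (l + of_int (a1 E)) * x3 - v - of_int (a3 E)
        in Some (x3, y3)))"

fun pmult :: "wmodel \<Rightarrow> nat \<Rightarrow> rpt \<Rightarrow> rpt" where
  "pmult E 0 P = None"
| "pmult E (Suc n) P = padd E P (pmult E n P)"

definition pimult :: "wmodel \<Rightarrow> int \<Rightarrow> rpt \<Rightarrow> rpt" where
  "pimult E k P = (if k \<ge> 0 then pmult E (nat k) P else pneg E (pmult E (nat (- k)) P))"

definition torsion :: "wmodel \<Rightarrow> rpt \<Rightarrow> bool" where
  "torsion E P \<longleftrightarrow> (\<exists>n>0. pmult E n P = None)"

definition lincomb :: "wmodel \<Rightarrow> int list \<Rightarrow> rpt list \<Rightarrow> rpt" where
  "lincomb E ns ps = foldr (padd E) (map2 (pimult E) ns ps) None"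

definition indep :: "wmodel \<Rightarrow> rpt list \<Rightarrow> bool" where
  "indep E ps \<longleftrightarrow> (\<forall>ns. length ns = length ps \<longrightarrow>
       lincomb E ns ps = None \<longrightarrow> (\<forall>n \<in> set ns. n = 0))"

definition has_rank :: "wmodel \<Rightarrow> nat \<Rightarrow> bool" where
  "has_rank E r \<longleftrightarrow>
     (\<exists>ps. distinct ps \<and> length ps = r \<and> set ps \<subseteq> ratpts E \<and> indep E ps) \<and>
     (\<forall>ps. distinct ps \<and> set ps \<subseteq> ratpts E \<and> indep E ps \<longrightarrow> length ps \<le> r)"

definition wheight :: "rat \<Rightarrow> real" where
  "wheight q = (case quotient_of q of (a, b) \<Rightarrow> ln (real_of_int (max \<bar>a\<bar> \<bar>b\<bar>)))"

fun xcoord :: "rpt \<Rightarrow> rat" where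
  "xcoord None = 0"
| "xcoord (Some (x, y)) = x"

text \<open>Canonical height (not normalized by 1/2).\<close>
definition canon_height :: "wmodel \<Rightarrow> rpt \<Rightarrow> real" where
  "canon_height E P = lim (\<lambda>n. wheight (xcoord (pmult E (2^n) P)) / 4^n)"

text \<open>Coordinates on the model y^2 = x^3 + A'x + B: X = 36x + 3 b2, Y = 108(2y + a1 x + a3).\<close>
definition shortX :: "wmodel \<Rightarrow> rat \<times> rat \<Rightarrow> rat" where
  "shortX E p = 36 * fst p + 3 * of_int (b2 E)"

definition shortY :: "wmodel \<Rightarrow> rat \<times> rat \<Rightarrow> rat" where
  "shortY E p = 108 * (2 * snd p + of_int (a1 E) * fst p + of_int (a3 E))"

definition integral_pt :: "wmodel \<Rightarrow> rat \<times> rat \<Rightarrow> bool" where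
  "integral_pt E p \<longleftrightarrow> on_curve E (fst p) (snd p) \<and> shortX E p \<in> \<int> \<and> shortY E p \<in> \<int>"

definition lang_conjecture :: bool where
  "lang_conjecture \<longleftrightarrow> (\<exists>cL > 0. \<forall>E P. global_minimal E \<and> P \<in> ratpts E \<and> \<not> torsion E P \<longrightarrow>
      canon_height E P \<ge> cL * max (wheight (jinv E)) (wheight (of_int (disc E))))"

end

theory Submission
  imports Defs "HOL-Computational_Algebra.Primes" "HOL-Algebra.Group"
begin

text \<open>Let \<open>H\<close> be the maximum of the heights of \<open>j\<close> and of the discriminant; the logarithms of the
  coefficients of the short model are \<open>O(H)\<close>, and the canonical height differs from the naive one
  by \<open>O(H)\<close>. It is a positive semidefinite quadratic form on a group of rank \<open>r\<close>, hence a sum of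
  \<open>r\<close> squares of additive functions, so by the box principle, among more than \<open>m K^r\<close> points of
  height at most \<open>R\<close> there are more than \<open>m\<close> whose differences have height at most \<open>\<delta> R\<close>. Let
  \<open>X\<close> be the largest absolute value of a term of the progression.

  If \<open>log X\<close> is large compared with \<open>H\<close>, consider the quarter of the points with
  \<open>|x| \<ge> X/2\<close>. For integral points the denominator of \<open>x(P + Q)\<close> is only \<open>(x(P) - x(Q))^2\<close>, so
  \<open>P + Q\<close> has height at most \<open>3 log X + O(H)\<close>, whence by the parallelogram law \<open>P - Q\<close> has
  height at least \<open>log X - O(H)\<close>, which bounds the number of points by \<open>K^r\<close>.

  Otherwise all points have height \<open>O(H)\<close>, and by Lang's conjecture a proportion \<open>K^(-r)\<close> of them
  differ pairwise by torsion points. Instead of a uniform bound for the torsion, the progression is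
  used: torsion points are integral at 5, so a congruence \<open>x(P) \<equiv> x(Q)\<close> modulo \<open>5^e\<close> forces
  \<open>y(P) \<equiv> - y(Q)\<close>. Three points in a residue class modulo \<open>5^k\<close> thus have small \<open>5\<close>-adic
  \<open>y\<close>, and by minimality at 5 such points occupy at most three residue classes modulo
  \<open>5^(m+1)\<close>, where \<open>3 m + 2 \<le> 2 k\<close>. Hence these points have small density.\<close>

section \<open>The group law on a short Weierstrass curve\<close>

text \<open>The box principle must cost \<open>K ^ r\<close>, not a power of \<open>r\<close>. Boxes
  small enough for \<open>r\<close> coordinates have side about the square root of
  \<open>\<delta> R / r\<close>, and filling a cube of side \<open>sqrt R\<close> with them would
  take about \<open>(r / \<delta>) ^ (r / 2)\<close> boxes. Points of a ball, however, are labelled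
  by integer vectors whose absolute values sum to at most \<open>c r\<close>, and there are only
  exponentially many of those. The prime 5 is the smallest one prime to 6. The passage from the
  minimal to the short model scales x by 36 and y by 216, so minimality at 5 is visible on the short
  model. The torsion case compares two densities. The pairwise torsion-related terms make up at
  least \<open>1 / K\<close> of the progression, with \<open>K = 25 ^ (k r)\<close>, while the
  congruences allow density at most \<open>3 / 5 ^ (2 h + 1)\<close> apart from a constant of order
  \<open>5 ^ (3 h)\<close>. Taking \<open>h = k r + 1\<close> makes the density term harmless, and
  the constant stays exponential in \<open>r\<close>.\<close>

type_synonym 'a pt = "('a \<times> 'a) option"

fun sneg :: "'a::field pt \<Rightarrow> 'a pt" where
  "sneg None = None"
| "sneg (Some (x, y)) = Some (x, - y)"

definition slope :: "'a::field \<Rightarrow> 'a \<Rightarrow> 'a \<Rightarrow> 'a \<Rightarrow> 'a \<Rightarrow> 'a" where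
  "slope A x1 y1 x2 y2 =
     (if x1 \<noteq> x2 then (y2 - y1) / (x2 - x1) else (3 * x1\<^sup>2 + A) / (2 * y1))"

fun sadd :: "'a::field \<Rightarrow> 'a pt \<Rightarrow> 'a pt \<Rightarrow> 'a pt" where
  "sadd A None Q = Q"
| "sadd A (Some p) None = Some p"
| "sadd A (Some (x1, y1)) (Some (x2, y2)) =
     (if x1 = x2 \<and> y1 + y2 = 0 then None
      else let l = slope A x1 y1 x2 y2; x3 = l\<^sup>2 - x1 - x2
           in Some (x3, - (l * (x3 - x1) + y1)))"

lemma sneg_sneg [simp]: "sneg (sneg P) = P"
  by (cases P rule: sneg.cases) auto

lemma sadd_None_right [simp]: "sadd A P None = P"
  by (cases P) auto

locale short_curve =
  fixes A B :: "'a::field_char_0"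
  assumes nonsingular: "4 * A ^ 3 + 27 * B\<^sup>2 \<noteq> 0"
begin

definition on :: "'a \<Rightarrow> 'a \<Rightarrow> bool" where
  "on x y \<longleftrightarrow> y\<^sup>2 = x ^ 3 + A * x + B"

definition pts :: "'a pt set" where
  "pts = insert None {Some (x, y) | x y. on x y}"

lemma None_in_pts [simp]: "None \<in> pts"
  by (simp add: pts_def)

lemma Some_in_pts [simp]: "Some (x, y) \<in> pts \<longleftrightarrow> on x y"
  by (simp add: pts_def)

lemma pts_cases [consumes 1, case_names None Some]:
  assumes "P \<in> pts"
  obtains "P = None" | x y where "P = Some (x, y)" "on x y"
  using assms by (auto simp: pts_def)

lemma on_uminus [simp]: "on x (- y) \<longleftrightarrow> on x y"
  by (simp add: on_def)

lemma sneg_in_pts [simp]: "P \<in> pts \<Longrightarrow> sneg P \<in> pts"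
  by (erule pts_cases) auto

lemma on_same_x:
  assumes "on x y" "on x y'"
  shows "y' = y \<or> y' = - y"
  using assms unfolding on_def by (metis power2_eq_iff)

text \<open>The line of slope \<open>l\<close> and intercept \<open>v\<close> meets the curve in the three given points,
  counted with multiplicity: the last two conditions compare coefficients of the cubic
  obtained by substituting the line into the equation of the curve.\<close>

definition line :: "'a \<Rightarrow> 'a \<Rightarrow> 'a \<Rightarrow> 'a \<Rightarrow> 'a \<Rightarrow> 'a \<Rightarrow> 'a \<Rightarrow> 'a \<Rightarrow> bool" where
  "line l v x1 y1 x2 y2 x3 y3 \<longleftrightarrow>
     y1 = l * x1 + v \<and> y2 = l * x2 + v \<and> y3 = l * x3 + v \<and>
     l\<^sup>2 = x1 + x2 + x3 \<and> A - 2 * l * v = x1 * x2 + x2 * x3 + x1 * x3"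

lemma line_rotate: "line l v x1 y1 x2 y2 x3 y3 \<Longrightarrow> line l v x3 y3 x1 y1 x2 y2"
  unfolding line_def by (simp add: algebra_simps)

lemma line_swap: "line l v x1 y1 x2 y2 x3 y3 \<Longrightarrow> line l v x2 y2 x1 y1 x3 y3"
  unfolding line_def by (simp add: algebra_simps)

lemma line_neg: "line l v x1 y1 x2 y2 x3 y3 \<Longrightarrow> line (- l) (- v) x1 (- y1) x2 (- y2) x3 (- y3)"
  unfolding line_def by (simp add: algebra_simps)

lemma line_slope:
  assumes on1: "on x1 y1" and on2: "on x2 y2" and ne: "\<not> (x1 = x2 \<and> y1 + y2 = 0)"
  defines "l \<equiv> slope A x1 y1 x2 y2"
  defines "x3 \<equiv> l\<^sup>2 - x1 - x2"
  shows "line l (y1 - l * x1) x1 y1 x2 y2 x3 (l * (x3 - x1) + y1)"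
    and "on x3 (l * (x3 - x1) + y1)"
proof -
  \<comment> \<open>Chord and tangent satisfy the same two division-free equations, so the cases
    need no further distinction. The second one comes from \<open>y2^2 - y1^2\<close> by cancelling
    \<open>x2 - x1\<close>.\<close>
  have key: "l * (x2 - x1) = y2 - y1 \<and> l * (y1 + y2) = x1\<^sup>2 + x1 * x2 + x2\<^sup>2 + A"
  proof (cases "x1 = x2")
    case True
    then have y: "y2 = y1" using on_same_x[OF on1, of y2] on2 ne by auto
    then have "y1 \<noteq> 0" using ne True by auto
    then show ?thesis using True y
      by (simp add: l_def slope_def field_simps power2_eq_square)
  next
    case False
    then have l: "l * (x2 - x1) = y2 - y1" by (simp add: l_def slope_def)
    have "(x2 - x1) * (l * (y1 + y2)) = (l * (x2 - x1)) * (y1 + y2)" by (simp only: ac_simps)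
    also have "\<dots> = y2\<^sup>2 - y1\<^sup>2" unfolding l by (simp add: power2_eq_square algebra_simps)
    also have "\<dots> = (x2 - x1) * (x1\<^sup>2 + x1 * x2 + x2\<^sup>2 + A)"
      using on1 on2 unfolding on_def by (simp add: power2_eq_square power3_eq_cube algebra_simps)
    finally have "(x2 - x1) * (l * (y1 + y2)) = (x2 - x1) * (x1\<^sup>2 + x1 * x2 + x2\<^sup>2 + A)" .
    then show ?thesis using False l by simp
  qed
  have x3: "x3 = l\<^sup>2 - x1 - x2" by (simp add: x3_def)
  define v where "v = y1 - l * x1"
  have e2: "A - 2 * l * v = x1 * x2 + x2 * x3 + x1 * x3"
    using key x3 v_def by algebra
  show "line l (y1 - l * x1) x1 y1 x2 y2 x3 (l * (x3 - x1) + y1)"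
    unfolding line_def v_def[symmetric] using e2 key by (simp add: x3 v_def algebra_simps)
  have "(l * (x3 - x1) + y1)\<^sup>2 = x3 ^ 3 + A * x3 + B"
    using e2 x3 on1 v_def unfolding on_def by algebra
  then show "on x3 (l * (x3 - x1) + y1)" by (simp add: on_def)
qed

text \<open>Converse of \<open>line_slope\<close>. As \<open>line\<close> is symmetric in its three
  points, commutativity and cancellation of \<open>sadd\<close> can be read off by permuting or
  reflecting a line.\<close>

lemma line_sadd:
  assumes on1: "on x1 y1" and on2: "on x2 y2" and line: "line l v x1 y1 x2 y2 x3 y3"
  shows "\<not> (x1 = x2 \<and> y1 + y2 = 0)" "l = slope A x1 y1 x2 y2"
    "sadd A (Some (x1, y1)) (Some (x2, y2)) = Some (x3, - y3)"
proof -
  have L: "y1 = l * x1 + v" "y2 = l * x2 + v" "y3 = l * x3 + v"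
    "l\<^sup>2 = x1 + x2 + x3" "A - 2 * l * v = x1 * x2 + x2 * x3 + x1 * x3"
    using line by (auto simp: line_def)
  \<comment> \<open>If \<open>y1 = 0\<close>, the coefficient conditions give
    \<open>A = - 3 x1^2\<close> and \<open>B = 2 x1^3\<close>, so \<open>x1\<close> is a double root
    of the cubic; \<open>nonsingular\<close> excludes this.\<close>
  have nz: "y1 \<noteq> 0" if "x1 = x2"
  proof
    assume "y1 = 0"
    then have v: "v = - l * x1" using L(1) by (simp add: eq_neg_iff_add_eq_0 add.commute)
    have "A = 2 * l\<^sup>2 * (- x1) + x1 * x1 + 2 * x1 * x3" using L(5) that unfolding v by (simp add: power2_eq_square algebra_simps)
    then have "A = - 3 * x1\<^sup>2"
      using L(4) that by algebra
    moreover from this have "B = 2 * x1 ^ 3"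
      using on1 \<open>y1 = 0\<close> unfolding on_def by algebra
    ultimately have "4 * A ^ 3 + 27 * B\<^sup>2 = 0" by algebra
    with nonsingular show False by simp
  qed
  show ne: "\<not> (x1 = x2 \<and> y1 + y2 = 0)"
  proof
    assume *: "x1 = x2 \<and> y1 + y2 = 0"
    then have "y1 = y2" using L by simp
    then have "2 * y1 = 0" using * by simp
    then show False using nz * by simp
  qed
  show l: "l = slope A x1 y1 x2 y2"
  proof (cases "x1 = x2")
    case True
    have "l * (2 * y1) = 3 * x1\<^sup>2 + A" using L True by algebra
    then show ?thesis using nz True by (simp add: slope_def field_simps)
  next
    case False
    have "l * (x2 - x1) = y2 - y1" using L by algebra
    then show ?thesis using False by (simp add: slope_def field_simps)
  qed
  have "x3 = l\<^sup>2 - x1 - x2" using L by algebra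
  moreover have "y3 = l * (x3 - x1) + y1" using L by algebra
  ultimately show "sadd A (Some (x1, y1)) (Some (x2, y2)) = Some (x3, - y3)"
    using ne l[symmetric] by (simp add: Let_def)
qed

lemma sadd_cases [consumes 2, case_names left right opposite affine]:
  assumes "P \<in> pts" "Q \<in> pts"
  obtains "P = None" | "Q = None"
    | x y where "on x y" "P = Some (x, y)" "Q = Some (x, - y)" "sadd A P Q = None"
    | x1 y1 x2 y2 x3 y3 l v where
        "P = Some (x1, y1)" "Q = Some (x2, y2)" "on x1 y1" "on x2 y2" "on x3 y3"
        "line l v x1 y1 x2 y2 x3 y3" "sadd A P Q = Some (x3, - y3)"
proof (cases "P = None \<or> Q = None")
  case True
  then show ?thesis using that(1,2) by blast
next
  case False
  then obtain x1 y1 x2 y2 where P: "P = Some (x1, y1)" "on x1 y1" and Q: "Q = Some (x2, y2)" "on x2 y2"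
    using assms by (auto simp: pts_def)
  show ?thesis
  proof (cases "x1 = x2 \<and> y1 + y2 = 0")
    case True
    then have "y2 = - y1" by (simp add: eq_neg_iff_add_eq_0 add.commute)
    then show ?thesis using that(3)[of x1 y1] P Q True by simp
  next
    case False
    from line_slope[OF P(2) Q(2) False] line_sadd[OF P(2) Q(2)] show ?thesis
      using that(4) P Q by metis
  qed
qed

lemma sadd_in_pts [simp]: "P \<in> pts \<Longrightarrow> Q \<in> pts \<Longrightarrow> sadd A P Q \<in> pts"
  by (rule sadd_cases[of P Q]) (auto simp del: sadd.simps(3))

lemma sadd_commute:
  assumes "P \<in> pts" "Q \<in> pts"
  shows "sadd A P Q = sadd A Q P"
  using assms
proof (cases rule: sadd_cases)
  case (affine x1 y1 x2 y2 x3 y3 l v)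
  then show ?thesis using line_sadd(3)[OF _ _ line_swap] by metis
qed auto

lemma sadd_sneg [simp]: "sadd A P (sneg P) = None"
  by (cases P rule: sneg.cases) auto

lemma sadd_eq_None:
  assumes "P \<in> pts" "Q \<in> pts" "sadd A P Q = None"
  shows "Q = sneg P"
  using assms by (cases rule: sadd_cases) auto

text \<open>Reflecting the line through \<open>P\<close>, \<open>Q\<close> and
  \<open>- (P + Q)\<close> gives the line through \<open>- P\<close>, \<open>- Q\<close> and
  \<open>P + Q\<close>. This special case of associativity is proved directly because the general
  argument relies on it.\<close>

lemma sadd_cancel_left:
  assumes "P \<in> pts" "Q \<in> pts"
  shows "sadd A (sneg P) (sadd A P Q) = Q"
  using assms
proof (cases rule: sadd_cases)
  case right
  have "sadd A (sneg P) P = None" using sadd_sneg[of "sneg P"] by simp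
  with right show ?thesis by simp
next
  case (affine x1 y1 x2 y2 x3 y3 l v)
  have "line (- l) (- v) x1 (- y1) x3 (- y3) x2 (- y2)"
    using line_neg[OF line_swap[OF line_rotate[OF affine(6)]]] .
  from line_sadd(3)[OF _ _ this] show ?thesis
    using affine by (simp del: sadd.simps(3))
qed auto

text \<open>With slopes \<open>l1\<close>, \<open>m1\<close> of the lines through \<open>P, Q\<close> and \<open>Q, T\<close>, and \<open>l2\<close>, \<open>m2\<close> of the lines
  computing \<open>(P + Q) + T\<close> and \<open>P + (Q + T)\<close>, one finds
  \<open>(l1 + l2) (l1 - m1) = xP - xT = (m1 + m2) (l1 - m1)\<close>, whence \<open>l1 + l2 = m1 + m2\<close>.\<close>

lemma sadd_assoc_generic:
  assumes P: "on xP yP" and Q: "on xQ yQ" and T: "on xT yT"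
    and PQ: "sadd A (Some (xP, yP)) (Some (xQ, yQ)) = Some (xD, yD)"
    and QT: "sadd A (Some (xQ, yQ)) (Some (xT, yT)) = Some (xE, yE)"
    and xTD: "xT \<noteq> xD" and xPE: "xP \<noteq> xE" and xPT: "xP \<noteq> xT"
  shows "sadd A (Some (xD, yD)) (Some (xT, yT)) = sadd A (Some (xP, yP)) (Some (xE, yE))"
proof -
  have "Some (xP, yP) \<in> pts" "Some (xQ, yQ) \<in> pts" "Some (xT, yT) \<in> pts"
    using P Q T by auto
  have "\<exists>l v. line l v xP yP xQ yQ xD (- yD)"
    using \<open>Some (xP, yP) \<in> pts\<close> \<open>Some (xQ, yQ) \<in> pts\<close>
    by (cases rule: sadd_cases; use PQ in \<open>fastforce simp del: sadd.simps(3)\<close>)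
  then obtain l1 v1 where L1: "line l1 v1 xP yP xQ yQ xD (- yD)" by blast
  have "\<exists>l v. line l v xQ yQ xT yT xE (- yE)"
    using \<open>Some (xQ, yQ) \<in> pts\<close> \<open>Some (xT, yT) \<in> pts\<close>
    by (cases rule: sadd_cases; use QT in \<open>fastforce simp del: sadd.simps(3)\<close>)
  then obtain m1 w1 where M1: "line m1 w1 xQ yQ xT yT xE (- yE)" by blast
  define l2 where "l2 = slope A xD yD xT yT"
  define m2 where "m2 = slope A xP yP xE yE"
  have l2: "l2 * (xT - xD) = yT - yD" using xTD by (simp add: l2_def slope_def)
  have m2: "m2 * (xE - xP) = yE - yP" using xPE by (simp add: m2_def slope_def)
  \<comment> \<open>\<open>L1''\<close> is the derivative at \<open>xQ\<close> of the cubic minus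
    the square of the line, which factors as \<open>(x - xP) (x - xQ) (x - xD)\<close>. It keeps its
    content when \<open>P = Q\<close>, where the slope is no difference quotient.\<close>
  have L1': "yP = yQ + l1 * (xP - xQ)" "yD = - (yQ + l1 * (xD - xQ))" "l1\<^sup>2 = xP + xQ + xD"
    and L1'': "3 * xQ\<^sup>2 + A - 2 * yQ * l1 = (xP - xQ) * (xD - xQ)"
    using L1 unfolding line_def by algebra+
  have M1': "yT = yQ + m1 * (xT - xQ)" "yE = - (yQ + m1 * (xE - xQ))" "m1\<^sup>2 = xQ + xT + xE"
    and M1'': "3 * xQ\<^sup>2 + A - 2 * yQ * m1 = (xT - xQ) * (xE - xQ)"
    using M1 unfolding line_def by algebra+
  have U1: "(xT - xD) * (l1 + l2) = 2 * yQ + (l1 + m1) * (xT - xQ)"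
    using L1' M1' l2 by algebra
  have U2: "(xP - xE) * (m1 + m2) = 2 * yQ + (l1 + m1) * (xP - xQ)"
    using L1' M1' m2 by algebra
  have "(2 * yQ + (l1 + m1) * (xT - xQ)) * (l1 - m1) = (xT - xD) * (xP - xT)"
    using L1'(3) L1'' M1'(3) M1'' by algebra
  then have 1: "(xT - xD) * ((l1 + l2) * (l1 - m1)) = (xT - xD) * (xP - xT)"
    using U1 by algebra
  have "(2 * yQ + (l1 + m1) * (xP - xQ)) * (l1 - m1) = (xP - xE) * (xP - xT)"
    using L1'(3) L1'' M1'(3) M1'' by algebra
  then have 2: "(xP - xE) * ((m1 + m2) * (l1 - m1)) = (xP - xE) * (xP - xT)"
    using U2 by algebra
  have e1: "(l1 + l2) * (l1 - m1) = xP - xT" using 1 xTD by simp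
  have e2: "(m1 + m2) * (l1 - m1) = xP - xT" using 2 xPE by simp
  have "l1 \<noteq> m1" using e1 xPT by auto
  then have s: "l1 + l2 = m1 + m2" using e1 e2 by (metis mult_right_cancel right_minus_eq)
  have m2': "m2 = l1 + l2 - m1" using s by algebra
  have xD: "xD = l1\<^sup>2 - xP - xQ" and xE: "xE = m1\<^sup>2 - xQ - xT"
    using L1'(3) M1'(3) by algebra+
  have x: "l2\<^sup>2 - xD - xT = m2\<^sup>2 - xP - xE"
    unfolding xD xE m2' using e1 by algebra
  define x where "x = l2\<^sup>2 - xD - xT"
  have "l2 * (x - xT) + yT = m2 * (x - xP) + yP"
    unfolding x_def xD L1'(1) M1'(1) m2' using e1 by algebra
  moreover have "l2 * (x - xD) + yD = l2 * (x - xT) + yT" using l2 by algebra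
  ultimately have "l2 * (x - xD) + yD = m2 * (x - xP) + yP" by simp
  moreover have "m2\<^sup>2 - xP - xE = x" using x by (simp add: x_def)
  ultimately show ?thesis using xTD xPE
    by (simp only: sadd.simps Let_def l2_def[symmetric] m2_def[symmetric] x_def[symmetric]) simp
qed

text \<open>\<open>P\<close> and \<open>Q\<close> stay arbitrary, coincidences included; genericity
  is asked of the last summand only, so that one auxiliary point can serve several pairs at
  once.\<close>

lemma sadd_assoc_cofinite:
  assumes P: "P \<in> pts" and Q: "Q \<in> pts"
  shows "\<exists>F. finite F \<and> (\<forall>T \<in> pts - F. sadd A (sadd A P Q) T = sadd A P (sadd A Q T))"
  using P Q
proof (cases rule: sadd_cases)
  case left
  then show ?thesis by (intro exI[of _ "{}"]) simp
next
  case right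
  then show ?thesis by (intro exI[of _ "{}"]) simp
next
  case (opposite x y)
  then have "P = sneg Q" by simp
  then show ?thesis using sadd_cancel_left[OF Q] opposite(4)
    by (intro exI[of _ "{}"]) auto
next
  case (affine xP yP xQ yQ xD yD' l v)
  let ?D = "sadd A P Q"
  \<comment> \<open>Avoiding \<open>- Q\<close> makes \<open>Q + T\<close> affine, avoiding
    \<open>P + Q\<close> and its negative gives \<open>xT \<noteq> xD\<close>, avoiding
    \<open>P\<close> and \<open>- P\<close> gives \<open>xP \<noteq> xT\<close>, and avoiding
    \<open>- Q + P\<close> and \<open>- Q - P\<close> gives \<open>xP \<noteq> xE\<close>.\<close>
  define F where "F = {None, sneg Q, ?D, sneg ?D, P, sneg P, sadd A (sneg Q) P, sadd A (sneg Q) (sneg P)}"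
  have "sadd A ?D T = sadd A P (sadd A Q T)" if "T \<in> pts - F" for T
  proof -
    have T: "T \<in> pts" "T \<notin> F" using that by auto
    then obtain xT yT where xT: "T = Some (xT, yT)" "on xT yT"
      by (auto simp: F_def elim: pts_cases)
    have "T \<noteq> sneg Q" using T(2) by (simp add: F_def)
    then have "sadd A Q T \<noteq> None" using sadd_eq_None[OF Q T(1)] by blast
    with sadd_in_pts[OF Q T(1)] obtain xE yE where E: "sadd A Q T = Some (xE, yE)" "on xE yE"
      by (cases rule: pts_cases) simp_all
    have "T \<noteq> sadd A (sneg Q) P" "T \<noteq> sadd A (sneg Q) (sneg P)"
      using T(2) by (auto simp: F_def)
    then have "Some (xE, yE) \<noteq> P" "Some (xE, yE) \<noteq> sneg P"
      using sadd_cancel_left[OF Q T(1)] E(1) by metis+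
    then have "xP \<noteq> xE" using on_same_x[OF affine(3), of yE] E(2) affine(1) by auto
    moreover have "xP \<noteq> xT"
      using on_same_x[OF affine(3), of yT] T(2) xT affine(1) by (auto simp: F_def)
    moreover have "xT \<noteq> xD"
      using on_same_x[OF affine(5), of yT] T(2) xT affine(7)
      by (auto simp: F_def simp del: sadd.simps(3))
    ultimately show ?thesis
      using sadd_assoc_generic[OF affine(3,4) xT(2), of xD "- yD'" xE yE] affine(1,2,7) E(1) xT(1)
      by (simp del: sadd.simps(3))
  qed
  moreover have "finite F" by (simp add: F_def)
  ultimately show ?thesis by blast
qed

lemma sadd_cancel_right:
  assumes "P \<in> pts" "Q \<in> pts" "T \<in> pts" "sadd A P T = sadd A Q T"
  shows "P = Q"
  using assms sadd_cancel_left[of T P] sadd_cancel_left[of T Q] sadd_commute by metis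

text \<open>After adding a point \<open>T\<close> outside a finite set to both sides, only instances with a
  generic last summand are needed.\<close>

lemma sadd_assoc:
  assumes inf: "infinite pts" and P: "P \<in> pts" and Q: "Q \<in> pts" and R: "R \<in> pts"
  shows "sadd A (sadd A P Q) R = sadd A P (sadd A Q R)"
proof -
  obtain F1 where F1: "finite F1"
    "\<And>T. T \<in> pts - F1 \<Longrightarrow> sadd A (sadd A (sadd A P Q) R) T = sadd A (sadd A P Q) (sadd A R T)"
    using sadd_assoc_cofinite[of "sadd A P Q" R] P Q R by auto
  obtain F2 where F2: "finite F2"
    "\<And>T. T \<in> pts - F2 \<Longrightarrow> sadd A (sadd A P Q) T = sadd A P (sadd A Q T)"
    using sadd_assoc_cofinite[of P Q] P Q by auto
  obtain F3 where F3: "finite F3"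
    "\<And>T. T \<in> pts - F3 \<Longrightarrow> sadd A (sadd A Q R) T = sadd A Q (sadd A R T)"
    using sadd_assoc_cofinite[of Q R] Q R by auto
  obtain F4 where F4: "finite F4"
    "\<And>T. T \<in> pts - F4 \<Longrightarrow> sadd A (sadd A P (sadd A Q R)) T = sadd A P (sadd A (sadd A Q R) T)"
    using sadd_assoc_cofinite[of P "sadd A Q R"] P Q R by auto
  have "finite (F1 \<union> sadd A (sneg R) ` F2 \<union> F3 \<union> F4)" using F1 F2 F3 F4 by simp
  then obtain T where T: "T \<in> pts" "T \<notin> F1 \<union> sadd A (sneg R) ` F2 \<union> F3 \<union> F4"
    using inf by (meson finite_subset subsetI)
  have "sadd A R T \<notin> F2" using T(2) sadd_cancel_left[OF R T(1)] by (metis UnCI imageI)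
  then have "sadd A (sadd A P Q) (sadd A R T) = sadd A P (sadd A Q (sadd A R T))"
    using F2(2) R T(1) by simp
  then have "sadd A (sadd A (sadd A P Q) R) T = sadd A (sadd A P (sadd A Q R)) T"
    using F1(2) F3(2) F4(2) T by simp
  then show ?thesis using sadd_cancel_right P Q R T(1) by (meson sadd_in_pts)
qed

end

section \<open>Rational points as a commutative group, by way of real points\<close>

lemma infinite_real_pts:
  fixes A B :: real
  assumes "short_curve A B"
  shows "infinite (short_curve.pts A B)"
proof
  interpret short_curve A B by fact
  assume fin: "finite pts"
  define K where "K = 1 + \<bar>A\<bar> + \<bar>B\<bar>"
  let ?f = "\<lambda>x. Some (x, sqrt (x ^ 3 + A * x + B))"
  have "?f x \<in> pts" if "x \<ge> K" for x
  proof -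
    have x: "x \<ge> 1" using that K_def by simp
    have "\<bar>A * x + B\<bar> \<le> \<bar>A\<bar> * x + \<bar>B\<bar> * x"
      using x abs_triangle_ineq[of "A * x" B] mult_left_mono[of 1 x "\<bar>B\<bar>"] by (simp add: abs_mult)
    also have "\<dots> \<le> K * x" using x by (simp add: K_def algebra_simps)
    also have "\<dots> \<le> x * x" using x that by (intro mult_right_mono) auto
    also have "\<dots> \<le> x ^ 3" using x by (simp add: power3_eq_cube mult_le_cancel_left1)
    finally show ?thesis by (simp add: on_def)
  qed
  then have "?f ` {K..} \<subseteq> pts" by auto
  then have "finite (?f ` {K..})" using fin finite_subset by blast
  moreover have "inj_on ?f {K..}" by (auto simp: inj_on_def)
  ultimately have "finite {K..}" using finite_imageD by blast
  then show False using infinite_Ici by blast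
qed

definition curve_group :: "rat \<Rightarrow> rat \<Rightarrow> rat pt monoid" where
  "curve_group A B = \<lparr>carrier = short_curve.pts A B, mult = sadd A, one = None\<rparr>"

fun pt_real :: "rat pt \<Rightarrow> real pt" where
  "pt_real None = None"
| "pt_real (Some (x, y)) = Some (of_rat x, of_rat y)"

lemma pt_real_eq_iff: "pt_real P = pt_real Q \<longleftrightarrow> P = Q"
  by (cases P rule: pt_real.cases; cases Q rule: pt_real.cases) auto

lemma of_rat_slope: "of_rat (slope A x1 y1 x2 y2) =
    slope (of_rat A) (of_rat x1) (of_rat y1) (of_rat x2) (of_rat y2 :: real)"
  by (simp add: slope_def of_rat_divide of_rat_diff of_rat_add of_rat_mult of_rat_power)

lemma pt_real_sadd: "pt_real (sadd A P Q) = sadd (of_rat A) (pt_real P) (pt_real Q)"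
proof (cases "P = None \<or> Q = None")
  case False
  then obtain x1 y1 x2 y2 where PQ: "P = Some (x1, y1)" "Q = Some (x2, y2)" by auto
  have "(of_rat y1 + of_rat y2 = (0::real)) \<longleftrightarrow> y1 + y2 = 0"
    by (metis of_rat_add of_rat_eq_0_iff)
  then show ?thesis unfolding PQ
    by (simp add: Let_def of_rat_slope[symmetric] of_rat_diff of_rat_add of_rat_mult
        of_rat_power of_rat_minus)
qed auto

text \<open>\<open>sadd_assoc\<close> draws on infinitely many points, and a curve may have few
  rational ones. Associativity is therefore taken from the reals, where every large \<open>x\<close>
  carries a point, and pulled back along the injective \<open>pt_real\<close>.\<close>

lemma comm_group_curve_group:
  assumes "short_curve A B"
  shows "comm_group (curve_group A B)"
proof -
  interpret short_curve A B by fact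
  have "(of_rat (4 * A ^ 3 + 27 * B\<^sup>2) :: real) \<noteq> 0" using nonsingular by simp
  then have R: "short_curve (of_rat A) (of_rat B :: real)"
    by unfold_locales (simp add: of_rat_add of_rat_mult of_rat_power)
  interpret R: short_curve "of_rat A" "of_rat B :: real" by (rule R)
  have emb: "pt_real P \<in> R.pts" if "P \<in> pts" for P
  proof (use that in \<open>cases rule: pts_cases\<close>)
    case (Some x y)
    then have "(of_rat (y\<^sup>2) :: real) = of_rat (x ^ 3 + A * x + B)" by (simp add: on_def)
    then show ?thesis using Some
      by (simp add: R.on_def of_rat_add of_rat_mult of_rat_power)
  qed auto
  have assoc: "sadd A (sadd A P Q) T = sadd A P (sadd A Q T)"
    if "P \<in> pts" "Q \<in> pts" "T \<in> pts" for P Q T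
    using R.sadd_assoc[OF infinite_real_pts[OF R] emb emb emb, OF that]
    by (simp add: pt_real_sadd[symmetric] pt_real_eq_iff)
  show ?thesis
    unfolding curve_group_def
  proof (rule comm_groupI, simp_all add: assoc)
    show "sadd A x y = sadd A y x" if "x \<in> pts" "y \<in> pts" for x y
      using that by (rule sadd_commute)
    show "\<exists>y \<in> pts. sadd A y x = None" if "x \<in> pts" for x
      using that sadd_sneg[of "sneg x"] by (intro bexI[of _ "sneg x"]) auto
  qed
qed

section \<open>Naive heights\<close>

context short_curve
begin

text \<open>The squared slopes towards \<open>Q\<close> and \<open>- Q\<close> differ in the sign of
  \<open>y1 y2\<close>, so in sum and product only \<open>y1^2\<close> and \<open>y2^2\<close>
  remain, and the curve equation eliminates them. Serves both the height inequality and the 5-adic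
  formula \<open>kernel_add\<close>.\<close>

lemma xcoord_sum_diff:
  assumes "on x1 y1" "on x2 y2" and ne: "x1 \<noteq> x2"
    and P: "sadd A (Some (x1, y1)) (Some (x2, y2)) = Some (x3, y3)"
    and Q: "sadd A (Some (x1, y1)) (Some (x2, - y2)) = Some (x4, y4)"
  shows "(x3 + x4) * (x1 - x2)\<^sup>2 = 2 * ((x1 + x2) * (A + x1 * x2) + 2 * B)"
    and "(x3 * x4) * (x1 - x2)\<^sup>2 = (x1 * x2 - A)\<^sup>2 - 4 * B * (x1 + x2)"
proof -
  have y: "y1\<^sup>2 = x1 ^ 3 + A * x1 + B" "y2\<^sup>2 = x2 ^ 3 + A * x2 + B"
    using assms by (auto simp: on_def)
  define l where "l = (y2 - y1) / (x2 - x1)"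
  define m where "m = (- y2 - y1) / (x2 - x1)"
  have l: "l * (x1 - x2) = y1 - y2" and m: "m * (x1 - x2) = y1 + y2"
    using ne by (simp_all add: l_def m_def field_simps)
  have x3: "x3 = l\<^sup>2 - x1 - x2" and x4: "x4 = m\<^sup>2 - x1 - x2"
    using P Q ne by (auto simp: slope_def Let_def l_def m_def)
  have l2: "l\<^sup>2 * (x1 - x2)\<^sup>2 = (y1 - y2)\<^sup>2" and m2: "m\<^sup>2 * (x1 - x2)\<^sup>2 = (y1 + y2)\<^sup>2"
    using l m by (simp_all add: power_mult_distrib[symmetric])
  show "(x3 + x4) * (x1 - x2)\<^sup>2 = 2 * ((x1 + x2) * (A + x1 * x2) + 2 * B)"
    unfolding x3 x4 using l2 m2 y by algebra
  define D where "D = (x1 - x2)\<^sup>2"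
  have x3': "x3 * D = (y1 - y2)\<^sup>2 - (x1 + x2) * D" and x4': "x4 * D = (y1 + y2)\<^sup>2 - (x1 + x2) * D"
    unfolding x3 x4 D_def using l2 m2 by algebra+
  have "D * (x3 * x4 * D) = (x3 * D) * (x4 * D)" by (simp add: ac_simps)
  also have "\<dots> = (y1\<^sup>2 - y2\<^sup>2)\<^sup>2 - 2 * (y1\<^sup>2 + y2\<^sup>2) * ((x1 + x2) * D) + ((x1 + x2) * D)\<^sup>2"
    unfolding x3' x4' by algebra
  also have "\<dots> = D * ((x1 * x2 - A)\<^sup>2 - 4 * B * (x1 + x2))"
    unfolding y D_def by algebra
  finally show "(x3 * x4) * (x1 - x2)\<^sup>2 = (x1 * x2 - A)\<^sup>2 - 4 * B * (x1 + x2)"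
    using ne by (simp add: D_def)
qed

lemma xcoord_double:
  assumes "on x y" "y \<noteq> 0" "sadd A (Some (x, y)) (Some (x, y)) = Some (x', y')"
  shows "x' * (4 * (x ^ 3 + A * x + B)) = x ^ 4 - 2 * A * x\<^sup>2 - 8 * B * x + A\<^sup>2"
proof -
  have y: "y\<^sup>2 = x ^ 3 + A * x + B" using assms by (simp add: on_def)
  define l where "l = (3 * x\<^sup>2 + A) / (2 * y)"
  have l: "l * (2 * y) = 3 * x\<^sup>2 + A" using assms by (simp add: l_def)
  have x': "x' = l\<^sup>2 - x - x"
    using assms by (auto simp: slope_def Let_def l_def split: if_splits)
  have "l\<^sup>2 * (4 * y\<^sup>2) = (3 * x\<^sup>2 + A)\<^sup>2"
    unfolding l[symmetric] by (simp add: power_mult_distrib)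
  then show ?thesis unfolding x' y by algebra
qed

end

section \<open>Elementary estimates for the Weil height\<close>

lemma wheight_nonneg: "wheight q \<ge> 0"
proof -
  obtain a b where ab: "quotient_of q = (a, b)" by (cases "quotient_of q")
  then have "b > 0" using quotient_of_denom_pos by blast
  then show ?thesis using ab by (simp add: wheight_def)
qed

lemma wheight_of_int: "wheight (of_int n) = ln (max (real_of_int \<bar>n\<bar>) 1)"
  by (simp add: wheight_def of_int_max)

lemma quotient_cancel:
  fixes n d a b :: int
  assumes "quotient_of (of_int n / of_int d) = (a, b)" "d \<noteq> 0"
  obtains k where "k \<noteq> 0" "n = a * k" "d = b * k"
proof -
  have b: "b > 0" and cop: "coprime a b"
    using assms quotient_of_denom_pos quotient_of_coprime by blast+
  have "of_int n / of_int d = (of_int a / of_int b :: rat)" using assms quotient_of_div by blast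
  then have "(of_int (n * b) :: rat) = of_int (a * d)" using assms b by (simp add: field_simps)
  then have eq: "n * b = a * d" by (simp only: of_int_eq_iff)
  then have "b dvd a * d" by (metis dvd_triv_right)
  then have "b dvd d" using cop by (simp add: coprime_commute coprime_dvd_mult_right_iff)
  then obtain k where k: "d = b * k" by blast
  then have "n = a * k" using eq b by (simp add: algebra_simps)
  then show ?thesis using k that assms by auto
qed

lemma wheight_quotient_le:
  assumes "d \<noteq> 0" "\<bar>real_of_int n\<bar> \<le> K" "\<bar>real_of_int d\<bar> \<le> K"
  shows "wheight (of_int n / of_int d) \<le> ln K"
proof -
  obtain a b where ab: "quotient_of (of_int n / of_int d) = (a, b)" by (cases "quotient_of (of_int n / of_int d)")
  then have b: "b > 0" using quotient_of_denom_pos by blast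
  obtain k where k: "k \<noteq> 0" "n = a * k" "d = b * k" using quotient_cancel[OF ab assms(1)] .
  have "\<bar>a\<bar> * 1 \<le> \<bar>n\<bar>" "\<bar>b\<bar> * 1 \<le> \<bar>d\<bar>"
    unfolding k(2,3) abs_mult using k(1) by (intro mult_left_mono; simp)+
  then have "real_of_int (max \<bar>a\<bar> \<bar>b\<bar>) \<le> K" using assms(2,3) by linarith
  then show ?thesis using ab b by (simp add: wheight_def)
qed

text \<open>Gauss's lemma for the product of the linear forms \<open>b X + a Y\<close> and \<open>d X + c Y\<close>.\<close>

lemma coprime_symmetric_functions:
  fixes a b c d :: int
  assumes "coprime a b" "coprime c d" "b \<noteq> 0" "d \<noteq> 0"
  shows "gcd (b * d) (gcd (a * d + c * b) (a * c)) = 1"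
proof (rule ccontr)
  let ?g = "gcd (b * d) (gcd (a * d + c * b) (a * c))"
  assume "?g \<noteq> 1"
  then have "\<not> is_unit ?g" by simp
  moreover have "?g \<noteq> 0" using assms by simp
  ultimately obtain p where p: "prime p" "p dvd ?g" using prime_divisor_exists by blast
  then have d: "p dvd b * d" "p dvd a * d + c * b" "p dvd a * c" by auto
  show False
  proof (cases "p dvd b")
    case True
    then have "\<not> p dvd a" using assms(1) p(1) by (meson coprime_common_divisor not_prime_unit)
    then have "p dvd c" using d(3) p(1) by (simp add: prime_dvd_mult_iff)
    then have "\<not> p dvd d" using assms(2) p(1) by (meson coprime_common_divisor not_prime_unit)
    have "p dvd a * d" using d(2) True by (metis dvd_add_left_iff dvd_mult)
    then show False using p(1) \<open>\<not> p dvd a\<close> \<open>\<not> p dvd d\<close> by (simp add: prime_dvd_mult_iff)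
  next
    case False
    then have "p dvd d" using d(1) p(1) by (simp add: prime_dvd_mult_iff)
    then have "\<not> p dvd c" using assms(2) p(1) by (meson coprime_common_divisor not_prime_unit)
    have "p dvd c * b" using d(2) \<open>p dvd d\<close> by (metis dvd_add_right_iff dvd_mult)
    then show False using p(1) \<open>\<not> p dvd c\<close> False by (simp add: prime_dvd_mult_iff)
  qed
qed

lemma max_mult_max_le:
  fixes a b c d K :: real
  assumes "\<bar>b * d\<bar> \<le> K" "\<bar>a * d + c * b\<bar> \<le> K" "\<bar>a * c\<bar> \<le> K"
  shows "max \<bar>a\<bar> \<bar>b\<bar> * max \<bar>c\<bar> \<bar>d\<bar> \<le> 2 * K"
proof -
  have K: "K \<ge> 0" using assms(1) by linarith
  \<comment> \<open>The terms \<open>a d\<close> and \<open>c b\<close> are controlled only through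
    their sum and product: if one exceeded \<open>2 K\<close>, the other would exceed
    \<open>K\<close>, and the product would be too large.\<close>
  have mixed: "\<bar>x\<bar> \<le> 2 * K" if "\<bar>x + y\<bar> \<le> K" "\<bar>x * y\<bar> \<le> K * K" for x y :: real
  proof (rule ccontr)
    assume *: "\<not> ?thesis"
    then have "\<bar>y\<bar> > K" using that(1) by linarith
    then have "(K + K) * K < \<bar>x\<bar> * \<bar>y\<bar>" using * K by (intro mult_strict_mono') auto
    then have "K * K + K * K < \<bar>x\<bar> * \<bar>y\<bar>" by (simp only: distrib_right)
    moreover have "\<bar>x\<bar> * \<bar>y\<bar> \<le> K * K" using that(2) by (simp only: abs_mult)
    moreover have "K * K \<ge> 0" using K by simp
    ultimately show False by linarith
  qed
  have prod: "\<bar>a * d * (c * b)\<bar> \<le> K * K"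
  proof -
    have "\<bar>a * d * (c * b)\<bar> = \<bar>a * c\<bar> * \<bar>b * d\<bar>" by (simp add: abs_mult)
    also have "\<dots> \<le> K * K" using assms K by (intro mult_mono) auto
    finally show ?thesis .
  qed
  have "\<bar>a * d\<bar> \<le> 2 * K" "\<bar>c * b\<bar> \<le> 2 * K"
    using mixed[of "a * d" "c * b"] mixed[of "c * b" "a * d"] assms(2) prod
    by (simp_all add: add.commute mult.commute)
  then have "\<bar>a\<bar> * \<bar>c\<bar> \<le> 2 * K" "\<bar>a\<bar> * \<bar>d\<bar> \<le> 2 * K" "\<bar>b\<bar> * \<bar>c\<bar> \<le> 2 * K" "\<bar>b\<bar> * \<bar>d\<bar> \<le> 2 * K"
    using assms K by (simp_all add: abs_mult[symmetric] mult.commute)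
  then show ?thesis by (auto simp: max_def)
qed

text \<open>\<open>(b d, a d + c b, a c)\<close> are projective coordinates of the unordered pair.
  They are primitive by \<open>coprime_symmetric_functions\<close>, so \<open>(v, s, p)\<close> is
  an integer multiple of them, and bounds on it pass to them whatever the common factor is.\<close>

lemma wheight_pair_le:
  fixes v s p :: int
  assumes v: "v \<noteq> 0" and sum: "(x + y) * of_int v = of_int s" and prod: "x * y * of_int v = of_int p"
    and K: "\<bar>real_of_int v\<bar> \<le> K" "\<bar>real_of_int s\<bar> \<le> K" "\<bar>real_of_int p\<bar> \<le> K"
  shows "wheight x + wheight y \<le> ln (2 * K)"
proof -
  obtain a b where ab: "quotient_of x = (a, b)" by (cases "quotient_of x")
  obtain c d where cd: "quotient_of y = (c, d)" by (cases "quotient_of y")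
  have pos: "b > 0" "d > 0" using ab cd quotient_of_denom_pos by blast+
  have cop: "coprime a b" "coprime c d" using ab cd quotient_of_coprime by blast+
  have xy: "x = of_int a / of_int b" "y = of_int c / of_int d" using ab cd quotient_of_div by blast+
  let ?v = "b * d" and ?s = "a * d + c * b" and ?p = "a * c"
  have "(of_int (v * ?s) :: rat) = of_int (s * ?v)" "(of_int (v * ?p) :: rat) = of_int (p * ?v)"
    using sum prod pos by (simp_all add: xy field_simps)
  then have e: "v * ?s = s * ?v" "v * ?p = p * ?v" by (simp_all only: of_int_eq_iff)
  have gcd: "w dvd v * gcd m n" if "w dvd v * m" "w dvd v * n" for w m n :: int
    using that gcd_mult_distrib_int[of v m n] by (metis abs_dvd_iff abs_mult gcd_greatest dvd_abs_iff abs_gcd_int)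
  have "?v dvd v * gcd ?v (gcd ?s ?p)" by (intro gcd) (simp_all add: e)
  also have "gcd ?v (gcd ?s ?p) = 1" using cop pos by (intro coprime_symmetric_functions) auto
  finally obtain k where k: "v = ?v * k" by auto
  then have k0: "k \<noteq> 0" using v by auto
  have "?v * s = ?v * (?s * k)" using e(1) by (subst (asm) k) (simp only: ac_simps)
  moreover have "?v * p = ?v * (?p * k)" using e(2) by (subst (asm) k) (simp only: ac_simps)
  ultimately have s: "s = ?s * k" and p: "p = ?p * k" using pos by simp_all
  have le: "\<bar>real_of_int m\<bar> \<le> K" if "\<bar>real_of_int (m * k)\<bar> \<le> K" for m
  proof -
    have "\<bar>m\<bar> * 1 \<le> \<bar>m\<bar> * \<bar>k\<bar>" using k0 by (intro mult_left_mono) auto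
    then have "\<bar>m\<bar> \<le> \<bar>m * k\<bar>" by (simp add: abs_mult)
    then show ?thesis using that by linarith
  qed
  have "max \<bar>real_of_int a\<bar> \<bar>real_of_int b\<bar> * max \<bar>real_of_int c\<bar> \<bar>real_of_int d\<bar> \<le> 2 * K"
    using le[of ?v] le[of ?s] le[of ?p] K unfolding k[symmetric] s[symmetric] p[symmetric]
    by (intro max_mult_max_le) simp_all
  moreover have pos': "max \<bar>real_of_int a\<bar> \<bar>real_of_int b\<bar> > 0" "max \<bar>real_of_int c\<bar> \<bar>real_of_int d\<bar> > 0"
    using pos by (simp_all add: less_max_iff_disj)
  moreover have "wheight x + wheight y
      = ln (max \<bar>real_of_int a\<bar> \<bar>real_of_int b\<bar> * max \<bar>real_of_int c\<bar> \<bar>real_of_int d\<bar>)"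
    using ab cd pos' by (simp add: wheight_def ln_mult of_int_max)
  moreover have "max \<bar>real_of_int a\<bar> \<bar>real_of_int b\<bar> * max \<bar>real_of_int c\<bar> \<bar>real_of_int d\<bar> > 0"
    using pos' by (rule mult_pos_pos)
  ultimately show ?thesis by (metis ln_le_cancel_iff order_less_le_trans)
qed

text \<open>For a point \<open>(x, y)\<close> and \<open>x = a/b\<close>, the double has \<open>x\<close>-coordinate \<open>dup_num/dup_den\<close>.\<close>

definition dup_num :: "int \<Rightarrow> int \<Rightarrow> int \<Rightarrow> int \<Rightarrow> int" where
  "dup_num A B a b = a ^ 4 - 2 * A * a\<^sup>2 * b\<^sup>2 - 8 * B * a * b ^ 3 + A\<^sup>2 * b ^ 4"

definition dup_den :: "int \<Rightarrow> int \<Rightarrow> int \<Rightarrow> int \<Rightarrow> int" where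
  "dup_den A B a b = 4 * (a ^ 3 * b + A * a * b ^ 3 + B * b ^ 4)"

text \<open>Bezout identities between the duplication forms, eliminating \<open>a\<close> here and
  \<open>b\<close> in the next lemma. They serve twice: a common factor of the two values divides
  \<open>4 (4 A^3 + 27 B^2)\<close>, and the two values cannot both be small.\<close>

lemma dup_resultant_b:
  "(12 * a\<^sup>2 * b + 16 * A * b ^ 3) * dup_num A B a b
     - (3 * a ^ 3 - 5 * A * a * b\<^sup>2 - 27 * B * b ^ 3) * dup_den A B a b
   = 4 * (4 * A ^ 3 + 27 * B\<^sup>2) * b ^ 7"
  unfolding dup_num_def dup_den_def by algebra

lemma dup_resultant_a:
  "(4 * (4 * A ^ 3 + 27 * B\<^sup>2) * a ^ 3 - 4 * A\<^sup>2 * B * a\<^sup>2 * b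
      + 4 * A * (3 * A ^ 3 + 22 * B\<^sup>2) * a * b\<^sup>2 + 12 * B * (A ^ 3 + 8 * B\<^sup>2) * b ^ 3) * dup_num A B a b
     + (A\<^sup>2 * B * a ^ 3 + A * (5 * A ^ 3 + 32 * B\<^sup>2) * a\<^sup>2 * b
      + 2 * B * (13 * A ^ 3 + 96 * B\<^sup>2) * a * b\<^sup>2 - 3 * A\<^sup>2 * (A ^ 3 + 8 * B\<^sup>2) * b ^ 3) * dup_den A B a b
   = 4 * (4 * A ^ 3 + 27 * B\<^sup>2) * a ^ 7"
  unfolding dup_num_def dup_den_def by algebra

lemma abs_intros:
  fixes x y X Y :: real
  shows "\<bar>x\<bar> \<le> X \<Longrightarrow> \<bar>y\<bar> \<le> Y \<Longrightarrow> \<bar>x + y\<bar> \<le> X + Y"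
    and "\<bar>x\<bar> \<le> X \<Longrightarrow> \<bar>y\<bar> \<le> Y \<Longrightarrow> \<bar>x - y\<bar> \<le> X + Y"
    and "\<bar>x\<bar> \<le> X \<Longrightarrow> \<bar>y\<bar> \<le> Y \<Longrightarrow> \<bar>x * y\<bar> \<le> X * Y"
    and "\<bar>x\<bar> \<le> X \<Longrightarrow> \<bar>x ^ n\<bar> \<le> X ^ n"
    and "\<bar>numeral k\<bar> \<le> (numeral k :: real)"
  by (auto simp: abs_mult power_abs intro: mult_mono power_mono)

lemma abs_dup_le:
  fixes A B a b :: int and M H :: real
  assumes M: "M \<ge> 1" "\<bar>real_of_int A\<bar> \<le> M" "\<bar>real_of_int B\<bar> \<le> M"
    and H: "\<bar>real_of_int a\<bar> \<le> H" "\<bar>real_of_int b\<bar> \<le> H"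
  shows "\<bar>real_of_int (dup_num A B a b)\<bar> \<le> 12 * M\<^sup>2 * H ^ 4"
    and "\<bar>real_of_int (dup_den A B a b)\<bar> \<le> 12 * M\<^sup>2 * H ^ 4"
proof -
  have M2: "1 \<le> M\<^sup>2" "M \<le> M\<^sup>2" using M(1) by (simp_all add: self_le_power)
  have "\<bar>real_of_int (dup_num A B a b)\<bar> \<le> H ^ 4 + 2 * M * H\<^sup>2 * H\<^sup>2 + 8 * M * H * H ^ 3 + M\<^sup>2 * H ^ 4"
    unfolding dup_num_def of_int_add of_int_diff of_int_mult of_int_power of_int_numeral
    by (intro abs_intros M H)
  also have "\<dots> = (1 + 10 * M + M\<^sup>2) * H ^ 4" by algebra
  also have "\<dots> \<le> (12 * M\<^sup>2) * H ^ 4" using M2 by (intro mult_right_mono) auto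
  finally show "\<bar>real_of_int (dup_num A B a b)\<bar> \<le> 12 * M\<^sup>2 * H ^ 4" .
  have "\<bar>real_of_int (dup_den A B a b)\<bar> \<le> 4 * (H ^ 3 * H + M * H * H ^ 3 + M * H ^ 4)"
    unfolding dup_den_def of_int_add of_int_diff of_int_mult of_int_power of_int_numeral
    by (intro abs_intros M H)
  also have "\<dots> = (4 + 8 * M) * H ^ 4" by algebra
  also have "\<dots> \<le> (12 * M\<^sup>2) * H ^ 4" using M2 by (intro mult_right_mono) auto
  finally show "\<bar>real_of_int (dup_den A B a b)\<bar> \<le> 12 * M\<^sup>2 * H ^ 4" .
qed

lemma dup_lower:
  fixes A B a b :: int and M H K :: real
  assumes M: "M \<ge> 1" "\<bar>real_of_int A\<bar> \<le> M" "\<bar>real_of_int B\<bar> \<le> M"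
    and H: "H = max \<bar>real_of_int a\<bar> \<bar>real_of_int b\<bar>" "H > 0"
    and K: "\<bar>real_of_int (dup_num A B a b)\<bar> \<le> K" "\<bar>real_of_int (dup_den A B a b)\<bar> \<le> K"
  shows "4 * \<bar>real_of_int (4 * A ^ 3 + 27 * B\<^sup>2)\<bar> * H ^ 4 \<le> 700 * M ^ 5 * K"
proof -
  have h: "\<bar>real_of_int a\<bar> \<le> H" "\<bar>real_of_int b\<bar> \<le> H" using H by auto
  have K0: "K \<ge> 0" using K by linarith
  have Mp: "M ^ i \<le> M ^ 5" if "i \<le> 5" for i using M(1) that by (intro power_increasing) auto
  note P = Mp[of 1] Mp[of 2] Mp[of 3] Mp[of 4]
  let ?D = "4 * A ^ 3 + 27 * B\<^sup>2"
  have "\<bar>real_of_int (4 * ?D * b ^ 7)\<bar>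
      \<le> (12 * H\<^sup>2 * H + 16 * M * H ^ 3) * K + (3 * H ^ 3 + 5 * M * H * H\<^sup>2 + 27 * M * H ^ 3) * K"
    unfolding dup_resultant_b[of a b A B, symmetric] of_int_add of_int_diff of_int_mult of_int_power of_int_numeral
    by (intro abs_intros M h K)
  also have "\<dots> = (15 + 48 * M) * (H ^ 3 * K)" by algebra
  also have "\<dots> \<le> (700 * M ^ 5) * (H ^ 3 * K)"
    using P M(1) K0 H by (intro mult_right_mono) auto
  finally have b: "\<bar>real_of_int (4 * ?D * b ^ 7)\<bar> \<le> 700 * M ^ 5 * (H ^ 3 * K)" .
  have "\<bar>real_of_int (4 * ?D * a ^ 7)\<bar>
      \<le> (4 * (4 * M ^ 3 + 27 * M\<^sup>2) * H ^ 3 + 4 * M\<^sup>2 * M * H\<^sup>2 * H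
      + 4 * M * (3 * M ^ 3 + 22 * M\<^sup>2) * H * H\<^sup>2 + 12 * M * (M ^ 3 + 8 * M\<^sup>2) * H ^ 3) * K
     + (M\<^sup>2 * M * H ^ 3 + M * (5 * M ^ 3 + 32 * M\<^sup>2) * H\<^sup>2 * H
      + 2 * M * (13 * M ^ 3 + 96 * M\<^sup>2) * H * H\<^sup>2 + 3 * M\<^sup>2 * (M ^ 3 + 8 * M\<^sup>2) * H ^ 3) * K"
    unfolding dup_resultant_a[of A B a b, symmetric] of_int_add of_int_diff of_int_mult of_int_power of_int_numeral
    by (intro abs_intros M h K)
  also have "\<dots> = (3 * M ^ 5 + 79 * M ^ 4 + 429 * M ^ 3 + 108 * M\<^sup>2) * (H ^ 3 * K)" by algebra
  \<comment> \<open>Raising every power of \<open>M\<close> to \<open>M ^ 5\<close> gives the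
    coefficient 3 + 79 + 429 + 108 = 619, rounded up to 700.\<close>
  also have "\<dots> \<le> (700 * M ^ 5) * (H ^ 3 * K)"
    using P M(1) K0 H by (intro mult_right_mono) auto
  finally have a: "\<bar>real_of_int (4 * ?D * a ^ 7)\<bar> \<le> 700 * M ^ 5 * (H ^ 3 * K)" .
  have "H ^ 7 = \<bar>real_of_int a\<bar> ^ 7 \<or> H ^ 7 = \<bar>real_of_int b\<bar> ^ 7" using H(1) by (auto simp: max_def)
  then have "4 * \<bar>real_of_int ?D\<bar> * H ^ 7 \<le> 700 * M ^ 5 * (H ^ 3 * K)"
    using a b by (elim disjE) (simp_all only: of_int_mult of_int_power abs_mult power_abs of_int_numeral abs_numeral)
  then have "H ^ 3 * (4 * \<bar>real_of_int ?D\<bar> * H ^ 4) \<le> H ^ 3 * (700 * M ^ 5 * K)"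
    by (simp add: ac_simps power_add[symmetric])
  then show ?thesis using H(2) by (simp only: mult_le_cancel_left_pos zero_less_power)
qed

section \<open>Height inequalities with error terms in \<open>ln M\<close>\<close>

locale integral_curve =
  fixes A B :: int and M :: real
  assumes disc: "4 * A ^ 3 + 27 * B\<^sup>2 \<noteq> 0"
    and M: "M \<ge> 2" "\<bar>real_of_int A\<bar> \<le> M" "\<bar>real_of_int B\<bar> \<le> M"
begin

sublocale short_curve "of_int A" "of_int B :: rat"
proof
  have "(of_int (4 * A ^ 3 + 27 * B\<^sup>2) :: rat) \<noteq> 0" using disc by (simp only: of_int_eq_0_iff) simp
  then show "4 * of_int A ^ 3 + 27 * (of_int B)\<^sup>2 \<noteq> (0::rat)" by simp
qed

abbreviation add :: "rat pt \<Rightarrow> rat pt \<Rightarrow> rat pt"  (infixl "\<oplus>" 65) where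
  "P \<oplus> Q \<equiv> sadd (of_int A) P Q"

abbreviation ht :: "rat pt \<Rightarrow> real" where
  "ht P \<equiv> wheight (xcoord P)"

lemma ln_700: "ln (700 * M ^ 5) \<le> 15 * ln M"
proof -
  \<comment> \<open>\<open>M \<ge> 2\<close> lets powers of \<open>M\<close> absorb numerical
    constants, so every error becomes a multiple of \<open>ln M\<close>.\<close>
  have "700 * M ^ 5 \<le> 2 ^ 10 * M ^ 5" using M by (intro mult_right_mono) auto
  also have "\<dots> \<le> M ^ 10 * M ^ 5" using M by (intro mult_right_mono power_mono) auto
  also have "\<dots> = M ^ 15" by (simp add: power_add[symmetric])
  finally have "ln (700 * M ^ 5) \<le> ln (M ^ 15)" using M by (subst ln_le_cancel_iff) auto
  also have "\<dots> = 15 * ln M" using M by (simp add: ln_realpow)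
  finally show ?thesis .
qed

lemma ht_double:
  assumes P: "P \<in> pts"
  shows "ht (P \<oplus> P) \<le> 4 * ht P + 15 * ln M" "ht (P \<oplus> P) \<ge> 4 * ht P - 15 * ln M"
proof -
  have lnM: "ln M \<ge> 0" using M by simp
  have *: "ht (P \<oplus> P) \<le> 4 * ht P + 15 * ln M \<and> ht (P \<oplus> P) \<ge> 4 * ht P - 15 * ln M"
  proof (cases P)
    case None
    then show ?thesis using lnM by (simp add: wheight_def)
  next
    case (Some p)
    then obtain x y where xy: "P = Some (x, y)" "on x y" using P by (auto simp: pts_def)
    obtain a b where ab: "quotient_of x = (a, b)" by (cases "quotient_of x")
    have b: "b > 0" and cop: "coprime a b" and x: "x = of_int a / of_int b"
      using ab quotient_of_denom_pos quotient_of_coprime quotient_of_div by blast+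
    define H where "H = max \<bar>real_of_int a\<bar> \<bar>real_of_int b\<bar>"
    have H: "H \<ge> 1" using b by (simp add: H_def max_def)
    have ht: "ht P = ln H" using ab xy by (simp add: wheight_def H_def of_int_max)
    let ?F = "dup_num A B a b" and ?G = "dup_den A B a b"
    have up: "\<bar>real_of_int ?F\<bar> \<le> 12 * M\<^sup>2 * H ^ 4" "\<bar>real_of_int ?G\<bar> \<le> 12 * M\<^sup>2 * H ^ 4"
      by (rule abs_dup_le; use M in \<open>simp add: H_def\<close>)+
    have G: "of_int ?G = 4 * (x ^ 3 + of_int A * x + of_int B) * of_int b ^ 4"
      unfolding dup_den_def x using b by (simp add: field_simps power_numeral_reduce)
    have F: "of_int ?F = (x ^ 4 - 2 * of_int A * x\<^sup>2 - 8 * of_int B * x + (of_int A)\<^sup>2) * of_int b ^ 4"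
      unfolding dup_num_def x using b by (simp add: field_simps power_numeral_reduce)
    let ?D = "4 * A ^ 3 + 27 * B\<^sup>2"
    have D: "\<bar>real_of_int ?D\<bar> > 0" using disc by linarith
    have dvd: "k dvd 4 * ?D" if "k dvd ?F" "k dvd ?G" for k
    proof -
      have "k dvd 4 * ?D * a ^ 7" "k dvd 4 * ?D * b ^ 7"
        unfolding dup_resultant_a[of A B a b, symmetric] dup_resultant_b[of a b A B, symmetric]
        using that by simp_all
      then have "k dvd gcd (4 * ?D * a ^ 7) (4 * ?D * b ^ 7)" by simp
      also have "gcd (4 * ?D * a ^ 7) (4 * ?D * b ^ 7) = \<bar>4 * ?D\<bar> * gcd (a ^ 7) (b ^ 7)"
        by (rule gcd_mult_distrib_int[symmetric])
      also have "gcd (a ^ 7) (b ^ 7) = 1" using cop by simp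
      finally show ?thesis by simp
    qed
    \<comment> \<open>The factor \<open>4 |D|\<close> in \<open>dup_lower\<close> cancels against
      the bound \<open>|4 D|\<close> for a common divisor \<open>k\<close>, so the discriminant
      disappears from the estimate.\<close>
    have low: "H ^ 4 \<le> 700 * M ^ 5 * N"
      if k: "k dvd ?F" "k dvd ?G" and N: "\<bar>real_of_int ?F\<bar> \<le> \<bar>k\<bar> * N" "\<bar>real_of_int ?G\<bar> \<le> \<bar>k\<bar> * N" "N \<ge> 0"
      for k :: int and N :: real
    proof -
      have "4 * \<bar>real_of_int ?D\<bar> * H ^ 4 \<le> 700 * M ^ 5 * (\<bar>k\<bar> * N)"
        by (rule dup_lower[OF _ _ _ H_def _ N(1,2)]) (use M H in auto)
      also have "\<bar>k\<bar> \<le> \<bar>4 * ?D\<bar>" using dvd[OF k] disc by (intro dvd_imp_le_int) auto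
      then have "real_of_int \<bar>k\<bar> \<le> real_of_int \<bar>4 * ?D\<bar>" by (simp only: of_int_le_iff)
      then have "700 * M ^ 5 * (\<bar>k\<bar> * N) \<le> 700 * M ^ 5 * (\<bar>4 * ?D\<bar> * N)"
        using M N(3) by (intro mult_left_mono mult_right_mono) auto
      finally have "4 * \<bar>real_of_int ?D\<bar> * H ^ 4 \<le> 700 * M ^ 5 * (real_of_int \<bar>4 * ?D\<bar> * N)" .
      also have "real_of_int \<bar>4 * ?D\<bar> = 4 * \<bar>real_of_int ?D\<bar>"
        by (simp only: of_int_abs of_int_mult of_int_numeral abs_mult abs_numeral)
      finally have "(4 * \<bar>real_of_int ?D\<bar>) * H ^ 4 \<le> (4 * \<bar>real_of_int ?D\<bar>) * (700 * M ^ 5 * N)"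
        by (simp only: ac_simps)
      then show ?thesis by (rule mult_left_le_imp_le) (use D in simp)
    qed
    have ln_le: "4 * ln H \<le> ln (700 * M ^ 5) + ln N" if "H ^ 4 \<le> 700 * M ^ 5 * N" for N
    proof -
      have "N > 0" using that H M by (smt (verit) one_le_power zero_less_mult_pos zero_less_power)
      have "4 * ln H = ln (H ^ 4)" using H by (simp add: ln_realpow)
      also have "\<dots> \<le> ln (700 * M ^ 5 * N)"
        using that H M \<open>N > 0\<close> by (subst ln_le_cancel_iff) (auto intro!: mult_pos_pos)
      also have "\<dots> = ln (700 * M ^ 5) + ln N" using M \<open>N > 0\<close> by (simp add: ln_mult)
      finally show ?thesis .
    qed
    show ?thesis
    proof (cases "y = 0")
      case True
      then have O: "P \<oplus> P = None" using xy by simp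
      have "x ^ 3 + of_int A * x + of_int B = 0" using xy True by (simp add: on_def)
      then have "(of_int ?G :: rat) = 0" unfolding G by simp
      then have "?G = 0" by (simp only: of_int_eq_0_iff)
      \<comment> \<open>As \<open>?G = 0\<close>, the value \<open>?F\<close> is itself a common
        divisor; \<open>N = 1\<close> corresponds to the height 0 of the point at infinity.\<close>
      then have "H ^ 4 \<le> 700 * M ^ 5 * 1" by (intro low[of ?F]) auto
      from ln_le[OF this] show ?thesis using O ht H lnM ln_700 by (simp add: wheight_def)
    next
      case False
      then obtain x' y' where xy': "P \<oplus> P = Some (x', y')" using xy by (auto simp: Let_def)
      from xcoord_double[OF xy(2) False] have
        "x' * (4 * (x ^ 3 + of_int A * x + of_int B)) =
          x ^ 4 - 2 * of_int A * x\<^sup>2 - 8 * of_int B * x + (of_int A)\<^sup>2"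
        using xy' xy(1) by blast
      then have "x' * of_int ?G = of_int ?F" unfolding F G by (simp only: mult.assoc[symmetric])
      moreover have G0: "?G \<noteq> 0"
      proof -
        have "x ^ 3 + of_int A * x + of_int B \<noteq> 0"
          using xy(2) False unfolding on_def by (metis power_eq_0_iff)
        then have "(of_int ?G :: rat) \<noteq> 0" unfolding G using b by simp
        then show ?thesis by simp
      qed
      ultimately have x': "x' = of_int ?F / of_int ?G" by (simp add: field_simps)
      have "ht (P \<oplus> P) \<le> ln (12 * M\<^sup>2 * H ^ 4)"
        using wheight_quotient_le[OF G0 up] x' xy' by simp
      also have "\<dots> \<le> ln (700 * M ^ 5 * H ^ 4)"
      proof (subst ln_le_cancel_iff)
        have "M\<^sup>2 \<le> M ^ 5" using M by (intro power_increasing) auto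
        then show "12 * M\<^sup>2 * H ^ 4 \<le> 700 * M ^ 5 * H ^ 4"
          using M by (intro mult_right_mono mult_mono) auto
      qed (use M H in auto)
      also have "\<dots> = ln (700 * M ^ 5) + 4 * ln H" using M H by (simp add: ln_mult ln_realpow)
      finally have 1: "ht (P \<oplus> P) \<le> 4 * ht P + 15 * ln M" using ht ln_700 by simp
      obtain u v where uv: "quotient_of x' = (u, v)" by (cases "quotient_of x'")
      then have "v > 0" using quotient_of_denom_pos by blast
      from quotient_cancel[OF uv[unfolded x'] G0] obtain k where
        k: "k \<noteq> 0" "?F = u * k" "?G = v * k" .
      define N where "N = max \<bar>real_of_int u\<bar> \<bar>real_of_int v\<bar>"
      have "H ^ 4 \<le> 700 * M ^ 5 * N"
      proof (rule low[of k])
        show "\<bar>real_of_int ?F\<bar> \<le> \<bar>k\<bar> * N" "\<bar>real_of_int ?G\<bar> \<le> \<bar>k\<bar> * N"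
          unfolding k(2,3) N_def 
          by (simp_all add: abs_mult mult.commute[of "\<bar>real_of_int k\<bar>"] mult_right_mono)
      qed (use k in \<open>auto simp: N_def\<close>)
      from ln_le[OF this] have "4 * ht P \<le> ln (700 * M ^ 5) + ht (P \<oplus> P)"
        using ht xy' uv by (simp add: wheight_def N_def of_int_max)
      then show ?thesis using 1 ln_700 by simp
    qed
  qed
  then show "ht (P \<oplus> P) \<le> 4 * ht P + 15 * ln M" "ht (P \<oplus> P) \<ge> 4 * ht P - 15 * ln M" by blast+
qed

text \<open>For naive heights only this direction is established;
  \<open>tate_limit_parallelogram\<close> obtains the other one in the limit from
  duplication.\<close>

lemma ht_parallelogram:
  assumes P: "P \<in> pts" and Q: "Q \<in> pts"
  shows "ht (P \<oplus> Q) + ht (P \<oplus> sneg Q) \<le> 2 * ht P + 2 * ht Q + 15 * ln M"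
proof -
  have lnM: "ln M \<ge> 0" using M by simp
  \<comment> \<open>The default \<open>xcoord None = 0\<close> has height \<open>ln 1 = 0\<close>,
    the value that the point at infinity should have.\<close>
  have ht0: "ht None = 0" by (simp add: wheight_def)
  have neg: "ht (sneg R) = ht R" for R by (cases R rule: sneg.cases) auto
  show ?thesis
  proof (cases "P = None \<or> Q = None")
    case True
    then show ?thesis using ht0 lnM neg wheight_nonneg[of "xcoord P"] wheight_nonneg[of "xcoord Q"] by auto
  next
    case False
    then obtain x1 y1 x2 y2 where PQ: "P = Some (x1, y1)" "on x1 y1" "Q = Some (x2, y2)" "on x2 y2"
      using P Q by (auto simp: pts_def)
    show ?thesis
    proof (cases "x1 = x2")
      case True
      then have "Q = P \<or> Q = sneg P" using on_same_x[OF PQ(2), of y2] PQ by auto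
      then have "ht (P \<oplus> Q) + ht (P \<oplus> sneg Q) = ht (P \<oplus> P) + ht None"
        using sadd_sneg[of P] by auto
      moreover have "ht Q = ht P" using True PQ by simp
      ultimately show ?thesis using ht_double[OF P] ht0 by simp
    next
      case ne: False
      obtain x3 y3 where R: "P \<oplus> Q = Some (x3, y3)" using ne PQ by (auto simp: Let_def)
      obtain x4 y4 where S: "P \<oplus> sneg Q = Some (x4, y4)" using ne PQ by (auto simp: Let_def)
      note xs = xcoord_sum_diff[OF PQ(2,4) ne R[unfolded PQ(1,3)] S[unfolded PQ(1,3) sneg.simps]]
      obtain a b where ab: "quotient_of x1 = (a, b)" by (cases "quotient_of x1")
      obtain c d where cd: "quotient_of x2 = (c, d)" by (cases "quotient_of x2")
      have pos: "b > 0" "d > 0" using ab cd quotient_of_denom_pos by blast+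
      have x: "x1 = of_int a / of_int b" "x2 = of_int c / of_int d" using ab cd quotient_of_div by blast+
      define H where "H = max \<bar>real_of_int a\<bar> \<bar>real_of_int b\<bar>"
      define J where "J = max \<bar>real_of_int c\<bar> \<bar>real_of_int d\<bar>"
      have HJ: "H \<ge> 1" "J \<ge> 1" using pos by (simp_all add: H_def J_def max_def)
      have hb: "\<bar>real_of_int a\<bar> \<le> H" "\<bar>real_of_int b\<bar> \<le> H" "\<bar>real_of_int c\<bar> \<le> J" "\<bar>real_of_int d\<bar> \<le> J"
        by (simp_all add: H_def J_def)
      have ht: "ht P = ln H" "ht Q = ln J"
        using ab cd PQ by (simp_all add: wheight_def H_def J_def of_int_max)
      define v where "v = (a * d - c * b)\<^sup>2"
      define s where "s = 2 * ((a * d + c * b) * (A * b * d + a * c) + 2 * B * b\<^sup>2 * d\<^sup>2)"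
      define p where "p = (a * c - A * b * d)\<^sup>2 - 4 * B * b * d * (a * d + c * b)"
      have v: "of_int v = (x1 - x2)\<^sup>2 * of_int (b * d) ^ 2"
        unfolding v_def x using pos by (simp add: field_simps power2_eq_square)
      have s: "of_int s = 2 * ((x1 + x2) * (of_int A + x1 * x2) + 2 * of_int B) * of_int (b * d) ^ 2"
        unfolding s_def x using pos by (simp add: field_simps power2_eq_square)
      have p: "of_int p = ((x1 * x2 - of_int A)\<^sup>2 - 4 * of_int B * (x1 + x2)) * of_int (b * d) ^ 2"
        unfolding p_def x using pos by (simp add: field_simps power2_eq_square)
      have "(of_int v :: rat) \<noteq> 0" unfolding v using ne pos by simp
      then have v0: "v \<noteq> 0" by simp
      have sum: "(x3 + x4) * of_int v = of_int s" unfolding v s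
        using xs(1) by (simp add: mult.assoc[symmetric])
      have prod: "x3 * x4 * of_int v = of_int p" unfolding v p
        using xs(2) by (simp add: mult.assoc[symmetric])
      have M2: "1 \<le> M\<^sup>2" "M \<le> M\<^sup>2" using M(1) by (simp_all add: self_le_power)
      let ?K = "(12 * M\<^sup>2) * (H\<^sup>2 * J\<^sup>2)"
      have "\<bar>real_of_int v\<bar> \<le> (H * J + J * H)\<^sup>2"
        unfolding v_def of_int_add of_int_diff of_int_mult of_int_power of_int_numeral
        by (intro abs_intros hb)
      also have "\<dots> = 4 * (H\<^sup>2 * J\<^sup>2)" by algebra
      also have "\<dots> \<le> ?K" using M2 by (intro mult_right_mono) auto
      finally have vK: "\<bar>real_of_int v\<bar> \<le> ?K" .
      have "\<bar>real_of_int s\<bar> \<le> 2 * ((H * J + J * H) * (M * H * J + H * J) + 2 * M * H\<^sup>2 * J\<^sup>2)"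
        unfolding s_def of_int_add of_int_diff of_int_mult of_int_power of_int_numeral
        by (intro abs_intros hb M)
      also have "\<dots> = (8 * M + 4) * (H\<^sup>2 * J\<^sup>2)" by algebra
      also have "\<dots> \<le> ?K" using M2 by (intro mult_right_mono) auto
      finally have sK: "\<bar>real_of_int s\<bar> \<le> ?K" .
      have "\<bar>real_of_int p\<bar> \<le> (H * J + M * H * J)\<^sup>2 + 4 * M * H * J * (H * J + J * H)"
        unfolding p_def of_int_add of_int_diff of_int_mult of_int_power of_int_numeral
        by (intro abs_intros hb M)
      also have "\<dots> = (M\<^sup>2 + 10 * M + 1) * (H\<^sup>2 * J\<^sup>2)" by algebra
      also have "\<dots> \<le> ?K" using M2 by (intro mult_right_mono) auto
      finally have pK: "\<bar>real_of_int p\<bar> \<le> ?K" .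
      have "ht (P \<oplus> Q) + ht (P \<oplus> sneg Q) \<le> ln (2 * ?K)"
        using wheight_pair_le[OF v0 sum prod vK sK pK] R S by simp
      also have "\<dots> \<le> ln (700 * M ^ 5 * (H\<^sup>2 * J\<^sup>2))"
      proof (subst ln_le_cancel_iff)
        have "M\<^sup>2 \<le> M ^ 5" using M by (intro power_increasing) auto
        then have "24 * M\<^sup>2 * (H\<^sup>2 * J\<^sup>2) \<le> 700 * M ^ 5 * (H\<^sup>2 * J\<^sup>2)"
          using M by (intro mult_right_mono mult_mono) auto
        then show "2 * ?K \<le> 700 * M ^ 5 * (H\<^sup>2 * J\<^sup>2)" by simp
      qed (use M HJ in auto)
      also have "\<dots> = ln (700 * M ^ 5) + (2 * ln H + 2 * ln J)"
        using M HJ by (simp add: ln_mult ln_realpow)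
      finally show ?thesis using ht ln_700 by simp
    qed
  qed
qed

end

section \<open>Points in the kernel of reduction modulo 5\<close>

text \<open>The localization of the integers at the prime ideal of 5, inside
  \<open>rat\<close>.\<close>

definition int5 :: "rat set" where
  "int5 = {of_int a / of_int b | a b. \<not> 5 dvd b}"

text \<open>A group of units only if 5 divides \<open>m\<close>.\<close>

definition unit5 :: "int \<Rightarrow> rat set" where
  "unit5 m = {1 + of_int m * e | e. e \<in> int5}"

lemma prime_5_int: "prime (5 :: int)"
  by simp

lemma int5I: "\<not> 5 dvd b \<Longrightarrow> q = of_int a / of_int b \<Longrightarrow> q \<in> int5"
  by (auto simp: int5_def)

lemma int5E:
  assumes "q \<in> int5"
  obtains a b where "q = of_int a / of_int b" "\<not> 5 dvd b" "b \<noteq> 0"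
proof -
  from assms obtain a b where "q = of_int a / of_int b" "\<not> 5 dvd b" by (auto simp: int5_def)
  moreover from this have "b \<noteq> 0" by auto
  ultimately show thesis using that by blast
qed

lemma int5_of_int [simp, intro]: "of_int a \<in> int5"
  by (rule int5I[of 1 _ a]) auto

lemma int5_numeral [simp, intro]: "numeral k \<in> int5"
  using int5_of_int[of "numeral k"] by simp

lemma int5_0 [simp, intro]: "0 \<in> int5"
  using int5_of_int[of 0] by simp

lemma int5_1 [simp, intro]: "1 \<in> int5"
  using int5_of_int[of 1] by simp

lemma int5_add [simp, intro]: "p \<in> int5 \<Longrightarrow> q \<in> int5 \<Longrightarrow> p + q \<in> int5"
proof -
  assume "p \<in> int5" "q \<in> int5"
  then obtain a b c d where "p = of_int a / of_int b" "\<not> 5 dvd b" "b \<noteq> 0"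
    "q = of_int c / of_int d" "\<not> 5 dvd d" "d \<noteq> 0" by (metis int5E)
  then show ?thesis using prime_5_int
    by (intro int5I[of "b * d" _ "a * d + c * b"]) (auto simp: prime_dvd_mult_iff field_simps)
qed

lemma int5_mult [simp, intro]: "p \<in> int5 \<Longrightarrow> q \<in> int5 \<Longrightarrow> p * q \<in> int5"
proof -
  assume "p \<in> int5" "q \<in> int5"
  then obtain a b c d where "p = of_int a / of_int b" "\<not> 5 dvd b" "b \<noteq> 0"
    "q = of_int c / of_int d" "\<not> 5 dvd d" "d \<noteq> 0" by (metis int5E)
  then show ?thesis using prime_5_int
    by (intro int5I[of "b * d" _ "a * c"]) (auto simp: prime_dvd_mult_iff field_simps)
qed

lemma int5_uminus [simp, intro]: "p \<in> int5 \<Longrightarrow> - p \<in> int5"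
  using int5_mult[OF int5_of_int[of "- 1"]] by simp

lemma int5_diff [simp, intro]: "p \<in> int5 \<Longrightarrow> q \<in> int5 \<Longrightarrow> p - q \<in> int5"
  using int5_add[of p "- q"] by simp

lemma int5_power [simp, intro]: "p \<in> int5 \<Longrightarrow> p ^ n \<in> int5"
  by (induction n) auto

lemma int5_divide3: "p \<in> int5 \<Longrightarrow> p / 3 \<in> int5"
  using int5_mult[of p "1 / 3"] int5I[of 3 "1 / 3" 1] by simp

lemma not_int5_one_fifth: "5 * e \<noteq> 1" if "e \<in> int5"
proof
  assume *: "5 * e = 1"
  obtain a b where e: "e = of_int a / of_int b" "\<not> 5 dvd b" "b \<noteq> 0" using \<open>e \<in> int5\<close> by (rule int5E)
  then have "(of_int (5 * a) :: rat) = of_int b" using *[unfolded e(1)] by (simp add: field_simps)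
  then have "b = 5 * a" by (simp only: of_int_eq_iff)
  then show False using e(2) by simp
qed

lemma unit5I: "e \<in> int5 \<Longrightarrow> u = 1 + of_int m * e \<Longrightarrow> u \<in> unit5 m"
  by (auto simp: unit5_def)

lemma unit5_mult: "u \<in> unit5 m \<Longrightarrow> v \<in> unit5 m \<Longrightarrow> u * v \<in> unit5 m"
proof -
  assume "u \<in> unit5 m" "v \<in> unit5 m"
  then obtain e f where ef: "u = 1 + of_int m * e" "v = 1 + of_int m * f" "e \<in> int5" "f \<in> int5"
    by (auto simp: unit5_def)
  show ?thesis
    by (rule unit5I[of "e + f + of_int m * (e * f)"]) (use ef in \<open>auto simp: algebra_simps\<close>)
qed

lemma unit5_nonzero: "u \<in> unit5 m \<Longrightarrow> 5 dvd m \<Longrightarrow> u \<noteq> 0"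
proof
  assume "u \<in> unit5 m" "5 dvd m" "u = 0"
  then obtain e n where "0 = 1 + of_int (5 * n) * e" "e \<in> int5" by (auto simp: unit5_def)
  then have "5 * (- (of_int n * e)) = 1" "- (of_int n * e) \<in> int5" by auto
  then show False using not_int5_one_fifth by blast
qed

lemma unit5_inverse: "u \<in> unit5 m \<Longrightarrow> 5 dvd m \<Longrightarrow> 1 / u \<in> unit5 m"
proof -
  assume u: "u \<in> unit5 m" and m: "5 dvd m"
  then obtain e where e: "u = 1 + of_int m * e" "e \<in> int5" by (auto simp: unit5_def)
  obtain a b where ab: "e = of_int a / of_int b" "\<not> 5 dvd b" "b \<noteq> 0" using e(2) by (rule int5E)
  have nd: "\<not> 5 dvd b + m * a" using ab m by (simp add: dvd_add_left_iff)
  then have "b + m * a \<noteq> 0" by auto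
  then have nz: "(of_int b + of_int m * of_int a :: rat) \<noteq> 0"
    by (metis of_int_add of_int_eq_0_iff of_int_mult)
  show ?thesis
  proof (rule unit5I)
    show "- (of_int a / of_int (b + m * a)) \<in> int5" using int5I[OF nd refl] by blast
    show "1 / u = 1 + of_int m * - (of_int a / of_int (b + m * a))"
      using ab(3) nz unfolding e(1) ab(1) by (simp add: field_simps)
  qed
qed

lemma unit5_divide: "u \<in> unit5 m \<Longrightarrow> v \<in> unit5 m \<Longrightarrow> 5 dvd m \<Longrightarrow> u / v \<in> unit5 m"
  using unit5_mult[of u m "1 / v"] unit5_inverse[of v m] by simp

lemma unit5_25_5: "u \<in> unit5 25 \<Longrightarrow> u \<in> unit5 5"
proof -
  assume "u \<in> unit5 25"
  then obtain e where "u = 1 + 25 * e" "e \<in> int5" by (auto simp: unit5_def)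
  then show ?thesis by (intro unit5I[of "5 * e"]) auto
qed

context integral_curve
begin

abbreviation GG :: "rat pt monoid" where
  "GG \<equiv> curve_group (of_int A) (of_int B)"

sublocale GG: comm_group GG
  by (rule comm_group_curve_group) unfold_locales

lemma GG_simps [simp]: "carrier GG = pts" "x \<otimes>\<^bsub>GG\<^esub> y = x \<oplus> y" "\<one>\<^bsub>GG\<^esub> = None"
  by (simp_all add: curve_group_def)

lemma GG_inv [simp]: "P \<in> pts \<Longrightarrow> inv\<^bsub>GG\<^esub> P = sneg P"
  using GG.inv_equality[of "sneg P" P] sadd_sneg[of "sneg P"] by simp

text \<open>In terms of \<open>z = 1/x\<close>, with \<open>z\<close> divisible by 5: \<open>z(2P) = 4 z u\<close>, \<open>z(3P) = 9 z u'\<close> and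
  \<open>z(5P) = 25 z v\<close> with units \<open>u, u' \<equiv> 1\<close> modulo 25 and \<open>v \<equiv> 1\<close> modulo 5.\<close>

lemma product_unit5:
  assumes "w1 \<in> int5" "w2 \<in> int5"
  shows "(1 - of_int A * (5 * w1) * (5 * w2))\<^sup>2 - 4 * of_int B * (5 * w1) * (5 * w2) * (5 * w1 + 5 * w2) \<in> unit5 25"
  by (rule unit5I[of "- 2 * of_int A * w1 * w2 + 25 * (of_int A * w1 * w2)\<^sup>2 - 20 * of_int B * w1 * w2 * (w1 + w2)"])
    (use assms in \<open>auto simp: power2_eq_square algebra_simps\<close>)

text \<open>Multiplying the product formula of \<open>xcoord_sum_diff\<close> by the squares of both
  \<open>z\<close> turns it into \<open>x(P + Q) x(P - Q) (z1 - z2)^2 = u\<close> with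
  \<open>u \<equiv> 1\<close> modulo 25. So \<open>P + Q\<close> is known as soon as
  \<open>P - Q\<close> is.\<close>

lemma kernel_add:
  assumes P: "P = Some (1 / (5 * w1), y1)" and Q: "Q = Some (1 / (5 * w2), y2)"
    and on: "P \<in> pts" "Q \<in> pts" and w: "w1 \<in> int5" "w2 \<in> int5" "w1 \<noteq> 0" "w2 \<noteq> 0" "w1 \<noteq> w2"
    and D: "P \<oplus> sneg Q = Some (1 / z, y4)" "z \<noteq> 0"
  shows "\<exists>y u. u \<in> unit5 25 \<and> P \<oplus> Q = Some (z * u / (5 * w1 - 5 * w2)\<^sup>2, y)"
proof -
  let ?x1 = "1 / (5 * w1)" and ?x2 = "1 / (5 * w2)"
  have ne: "?x1 \<noteq> ?x2" using w by simp
  then obtain x3 y3 where R: "P \<oplus> Q = Some (x3, y3)" using P Q by (auto simp: Let_def)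
  have on': "on ?x1 y1" "on ?x2 y2" using on P Q by auto
  have *: "x3 * (1 / z) * (?x1 - ?x2)\<^sup>2 = (?x1 * ?x2 - of_int A)\<^sup>2 - 4 * of_int B * (?x1 + ?x2)"
    using xcoord_sum_diff(2)[OF on' ne R[unfolded P Q] D(1)[unfolded P Q sneg.simps]] .
  define u where "u = (1 - of_int A * (5 * w1) * (5 * w2))\<^sup>2 - 4 * of_int B * (5 * w1) * (5 * w2) * (5 * w1 + 5 * w2)"
  define p q where "p = 5 * w1" and "q = 5 * w2"
  have pq: "p \<noteq> 0" "q \<noteq> 0" "p \<noteq> q" using w by (auto simp: p_def q_def)
  have "(1 / p - 1 / q)\<^sup>2 * (p * q)\<^sup>2 = (p - q)\<^sup>2"
    using pq by (simp add: field_simps power2_eq_square)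
  moreover have "((1 / p * (1 / q) - of_int A)\<^sup>2 - 4 * of_int B * (1 / p + 1 / q)) * (p * q)\<^sup>2 = u"
    using pq unfolding u_def p_def[symmetric] q_def[symmetric] by (simp add: field_simps power2_eq_square)
  ultimately have "x3 * (1 / z) * (p - q)\<^sup>2 = u"
    using * unfolding p_def[symmetric] q_def[symmetric] by (metis mult.assoc)
  then have "x3 = z * u / (p - q)\<^sup>2" using pq D(2) by (simp add: field_simps)
  moreover have "u \<in> unit5 25" unfolding u_def by (rule product_unit5[OF w(1,2)])
  ultimately show ?thesis using R by (auto simp: p_def q_def)
qed

lemma kernel_double:
  assumes P: "P = Some (1 / (5 * w), y)" "P \<in> pts" and w: "w \<in> int5" "w \<noteq> 0"
  shows "\<exists>y u. u \<in> unit5 25 \<and> P \<oplus> P = Some (1 / (5 * (4 * w * u)), y)"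
proof -
  define z where "z = 5 * w"
  have z: "z \<noteq> 0" using w by (simp add: z_def)
  let ?A = "of_int A :: rat" and ?B = "of_int B :: rat"
  define d where "d = 1 + ?A * z\<^sup>2 + ?B * z ^ 3"
  define n where "n = 1 - 2 * ?A * z\<^sup>2 - 8 * ?B * z ^ 3 + ?A\<^sup>2 * z ^ 4"
  have d: "d \<in> unit5 25"
    by (rule unit5I[of "?A * w\<^sup>2 + 5 * ?B * w ^ 3"]) (use w in \<open>auto simp: d_def z_def power2_eq_square power3_eq_cube\<close>)
  have n: "n \<in> unit5 25"
    by (rule unit5I[of "- 2 * ?A * w\<^sup>2 - 40 * ?B * w ^ 3 + 25 * ?A\<^sup>2 * w ^ 4"])
      (use w in \<open>auto simp: n_def z_def power2_eq_square power3_eq_cube power4_eq_xxxx\<close>)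
  have nz: "d \<noteq> 0" "n \<noteq> 0" using unit5_nonzero d n by force+
  have on: "on (1 / z) y" using P by (simp add: z_def)
  have D: "(1 / z) ^ 3 + ?A * (1 / z) + ?B = d / z ^ 3"
    using z by (simp add: d_def field_simps power2_eq_square power3_eq_cube)
  have N: "(1 / z) ^ 4 - 2 * ?A * (1 / z)\<^sup>2 - 8 * ?B * (1 / z) + ?A\<^sup>2 = n / z ^ 4"
    using z by (simp add: n_def field_simps power2_eq_square power3_eq_cube power4_eq_xxxx)
  have "y\<^sup>2 = d / z ^ 3" using on D by (simp add: on_def)
  then have y: "y \<noteq> 0" using nz z by auto
  then obtain x' y' where R: "P \<oplus> P = Some (x', y')" using P by (auto simp: Let_def)
  have "x' * (4 * (d / z ^ 3)) = n / z ^ 4"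
    using xcoord_double[OF on y] R P(1) unfolding D N by (simp add: z_def)
  then have "x' = 1 / (4 * z * (d / n))"
    using nz z by (simp add: field_simps power_numeral_reduce)
  then show ?thesis using R unit5_divide[OF d n] by (auto simp: z_def algebra_simps)
qed

text \<open>The chain 2P, 3P = 2P + P, 5P = 3P + 2P is chosen because both additions have the known
  difference \<open>P\<close>, as \<open>kernel_add\<close> demands.\<close>

lemma kernel_times_5:
  assumes P: "P = Some (1 / (5 * w), y)" "P \<in> pts" and w: "w \<in> int5" "w \<noteq> 0"
  shows "\<exists>y v. v \<in> unit5 5 \<and> P [^]\<^bsub>GG\<^esub> (5::nat) = Some (1 / (5 * (25 * w * v)), y)"
proof -
  define P2 where "P2 = P \<oplus> P"
  define P3 where "P3 = P2 \<oplus> P"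
  have pts: "P2 \<in> pts" "P3 \<in> pts" using P(2) by (simp_all add: P2_def P3_def)
  have "P2 \<oplus> sneg P = P" unfolding P2_def
    using sadd_cancel_left[OF P(2) P(2)] sadd_commute P(2) sadd_in_pts sneg_in_pts by metis
  then have D2: "P2 \<oplus> sneg P = Some (1 / (5 * w), y)" using P by simp
  have "P3 \<oplus> sneg P2 = P" unfolding P3_def
    using sadd_cancel_left[OF pts(1) P(2)] sadd_commute P(2) pts(1) sadd_in_pts sneg_in_pts by metis
  then have D3: "P3 \<oplus> sneg P2 = Some (1 / (5 * w), y)" using P by simp
  obtain y2 u where u: "u \<in> unit5 25" "P2 = Some (1 / (5 * (4 * w * u)), y2)"
    using kernel_double[OF P w] by (auto simp: P2_def)
  obtain e where e: "u = 1 + 25 * e" "e \<in> int5" using u(1) by (auto simp: unit5_def)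
  \<comment> \<open>\<open>4 u - 1 = 3 u1\<close>; since 3 is invertible at 5, the precision 25 is
    kept.\<close>
  define u1 where "u1 = 1 + 25 * (4 * e / 3)"
  have u1: "u1 \<in> unit5 25" unfolding u1_def using int5_divide3[of "4 * e"] e by (intro unit5I) auto
  have d21: "5 * (4 * w * u) - 5 * w = 5 * w * (3 * u1)" by (simp add: u1_def e field_simps)
  have nz: "u \<noteq> 0" "u1 \<noteq> 0" using u u1 unit5_nonzero by force+
  have "5 * (4 * w * u) - 5 * w \<noteq> 0" unfolding d21 using w nz by simp
  then have w2: "4 * w * u \<in> int5" "4 * w * u \<noteq> 0" "4 * w * u \<noteq> w"
    using e w nz by auto
  obtain y3 v where v: "v \<in> unit5 25" "P3 = Some (5 * w * v / (5 * (4 * w * u) - 5 * w)\<^sup>2, y3)"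
    using kernel_add[OF u(2) P(1) pts(1) P(2) w2(1) w(1) w2(2) w(2) w2(3) D2] w by (auto simp: P3_def)
  define u3 where "u3 = u1 * u1 / v"
  have u3: "u3 \<in> unit5 25" unfolding u3_def by (intro unit5_divide unit5_mult u1 v) auto
  have "v \<noteq> 0" "u3 \<noteq> 0" using u3 v unit5_nonzero by force+
  have P3: "P3 = Some (1 / (5 * (9 * w * u3)), y3)"
    unfolding v(2) d21 u3_def using w nz \<open>v \<noteq> 0\<close> by (simp add: field_simps power2_eq_square)
  obtain f where f: "u3 = 1 + 25 * f" "f \<in> int5" using u3 by (auto simp: unit5_def)
  \<comment> \<open>\<open>9 u3 - 4 u = 5 u4\<close>: extracting the factor 5 uses up one power of
    5, which is why units modulo 25 are carried up to this point.\<close>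
  define u4 where "u4 = 1 + 5 * (9 * f - 4 * e)"
  have u4: "u4 \<in> unit5 5" unfolding u4_def by (rule unit5I[of "9 * f - 4 * e"]) (use e f in auto)
  have d32: "5 * (9 * w * u3) - 5 * (4 * w * u) = 5 * w * (5 * u4)" by (simp add: u4_def e f field_simps)
  have "u4 \<noteq> 0" using u4 unit5_nonzero by force
  have "5 * (9 * w * u3) - 5 * (4 * w * u) \<noteq> 0" unfolding d32 using w \<open>u4 \<noteq> 0\<close> by simp
  then have w3: "9 * w * u3 \<in> int5" "9 * w * u3 \<noteq> 0" "9 * w * u3 \<noteq> 4 * w * u"
    using f w \<open>u3 \<noteq> 0\<close> by auto
  obtain y5 v' where v': "v' \<in> unit5 25"
    "P3 \<oplus> P2 = Some (5 * w * v' / (5 * (9 * w * u3) - 5 * (4 * w * u))\<^sup>2, y5)"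
    using kernel_add[OF P3 u(2) pts(2) pts(1) w3(1) w2(1) w3(2) w2(2) w3(3) D3] w by auto
  have "v' \<noteq> 0" using v' unit5_nonzero by force
  have "P3 \<oplus> P2 = Some (1 / (5 * (25 * w * (u4 * u4 / v'))), y5)"
    unfolding v'(2) d32 using w \<open>v' \<noteq> 0\<close> \<open>u4 \<noteq> 0\<close> by (simp add: field_simps power2_eq_square)
  moreover have "u4 * u4 / v' \<in> unit5 5"
    by (intro unit5_divide unit5_mult u4 unit5_25_5 v') auto
  moreover have "P [^]\<^bsub>GG\<^esub> (5::nat) = P3 \<oplus> P2"
  proof -
    have "P2 = P [^]\<^bsub>GG\<^esub> (2::nat)" "P3 = P [^]\<^bsub>GG\<^esub> (3::nat)"
      using P GG.nat_pow_Suc[of P 1] GG.nat_pow_Suc[of P 2]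
      by (simp_all add: P2_def P3_def numeral_2_eq_2 numeral_3_eq_3)
    then show ?thesis using GG.nat_pow_mult[of P 3 2] P by simp
  qed
  ultimately show ?thesis by auto
qed

text \<open>Otherwise \<open>z = 1 / x\<close> is divisible by 5, and each multiplication by 5
  multiplies it by 25 up to a unit. The points \<open>5^k P\<close> are then pairwise distinct,
  whereas a torsion point has finitely many multiples.\<close>

lemma torsion_int5:
  assumes P: "Some (x, y) \<in> pts" and tors: "Some (x, y) [^]\<^bsub>GG\<^esub> n = None" "n > (0::nat)"
  shows "x \<in> int5"
proof (rule ccontr)
  assume x: "x \<notin> int5"
  let ?P = "Some (x, y)"
  obtain a b where ab: "quotient_of x = (a, b)" by (cases "quotient_of x")
  have b: "b > 0" and cop: "coprime a b" and xab: "x = of_int a / of_int b"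
    using ab quotient_of_denom_pos quotient_of_coprime quotient_of_div by blast+
  have "5 dvd b" using x int5I[OF _ xab] by blast
  then have a: "\<not> 5 dvd a" using cop by (metis coprime_common_divisor not_prime_unit prime_5_int)
  then have "a \<noteq> 0" by auto
  obtain c where c: "b = 5 * c" using \<open>5 dvd b\<close> by blast
  define w where "w = (of_int c / of_int a :: rat)"
  have w: "w \<in> int5" "w \<noteq> 0" using int5I[OF a] c b \<open>a \<noteq> 0\<close> by (auto simp: w_def)
  have xw: "x = 1 / (5 * w)" using c b \<open>a \<noteq> 0\<close> by (simp add: xab w_def)
  have *: "\<exists>y v. v \<in> unit5 5 \<and> ?P [^]\<^bsub>GG\<^esub> (5 ^ k :: nat) = Some (1 / (5 * (25 ^ k * w * v)), y)" for k
  proof (induction k)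
    case 0
    have "1 \<in> unit5 5" by (rule unit5I[of 0]) auto
    then show ?case using P xw by auto
  next
    case (Suc k)
    then obtain y' v where v: "v \<in> unit5 5" "?P [^]\<^bsub>GG\<^esub> (5 ^ k :: nat) = Some (1 / (5 * (25 ^ k * w * v)), y')"
      by blast
    have v': "v \<in> int5" "v \<noteq> 0" using v(1) unit5_nonzero[OF v(1)] by (auto simp: unit5_def)
    have "?P [^]\<^bsub>GG\<^esub> (5 ^ k :: nat) \<in> pts" using GG.nat_pow_closed[of ?P "5 ^ k"] P by simp
    from kernel_times_5[OF v(2) this] obtain y'' v1 where v1: "v1 \<in> unit5 5"
      "(?P [^]\<^bsub>GG\<^esub> (5 ^ k :: nat)) [^]\<^bsub>GG\<^esub> (5::nat) = Some (1 / (5 * (25 * (25 ^ k * w * v) * v1)), y'')"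
      using v' w by auto
    have "(?P [^]\<^bsub>GG\<^esub> (5 ^ k :: nat)) [^]\<^bsub>GG\<^esub> (5::nat) = ?P [^]\<^bsub>GG\<^esub> (5 ^ Suc k :: nat)"
      using P by (subst GG.nat_pow_pow) (simp_all add: mult.commute)
    moreover have "25 * (25 ^ k * w * v) * v1 = 25 ^ Suc k * w * (v * v1)" by simp
    ultimately show ?case using v1(2) unit5_mult[OF v(1) v1(1)] by metis
  qed
  have "?P [^]\<^bsub>GG\<^esub> i = ?P [^]\<^bsub>GG\<^esub> (i mod n)" for i :: nat
  proof -
    have "?P [^]\<^bsub>GG\<^esub> i = ?P [^]\<^bsub>GG\<^esub> (n * (i div n) + i mod n)" by simp
    also have "\<dots> = (?P [^]\<^bsub>GG\<^esub> n) [^]\<^bsub>GG\<^esub> (i div n) \<oplus> ?P [^]\<^bsub>GG\<^esub> (i mod n)"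
      using P GG.nat_pow_mult[of ?P "n * (i div n)" "i mod n"] GG.nat_pow_pow[of ?P n "i div n"] by simp
    also have "\<dots> = ?P [^]\<^bsub>GG\<^esub> (i mod n)" using tors GG.nat_pow_one[of "i div n"] by simp
    finally show ?thesis .
  qed
  then have "range (\<lambda>k. ?P [^]\<^bsub>GG\<^esub> (5 ^ k :: nat)) \<subseteq> (\<lambda>i. ?P [^]\<^bsub>GG\<^esub> i) ` {..<n}"
    using tors(2) by (smt (verit, best) image_iff image_subsetI lessThan_iff mod_less_divisor)
  then have "finite (range (\<lambda>k. ?P [^]\<^bsub>GG\<^esub> (5 ^ k :: nat)))" using finite_subset by blast
  then have "\<not> inj (\<lambda>k. ?P [^]\<^bsub>GG\<^esub> (5 ^ k :: nat))" 
    using finite_imageD infinite_UNIV_nat by blast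
  then obtain k l where kl: "k < l" "?P [^]\<^bsub>GG\<^esub> (5 ^ k :: nat) = ?P [^]\<^bsub>GG\<^esub> (5 ^ l :: nat)"
    unfolding inj_def by (metis nat_neq_iff)
  obtain u v where uv: "u \<in> unit5 5" "v \<in> unit5 5"
    "1 / (5 * (25 ^ k * w * u)) = 1 / (5 * (25 ^ l * w * v))"
    using *[of k] *[of l] kl(2) by auto
  have "25 ^ l = 25 ^ k * (25 * 25 ^ (l - k - 1) :: rat)"
    using kl(1) by (simp flip: power_add power_Suc)
  then have "u = 25 * 25 ^ (l - k - 1) * v" using uv(3) w unit5_nonzero[OF uv(1)] unit5_nonzero[OF uv(2)] by simp
  then have "u / v = 25 * 25 ^ (l - k - 1)" using unit5_nonzero[OF uv(2)] by simp
  moreover have "u / v \<in> unit5 5" using unit5_divide uv by simp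
  ultimately obtain e where "25 * 25 ^ (l - k - 1) = 1 + 5 * e" "e \<in> int5" by (auto simp: unit5_def)
  then have "5 * (5 * 25 ^ (l - k - 1) - e) = 1" "5 * 25 ^ (l - k - 1) - e \<in> int5" by auto
  then show False using not_int5_one_fifth by blast
qed

text \<open>\<open>P - Q\<close> has x-coordinate \<open>l^2 - x1 - x2\<close> with
  \<open>l = (y1 + y2) / (x1 - x2)\<close>. Integrality at 5 forces the numerator of
  \<open>l\<close> to contain every power of 5 that its denominator contains.\<close>

lemma torsion_difference_dvd:
  fixes x1 y1 x2 y2 :: int
  assumes P: "Some (of_int x1, of_int y1) \<in> pts" and Q: "Some (of_int x2, of_int y2) \<in> pts"
    and ne: "x1 \<noteq> x2" and n: "n > (0::nat)"
    and tors: "(Some (of_int x1, of_int y1) \<oplus> sneg (Some (of_int x2, of_int y2))) [^]\<^bsub>GG\<^esub> n = None"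
    and dvd: "5 ^ e dvd x1 - x2"
  shows "5 ^ e dvd y1 + y2"
proof -
  define l where "l = (of_int (- y2 - y1) / of_int (x2 - x1) :: rat)"
  have "\<exists>y. Some (of_int x1, of_int y1) \<oplus> sneg (Some (of_int x2, of_int y2))
      = Some (l\<^sup>2 - of_int x1 - of_int x2, y)"
    using ne by (simp add: Let_def slope_def l_def)
  then obtain y where T: "Some (of_int x1, of_int y1) \<oplus> sneg (Some (of_int x2, of_int y2))
      = Some (l\<^sup>2 - of_int x1 - of_int x2, y)" by blast
  then have "Some (l\<^sup>2 - of_int x1 - of_int x2, y) \<in> pts"
    using P Q sadd_in_pts sneg_in_pts by metis
  from torsion_int5[OF this tors[unfolded T] n] have "l\<^sup>2 - of_int x1 - of_int x2 \<in> int5" .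
  then have "l\<^sup>2 - of_int x1 - of_int x2 + of_int x1 + of_int x2 \<in> int5" by blast
  then have "l\<^sup>2 \<in> int5" by simp
  then obtain a b where ab: "l\<^sup>2 = of_int a / of_int b" "\<not> 5 dvd b" "b \<noteq> 0" by (rule int5E)
  have "l = of_int (y1 + y2) / of_int (x1 - x2)" using ne by (simp add: l_def field_simps)
  then have "of_int a / of_int b = (of_int (y1 + y2) / of_int (x1 - x2) :: rat)\<^sup>2" using ab(1) by simp
  moreover have "(of_int (x1 - x2) :: rat) \<noteq> 0" using ne by simp
  ultimately have "of_int (a * (x1 - x2)\<^sup>2) = (of_int ((y1 + y2)\<^sup>2 * b) :: rat)"
    using ab(3) by (simp add: field_simps)
  then have eq: "a * (x1 - x2)\<^sup>2 = (y1 + y2)\<^sup>2 * b" by (simp only: of_int_eq_iff)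
  have "(5 ^ e)\<^sup>2 dvd (y1 + y2)\<^sup>2 * b" unfolding eq[symmetric] using dvd by (intro dvd_mult) (rule dvd_power_same)
  moreover have "coprime ((5 ^ e)\<^sup>2) b"
    using ab(2) prime_5_int by (simp add: prime_imp_coprime)
  ultimately have "(5 ^ e)\<^sup>2 dvd (y1 + y2)\<^sup>2" by (simp add: coprime_dvd_mult_left_iff)
  then show ?thesis by (simp add: pow_divides_pow_iff)
qed

end

section \<open>Residue classes of terms that differ by torsion\<close>

lemma prime_power_dvd_cancel:
  fixes p z w :: int
  assumes p: "prime p" and dvd: "p ^ a dvd z * w" and nd: "\<not> p ^ Suc b dvd z"
  shows "p ^ (a - b) dvd w"
proof (cases "z * w = 0")
  case True
  then show ?thesis using nd by auto
next
  case False
  then have nz: "z \<noteq> 0" "w \<noteq> 0" by auto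
  have "multiplicity p z \<le> b"
    using nd p nz by (meson leI less_eq_Suc_le multiplicity_dvd' )
  moreover have "a \<le> multiplicity p (z * w)"
    using dvd False p by (metis multiplicity_geI not_prime_unit)
  moreover have "multiplicity p (z * w) = multiplicity p z + multiplicity p w"
    using p nz by (intro prime_elem_multiplicity_mult_distrib) auto
  ultimately have "a - b \<le> multiplicity p w" by simp
  then show ?thesis by (rule multiplicity_dvd')
qed

text \<open>Divided differences of the cubic \<open>x^3 + A x + B\<close> at four terms of the progression.\<close>

lemma four_points_nonminimal:
  fixes A B d :: int and x :: "nat \<Rightarrow> int"
  assumes v: "5 ^ v dvd d" "\<not> 5 ^ Suc v dvd d"
    and x: "\<And>i j. i < 4 \<Longrightarrow> j < 4 \<Longrightarrow> i \<noteq> j \<Longrightarrow> \<exists>c. x i - x j = c * d \<and> \<not> 5 ^ Suc m dvd c"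
    and f: "\<And>i. i < 4 \<Longrightarrow> 5 ^ (2 * v + 2 * k) dvd x i ^ 3 + A * x i + B"
    and k: "2 * k \<ge> 3 * m + 2"
  shows "5 ^ 4 dvd A \<and> 5 ^ 6 dvd B"
proof -
  have nd: "\<not> 5 ^ Suc (v + m) dvd x i - x j" if ij: "i < 4" "j < 4" "i \<noteq> j" for i j
  proof
    assume *: "5 ^ Suc (v + m) dvd x i - x j"
    obtain c where c: "x i - x j = c * d" "\<not> 5 ^ Suc m dvd c" using x[OF ij] by blast
    have "5 ^ (Suc (v + m) - v) dvd c"
      by (rule prime_power_dvd_cancel[OF prime_5_int _ v(2)]) (use * c in \<open>simp add: mult.commute\<close>)
    then show False using c(2) by (simp add: Suc_diff_le)
  qed
  \<comment> \<open>Each division by a difference of terms costs at most \<open>v + m\<close> in the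
    exponent: \<open>2 v + 2 k\<close> becomes \<open>v + 2 k - m\<close> here and
    \<open>2 k - 2 m\<close> in \<open>dd2\<close>.\<close>
  have dd1: "5 ^ (v + 2 * k - m) dvd (x i)\<^sup>2 + x i * x j + (x j)\<^sup>2 + A" if ij: "i < 4" "j < 4" "i \<noteq> j" for i j
  proof -
    have "(x i ^ 3 + A * x i + B) - (x j ^ 3 + A * x j + B) = (x i - x j) * ((x i)\<^sup>2 + x i * x j + (x j)\<^sup>2 + A)"
      by algebra
    moreover have "5 ^ (2 * v + 2 * k) dvd (x i ^ 3 + A * x i + B) - (x j ^ 3 + A * x j + B)"
      using f ij by (intro dvd_diff)
    ultimately have "5 ^ (2 * v + 2 * k) dvd (x i - x j) * ((x i)\<^sup>2 + x i * x j + (x j)\<^sup>2 + A)"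
      by (simp only:)
    from prime_power_dvd_cancel[OF prime_5_int this nd[OF ij]] show ?thesis
      by (simp add: mult_2)
  qed
  have dd2: "5 ^ (2 * k - 2 * m) dvd x i + x j + x l"
    if ij: "i < 4" "j < 4" "l < 4" "i \<noteq> j" "i \<noteq> l" "j \<noteq> l" for i j l
  proof -
    have "((x i)\<^sup>2 + x i * x j + (x j)\<^sup>2 + A) - ((x i)\<^sup>2 + x i * x l + (x l)\<^sup>2 + A) = (x j - x l) * (x i + x j + x l)"
      by algebra
    moreover have "5 ^ (v + 2 * k - m) dvd
        ((x i)\<^sup>2 + x i * x j + (x j)\<^sup>2 + A) - ((x i)\<^sup>2 + x i * x l + (x l)\<^sup>2 + A)"
      using ij by (intro dvd_diff dd1)
    ultimately have "5 ^ (v + 2 * k - m) dvd (x j - x l) * (x i + x j + x l)"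
      by (simp only:)
    from prime_power_dvd_cancel[OF prime_5_int this nd] show ?thesis
      using ij by (simp add: mult_2)
  qed
  \<comment> \<open>Two second divided differences with two common nodes differ by
    \<open>x 2 - x 3\<close>, which \<open>5 ^ Suc (v + m)\<close> does not divide. Hence
    \<open>2 k \<le> v + 3 m\<close>, and the hypothesis on \<open>k\<close> leaves
    \<open>v \<ge> 2\<close>: the step \<open>d\<close> is divisible by 25.\<close>
  have "5 ^ (2 * k - 2 * m) dvd (x 0 + x 1 + x 2) - (x 0 + x 1 + x 3)"
    by (intro dvd_diff dd2) auto
  then have d23: "5 ^ (2 * k - 2 * m) dvd x 2 - x 3" by simp
  have "2 * k - 2 * m \<le> v + m"
  proof (rule ccontr)
    assume "\<not> ?thesis"
    then have "5 ^ Suc (v + m) dvd x 2 - x 3" using d23 by (intro power_le_dvd[OF d23]) simp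
    then show False using nd[of 2 3] by simp
  qed
  then have v2: "v \<ge> 2" using k by linarith
  have sq: "(5::int) ^ 2 dvd x i - x j" if "i < 4" "j < 4" "i \<noteq> j" for i j
  proof -
    have "5 ^ 2 dvd d" using v(1) v2 power_le_dvd by blast
    then show ?thesis using x[OF that] by (metis dvd_mult)
  qed
  have "(5::int) ^ 2 dvd x 0 + x 1 + x 2"
    by (rule power_le_dvd[OF dd2]) (use k in auto)
  \<comment> \<open>All terms agree modulo 25, so a sum of three is \<open>3 x 0\<close> there and
    each term is divisible by 25. Going back through the divided difference and the cubic then
    yields the powers dividing \<open>A\<close> and \<open>B\<close>.\<close>
  moreover have "5 ^ 2 dvd (x 0 - x 1) + (x 0 - x 2)" using sq[of 0 1] sq[of 0 2] by (intro dvd_add) auto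
  ultimately have "5 ^ 2 dvd (x 0 + x 1 + x 2) + ((x 0 - x 1) + (x 0 - x 2))" by (rule dvd_add)
  then have "5 ^ 2 dvd 3 * x 0" by simp
  moreover have "coprime (5 ^ 2 :: int) 3"
    using prime_imp_coprime[OF prime_5_int, of 3] by (simp only: coprime_power_left_iff) simp
  ultimately have x0: "5 ^ 2 dvd x 0" by (simp only: coprime_dvd_mult_right_iff)
  then have x1: "5 ^ 2 dvd x 1" using dvd_diff[OF x0 sq[of 0 1]] by simp
  obtain a b where ab: "x 0 = 5 ^ 2 * a" "x 1 = 5 ^ 2 * b" using x0 x1 by (auto elim!: dvdE)
  have "(5::int) ^ 4 dvd (x 0)\<^sup>2 + x 0 * x 1 + (x 1)\<^sup>2 + A"
    by (rule power_le_dvd[OF dd1]) (use k v2 in auto)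
  moreover have "(x 0)\<^sup>2 + x 0 * x 1 + (x 1)\<^sup>2 = 5 ^ 4 * (a\<^sup>2 + a * b + b\<^sup>2)"
    unfolding ab by (simp add: power2_eq_square algebra_simps)
  ultimately have A: "5 ^ 4 dvd A" by (metis dvd_add_right_iff dvd_triv_left)
  then obtain c where c: "A = 5 ^ 4 * c" by blast
  have "(5::int) ^ 6 dvd x 0 ^ 3 + A * x 0 + B"
    by (rule power_le_dvd[OF f]) (use k v2 in auto)
  moreover have "x 0 ^ 3 + A * x 0 = 5 ^ 6 * (a ^ 3 + c * a)"
    unfolding ab c by (simp add: power3_eq_cube algebra_simps)
  ultimately have "5 ^ 6 dvd B" by (metis dvd_add_right_iff dvd_triv_left)
  then show ?thesis using A by blast
qed

lemma card_residue_class_le: "card {i \<in> {..<N}. i mod q = c} \<le> N div q + 1" for q :: nat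
proof -
  have "inj_on (\<lambda>i. i div q) {i \<in> {..<N}. i mod q = c}"
  proof (rule inj_onI)
    fix i j assume "i \<in> {i \<in> {..<N}. i mod q = c}" "j \<in> {i \<in> {..<N}. i mod q = c}" "i div q = j div q"
    then show "i = j" using div_mult_mod_eq[of i q] div_mult_mod_eq[of j q] by simp
  qed
  moreover have "(\<lambda>i. i div q) ` {i \<in> {..<N}. i mod q = c} \<subseteq> {..N div q}"
    by (auto intro: div_le_mono)
  ultimately have "card {i \<in> {..<N}. i mod q = c} \<le> card {..N div q}" by (rule card_inj_on_le) simp
  then show ?thesis by simp
qed

text \<open>\<open>h\<close> is a free precision. Classes modulo \<open>5 ^ (3 h + 1)\<close> with
  at most two members give the first term; members of fuller classes have small \<open>y\<close> at
  5 and lie in three classes modulo \<open>5 ^ (2 h + 1)\<close>. A large \<open>h\<close> makes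
  their density small at the price of a larger constant.\<close>

lemma (in integral_curve) torsion_class_bound:
  fixes x y :: "nat \<Rightarrow> int"
  assumes minimal: "\<not> (5 ^ 4 dvd A \<and> 5 ^ 6 dvd B)"
    and d: "d \<noteq> 0" and x: "\<And>i. x i = a + int i * d"
    and S: "S \<subseteq> {..<N}" and on: "\<And>i. i \<in> S \<Longrightarrow> Some (of_int (x i), of_int (y i)) \<in> pts"
    and tors: "\<And>i j. i \<in> S \<Longrightarrow> j \<in> S \<Longrightarrow> \<exists>n>0.
      (Some (of_int (x i), of_int (y i)) \<oplus> sneg (Some (of_int (x j), of_int (y j)))) [^]\<^bsub>GG\<^esub> (n::nat) = None"
  shows "card S \<le> 2 * 5 ^ (3 * h + 1) + 3 * (N div 5 ^ (2 * h + 1) + 1)"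
proof -
  \<comment> \<open>Together with \<open>m = 2 h\<close> this is the equality case of
    \<open>3 m + 2 \<le> 2 k\<close>.\<close>
  define k where "k = 3 * h + 1"
  define m where "m = 2 * h"
  define v where "v = multiplicity 5 d"
  have v: "5 ^ v dvd d" "\<not> 5 ^ Suc v dvd d"
    using d power_dvd_iff_le_multiplicity[of d 5 "Suc v"] by (auto simp: v_def multiplicity_dvd)
  have finS: "finite S" using S finite_subset by blast
  define C where "C = (\<lambda>i. {t \<in> S. t mod 5 ^ k = i mod 5 ^ k})"
  define Good where "Good = {i \<in> S. card (C i) \<ge> 3}"
  have xdiff: "x i - x j = (int i - int j) * d" for i j by (simp add: x algebra_simps)
  have pair: "5 ^ (v + k) dvd y i + y j" if "i \<in> S" "j \<in> S" "i \<noteq> j" "i mod 5 ^ k = j mod 5 ^ k" for i j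
  proof -
    have "int i mod int (5 ^ k) = int j mod int (5 ^ k)" using that(4) by (metis of_nat_mod)
    then have "5 ^ k dvd int i - int j" by (simp add: mod_eq_dvd_iff)
    then have dvd: "5 ^ (v + k) dvd x i - x j"
      unfolding xdiff power_add using v(1) by (subst mult.commute) (intro mult_dvd_mono)
    have "x i \<noteq> x j" using that(3) d xdiff[of i j] by auto
    then show ?thesis using torsion_difference_dvd[OF on on] tors that(1,2) dvd by blast
  qed
  have good: "5 ^ (2 * v + 2 * k) dvd x i ^ 3 + A * x i + B" if "i \<in> Good" for i
  proof -
    have iS: "i \<in> S" and c: "card (C i) \<ge> 3" using that by (auto simp: Good_def)
    have "finite (C i)" using finS by (simp add: C_def)
    moreover have "i \<in> C i" using iS by (simp add: C_def)
    ultimately have "card (C i - {i}) \<ge> 2" using c by simp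
    then obtain T where T: "T \<subseteq> C i - {i}" "card T = 2" by (rule obtain_subset_with_card_n)
    then obtain j l where "T = {j, l}" "j \<noteq> l" by (meson card_2_iff)
    then have jl: "j \<in> C i - {i}" "l \<in> C i - {i}" "j \<noteq> l" using T by auto
    \<comment> \<open>A pair controls only the sum of its ordinates; with three members this
      combination isolates \<open>2 y i\<close>.\<close>
    have "5 ^ (v + k) dvd (y i + y j) + (y i + y l) - (y j + y l)"
      using jl iS by (intro dvd_diff dvd_add pair) (auto simp: C_def)
    then have "5 ^ (v + k) dvd 2 * y i" by simp
    moreover have "coprime (5 ^ (v + k) :: int) 2"
      using prime_imp_coprime[OF prime_5_int, of 2] by (simp only: coprime_power_left_iff) simp
    ultimately have "5 ^ (v + k) dvd y i" by (simp only: coprime_dvd_mult_right_iff)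
    then have "(5 ^ (v + k))\<^sup>2 dvd (y i)\<^sup>2" by (rule dvd_power_same)
    moreover have "(5::int) ^ (2 * v + 2 * k) = (5 ^ (v + k))\<^sup>2" by (simp add: power_mult[symmetric] algebra_simps)
    moreover have "(of_int ((y i)\<^sup>2) :: rat) = of_int (x i ^ 3 + A * x i + B)"
      using on[OF iS] by (simp add: on_def)
    then have "(y i)\<^sup>2 = x i ^ 3 + A * x i + B" by (simp only: of_int_eq_iff)
    ultimately show ?thesis by simp
  qed
  have "card (S - Good) \<le> 2 * 5 ^ k"
  proof -
    have "S - Good = (\<Union>c\<in>{..<5 ^ k}. {t \<in> S - Good. t mod 5 ^ k = c})" by auto
    then have "card (S - Good) \<le> (\<Sum>c\<in>{..<5 ^ k}. card {t \<in> S - Good. t mod 5 ^ k = c})"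
      by (metis card_UN_le finite_lessThan)
    also have "\<dots> \<le> (\<Sum>c\<in>{..<5 ^ k :: nat}. 2)"
    proof (rule sum_mono)
      fix c
      show "card {t \<in> S - Good. t mod 5 ^ k = c} \<le> 2"
      proof (cases "{t \<in> S - Good. t mod 5 ^ k = c} = {}")
        case False
        then obtain t where t: "t \<in> S" "t \<notin> Good" "t mod 5 ^ k = c" by blast
        then have "card (C t) \<le> 2" by (auto simp: Good_def)
        moreover have "card {t \<in> S - Good. t mod 5 ^ k = c} \<le> card (C t)"
          using finS t by (intro card_mono) (auto simp: C_def)
        ultimately show ?thesis by linarith
      qed (simp only: card.empty)
    qed
    also have "\<dots> = 2 * 5 ^ k" by simp
    finally show ?thesis .
  qed
  moreover have "card Good \<le> 3 * (N div 5 ^ Suc m + 1)"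
  proof -
    define R where "R = (\<lambda>i. i mod 5 ^ Suc m) ` Good"
    have finG: "finite Good" using finS by (simp add: Good_def)
    have "card R \<le> 3"
    proof (rule ccontr)
      assume "\<not> ?thesis"
      then have "card {..<4::nat} \<le> card R" by simp
      moreover have "finite R" using finG by (simp add: R_def)
      ultimately obtain g where g: "g ` {..<4::nat} \<subseteq> R" "inj_on g {..<4}"
        by (metis card_le_inj finite_lessThan)
      have "\<forall>i\<in>{..<4}. \<exists>t. t \<in> Good \<and> t mod 5 ^ Suc m = g i"
      proof
        fix i :: nat assume "i \<in> {..<4}"
        then have "g i \<in> R" using g(1) by blast
        then obtain t where "g i = t mod 5 ^ Suc m" "t \<in> Good" unfolding R_def by (rule imageE)
        then have "t \<in> Good \<and> t mod 5 ^ Suc m = g i" by (simp only:)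
        then show "\<exists>t. t \<in> Good \<and> t mod 5 ^ Suc m = g i" by (rule exI)
      qed
      from bchoice[OF this] obtain t
        where t': "\<forall>i\<in>{..<4}. t i \<in> Good \<and> t i mod 5 ^ Suc m = g i" by (rule exE)
      have t: "t i \<in> Good" "t i mod 5 ^ Suc m = g i" if "i < 4" for i
        using bspec[OF t', of i] that by (simp_all only: lessThan_iff)
      have "5 ^ 4 dvd A \<and> 5 ^ 6 dvd B"
      proof (rule four_points_nonminimal[OF v, of "\<lambda>i. x (t i)" m])
        fix i j :: nat assume ij: "i < 4" "j < 4" "i \<noteq> j"
        have "\<not> 5 ^ Suc m dvd int (t i) - int (t j)"
        proof
          assume "5 ^ Suc m dvd int (t i) - int (t j)"
          then have "int (t i) mod int (5 ^ Suc m) = int (t j) mod int (5 ^ Suc m)"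
            by (simp add: mod_eq_dvd_iff)
          then have "t i mod 5 ^ Suc m = t j mod 5 ^ Suc m" by (metis of_nat_mod of_nat_eq_iff)
          then show False using t(2) ij g(2) by (auto simp: inj_on_def)
        qed
        then show "\<exists>c. x (t i) - x (t j) = c * d \<and> \<not> 5 ^ Suc m dvd c" using xdiff by blast
      next
        show "3 * m + 2 \<le> 2 * k" by (simp add: m_def k_def)
      qed (use good t in blast)
      then show False using minimal by blast
    qed
    have "Good \<subseteq> (\<Union>c\<in>R. {i \<in> {..<N}. i mod 5 ^ Suc m = c})"
      using S by (auto simp: R_def Good_def)
    moreover have "finite R" using finG by (simp add: R_def)
    ultimately have "card Good \<le> card (\<Union>c\<in>R. {i \<in> {..<N}. i mod 5 ^ Suc m = c})"
      by (intro card_mono) auto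
    also have "\<dots> \<le> (\<Sum>c\<in>R. card {i \<in> {..<N}. i mod 5 ^ Suc m = c})"
      by (rule card_UN_le[OF \<open>finite R\<close>])
    also have "\<dots> \<le> (\<Sum>c\<in>R. N div 5 ^ Suc m + 1)" by (intro sum_mono card_residue_class_le)
    also have "\<dots> = card R * (N div 5 ^ Suc m + 1)" by simp
    also have "\<dots> \<le> 3 * (N div 5 ^ Suc m + 1)" using \<open>card R \<le> 3\<close> by (rule mult_le_mono1)
    finally show ?thesis .
  qed
  moreover have "card S = card (S - Good) + card Good"
    using finS by (subst card_Diff_subset) (auto simp: Good_def card_mono)
  ultimately show ?thesis by (simp add: k_def m_def)
qed

section \<open>Quadratic forms on abelian groups\<close>

context comm_group
begin

text \<open>Built like \<open>lincomb\<close>, so that \<open>short_pt_lincomb\<close> can carry one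
  to the other.\<close>

definition comb :: "int list \<Rightarrow> 'a list \<Rightarrow> 'a" where
  "comb ns ps = foldr (\<otimes>) (map2 (\<lambda>n p. p [^] n) ns ps) \<one>"

lemma comb_Nil [simp]: "comb [] ps = \<one>" "comb ns [] = \<one>"
  by (simp_all add: comb_def)

lemma comb_Cons [simp]: "comb (n # ns) (p # ps) = p [^] n \<otimes> comb ns ps"
  by (simp add: comb_def)

lemma comb_closed [simp]: "set ps \<subseteq> carrier G \<Longrightarrow> comb ns ps \<in> carrier G"
proof (induction ps arbitrary: ns)
  case (Cons p ps)
  then show ?case by (cases ns) auto
qed simp

lemma comb_zero: "set ps \<subseteq> carrier G \<Longrightarrow> \<forall>n \<in> set ns. n = 0 \<Longrightarrow> comb ns ps = \<one>"
proof (induction ps arbitrary: ns)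
  case (Cons p ps)
  then show ?case by (cases ns) auto
qed simp

end

locale psd_form = comm_group G for G (structure) +
  fixes b :: "'a \<Rightarrow> 'a \<Rightarrow> real"
  assumes add_left: "\<lbrakk>x \<in> carrier G; y \<in> carrier G; z \<in> carrier G\<rbrakk> \<Longrightarrow> b (x \<otimes> y) z = b x z + b y z"
    and sym: "\<lbrakk>x \<in> carrier G; y \<in> carrier G\<rbrakk> \<Longrightarrow> b x y = b y x"
    and nonneg: "x \<in> carrier G \<Longrightarrow> 0 \<le> b x x"
begin

lemma one_left [simp]: "z \<in> carrier G \<Longrightarrow> b \<one> z = 0"
  using add_left[of \<one> \<one> z] by simp

lemma inv_left: "x \<in> carrier G \<Longrightarrow> z \<in> carrier G \<Longrightarrow> b (inv x) z = - b x z"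
  using add_left[of x "inv x" z] by simp

lemma nat_pow_left: "x \<in> carrier G \<Longrightarrow> z \<in> carrier G \<Longrightarrow> b (x [^] (n::nat)) z = n * b x z"
  by (induction n) (auto simp: add_left algebra_simps)

lemma int_pow_left: "x \<in> carrier G \<Longrightarrow> z \<in> carrier G \<Longrightarrow> b (x [^] (n::int)) z = n * b x z"
  by (cases n rule: int_cases2) (auto simp: int_pow_int int_pow_neg nat_pow_left inv_left)

lemma int_pow_both: "x \<in> carrier G \<Longrightarrow> b (x [^] (n::int)) (x [^] n) = (of_int n)\<^sup>2 * b x x"
  using int_pow_left[of x "x [^] n" n] int_pow_left[of x x n] sym[of x "x [^] n"]
  by (simp add: power2_eq_square)

lemma add_both:
  assumes "x \<in> carrier G" "y \<in> carrier G"
  shows "b (x \<otimes> y) (x \<otimes> y) = b x x + 2 * b x y + b y y"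
  using assms sym[of x "x \<otimes> y"] sym[of y "x \<otimes> y"] sym[of x y] by (simp add: add_left)

text \<open>Only integer multiples are available, so the usual minimising multiple of \<open>e\<close> is
  approximated by rationals of growing denominator \<open>n\<close>.\<close>

lemma cauchy_schwarz:
  assumes x: "x \<in> carrier G" and e: "e \<in> carrier G" and pos: "b e e > 0"
  shows "(b x e)\<^sup>2 \<le> b x x * b e e"
proof (rule ccontr)
  assume "\<not> ?thesis"
  then have "(b x e)\<^sup>2 / b e e - b x x > 0" using pos by (simp add: field_simps)
  then obtain n :: nat where n: "real n * ((b x e)\<^sup>2 / b e e - b x x) > b e e"
    using ex_less_of_nat_mult by blast
  then have "n > 0" using pos by (cases n) auto
  define t where "t = - b x e / b e e"
  define m where "m = \<lfloor>real n * t\<rfloor>"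
  define d where "d = real n * t - m"
  have d: "0 \<le> d" "d < 1" unfolding d_def m_def by linarith+
  have "b (x [^] int n \<otimes> e [^] m) (x [^] int n \<otimes> e [^] m)
      = (real n)\<^sup>2 * b x x + 2 * (real n * (m * b x e)) + (of_int m)\<^sup>2 * b e e"
    using x e sym[of x "e [^] m"] sym[of x e] int_pow_left[of e x m]
      int_pow_left[of x "e [^] m" "int n"] int_pow_both[of x "int n"] int_pow_both[of e m]
    by (simp add: add_both algebra_simps)
  also have "real_of_int m = real n * t - d" by (simp add: d_def)
  also have "(real n)\<^sup>2 * b x x + 2 * (real n * ((real n * t - d) * b x e)) + (real n * t - d)\<^sup>2 * b e e
      = (real n)\<^sup>2 * (b x x - (b x e)\<^sup>2 / b e e) + d\<^sup>2 * b e e"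
    using pos unfolding t_def by (simp add: field_simps power2_eq_square)
  finally have "0 \<le> (real n)\<^sup>2 * (b x x - (b x e)\<^sup>2 / b e e) + d\<^sup>2 * b e e"
    using nonneg[of "x [^] int n \<otimes> e [^] m"] x e by simp
  moreover have "d\<^sup>2 * b e e \<le> b e e" using d pos by (simp add: abs_square_le_1)
  ultimately have "real n * (real n * ((b x e)\<^sup>2 / b e e - b x x)) \<le> b e e"
    by (simp add: algebra_simps power2_eq_square)
  moreover have "real n * (real n * ((b x e)\<^sup>2 / b e e - b x x)) \<ge> 1 * (real n * ((b x e)\<^sup>2 / b e e - b x x))"
    using n pos \<open>n > 0\<close> by (intro mult_right_mono) auto
  ultimately show False using n by linarith
qed

text \<open>The combination need only be null for the form, not trivial in the group. This makes the
  notion pass to the projected form in \<open>gram_schmidt_sum_squares\<close>, whose radical is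
  larger.\<close>

definition dim_le :: "nat \<Rightarrow> bool" where
  "dim_le r \<longleftrightarrow> (\<forall>ps. set ps \<subseteq> carrier G \<and> length ps = Suc r \<longrightarrow>
     (\<exists>ns. length ns = Suc r \<and> (\<exists>n \<in> set ns. n \<noteq> 0) \<and> b (comb ns ps) (comb ns ps) = 0))"

end

text \<open>Subtracting the square of \<open>b x e / sqrt (b e e)\<close> leaves a form that is
  semidefinite by Cauchy-Schwarz and has \<open>e\<close> in its radical, so the dimension drops by
  one. If no \<open>e\<close> has positive norm, all functions can be zero.\<close>

lemma gram_schmidt_sum_squares:
  assumes "psd_form G b" "psd_form.dim_le G b r"
  shows "\<exists>f :: nat \<Rightarrow> 'a \<Rightarrow> real.
     (\<forall>i<r. \<forall>x\<in>carrier G. \<forall>y\<in>carrier G. f i (x \<otimes>\<^bsub>G\<^esub> y) = f i x + f i y) \<and>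
     (\<forall>x\<in>carrier G. b x x = (\<Sum>i<r. (f i x)\<^sup>2))"
  using assms
proof (induction r arbitrary: b)
  case 0
  interpret psd_form G b by fact
  have "b x x = 0" if "x \<in> carrier G" for x
  proof -
    have "\<exists>ns. length ns = Suc 0 \<and> (\<exists>n \<in> set ns. n \<noteq> 0) \<and> b (comb ns [x]) (comb ns [x]) = 0"
      using 0(2) that unfolding dim_le_def by auto
    then obtain n where "n \<noteq> 0" "b (comb [n] [x]) (comb [n] [x]) = 0"
      by (auto simp: length_Suc_conv)
    then show ?thesis using that by (simp add: int_pow_both)
  qed
  then show ?case by simp
next
  case (Suc r)
  interpret psd_form G b by fact
  show ?case
  proof (cases "\<exists>e \<in> carrier G. b e e > 0")
    case False
    then have "b x x = 0" if "x \<in> carrier G" for x using that nonneg by force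
    then show ?thesis by (intro exI[of _ "\<lambda>_ _. 0"]) simp
  next
    case True
    then obtain e where e: "e \<in> carrier G" "b e e > 0" by blast
    define b' where "b' = (\<lambda>x y. b x y - b x e * b y e / b e e)"
    have psd: "psd_form G b'"
    proof (unfold_locales, goal_cases)
      case (1 x y z)
      then show ?case using e by (simp add: b'_def add_left field_simps)
    next
      case (2 x y)
      then show ?case using e sym[of x y] by (simp add: b'_def)
    next
      case (3 x)
      then show ?case using cauchy_schwarz[OF 3 e] e
        by (simp add: b'_def field_simps power2_eq_square)
    qed
    interpret b': psd_form G b' by (rule psd)
    have e0: "b' e x = 0" if "x \<in> carrier G" for x
      using that e sym[of e x] by (simp add: b'_def)
    have "b'.dim_le r"
      unfolding b'.dim_le_def
    proof (intro allI impI)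
      fix ps assume ps: "set ps \<subseteq> carrier G \<and> length ps = Suc r"
      have "set (e # ps) \<subseteq> carrier G \<and> length (e # ps) = Suc (Suc r)" using ps e by simp
      then obtain ms where ms: "length ms = Suc (Suc r)" "\<exists>n \<in> set ms. n \<noteq> 0"
        "b (comb ms (e # ps)) (comb ms (e # ps)) = 0"
        using Suc(3) unfolding dim_le_def by blast
      then obtain n ns where ns: "ms = n # ns" "length ns = Suc r" by (cases ms) auto
      let ?L = "comb ns ps"
      have L: "?L \<in> carrier G" using ps by simp
      have z: "b (e [^]\<^bsub>G\<^esub> n \<otimes>\<^bsub>G\<^esub> ?L) (e [^]\<^bsub>G\<^esub> n \<otimes>\<^bsub>G\<^esub> ?L) = 0" using ms ns by simp
      \<comment> \<open>A null combination involving \<open>e\<close> alone would force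
        \<open>n^2 b e e = 0\<close>, so the relation survives the removal of
        \<open>e\<close>.\<close>
      have "\<exists>n \<in> set ns. n \<noteq> 0"
      proof (rule ccontr)
        assume *: "\<not> ?thesis"
        then have "?L = \<one>\<^bsub>G\<^esub>" using ps comb_zero by blast
        then have "(of_int n)\<^sup>2 * b e e = 0" using z e int_pow_both[of e n] by simp
        then show False using * e ms(2) ns by auto
      qed
      moreover have "b' ?L ?L = 0"
      proof -
        have "b' ?L ?L = b' (e [^]\<^bsub>G\<^esub> n \<otimes>\<^bsub>G\<^esub> ?L) (e [^]\<^bsub>G\<^esub> n \<otimes>\<^bsub>G\<^esub> ?L)"
          using L e e0 b'.int_pow_left[of e] by (simp add: b'.add_both)
        also have "\<dots> \<le> b (e [^]\<^bsub>G\<^esub> n \<otimes>\<^bsub>G\<^esub> ?L) (e [^]\<^bsub>G\<^esub> n \<otimes>\<^bsub>G\<^esub> ?L)"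
          using e by (simp add: b'_def)
        finally show ?thesis using z b'.nonneg[OF L] by simp
      qed
      ultimately show "\<exists>ns. length ns = Suc r \<and> (\<exists>n \<in> set ns. n \<noteq> 0) \<and> b' (comb ns ps) (comb ns ps) = 0"
        using ns by blast
    qed
    from Suc(1)[OF psd this] obtain f where
      f: "\<And>i x y. i < r \<Longrightarrow> x \<in> carrier G \<Longrightarrow> y \<in> carrier G \<Longrightarrow> f i (x \<otimes>\<^bsub>G\<^esub> y) = f i x + f i y"
        "\<And>x. x \<in> carrier G \<Longrightarrow> b' x x = (\<Sum>i<r. (f i x)\<^sup>2)" by blast
    define g where "g = f(r := \<lambda>x. b x e / sqrt (b e e))"
    have "b x x = (\<Sum>i<Suc r. (g i x)\<^sup>2)" if "x \<in> carrier G" for x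
      using f(2)[OF that] e by (simp add: g_def b'_def power_divide power2_eq_square)
    moreover have "g i (x \<otimes>\<^bsub>G\<^esub> y) = g i x + g i y"
      if "i < Suc r" "x \<in> carrier G" "y \<in> carrier G" for i x y
      using that f(1) e by (auto simp: g_def add_left add_divide_distrib less_Suc_eq)
    ultimately show ?thesis by blast
  qed
qed

lemma sum_half_powers: "(\<Sum>k\<in>{- int n..int n}. (1/2::real) ^ nat \<bar>k\<bar>) = 3 - 2 * (1/2) ^ n"
proof (induction n)
  case (Suc n)
  have "{- int (Suc n)..int (Suc n)} = insert (- int (Suc n)) (insert (int (Suc n)) {- int n..int n})"
    by auto
  moreover have "nat (1 + int n) = Suc n" "nat (int n + 1) = Suc n" by simp_all
  ultimately show ?case using Suc by simp
qed simp

text \<open>The weights \<open>(1/2)^|z 0| * ... * (1/2)^|z (r-1)|\<close> sum to at most \<open>3^r\<close>.\<close>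

lemma card_int_vectors:
  defines "V \<equiv> \<lambda>r n. {z \<in> {..<r} \<rightarrow>\<^sub>E (UNIV :: int set). (\<Sum>i<r. \<bar>z i\<bar>) \<le> int n}"
  shows "finite (V r n)" "real (card (V r n)) \<le> 3 ^ r * 2 ^ n"
proof -
  let ?P = "{..<r} \<rightarrow>\<^sub>E {- int n..int n}"
  have sub: "V r n \<subseteq> ?P"
  proof
    fix z assume z: "z \<in> V r n"
    have "\<bar>z i\<bar> \<le> int n" if "i < r" for i
    proof -
      have "\<bar>z i\<bar> \<le> (\<Sum>i<r. \<bar>z i\<bar>)" using that by (intro member_le_sum) auto
      also have "\<dots> \<le> int n" using z by (simp add: V_def)
      finally show ?thesis .
    qed
    then have "z i \<in> {- int n..int n}" if "i < r" for i
      using that by (simp add: abs_le_iff minus_le_iff)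
    then show "z \<in> ?P" using z by (auto simp: V_def PiE_iff)
  qed
  have fin: "finite ?P" by (intro finite_PiE) auto
  then show "finite (V r n)" using sub finite_subset by blast
  \<comment> \<open>Each vector of \<open>V r n\<close> has weight at least
    \<open>(1/2) ^ n\<close>. Over the enclosing cube the sum of the weights factors, each factor
    being at most 1 + 2 (1/2 + 1/4 + ...) = 3.\<close>
  have "real (card (V r n)) * (1/2) ^ n = (\<Sum>z\<in>V r n. (1/2) ^ n)" by simp
  also have "\<dots> \<le> (\<Sum>z\<in>V r n. \<Prod>i<r. (1/2) ^ nat \<bar>z i\<bar>)"
  proof (rule sum_mono)
    fix z assume z: "z \<in> V r n"
    have "(\<Sum>i<r. nat \<bar>z i\<bar>) \<le> n"
    proof -
      have "int (\<Sum>i<r. nat \<bar>z i\<bar>) = (\<Sum>i<r. \<bar>z i\<bar>)" by simp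
      also have "\<dots> \<le> int n" using z by (simp add: V_def)
      finally show ?thesis by (simp only: of_nat_le_iff)
    qed
    then show "(1/2::real) ^ n \<le> (\<Prod>i<r. (1/2) ^ nat \<bar>z i\<bar>)"
      by (simp add: power_sum[symmetric] power_decreasing)
  qed
  also have "\<dots> \<le> (\<Sum>z\<in>?P. \<Prod>i<r. (1/2) ^ nat \<bar>z i\<bar>)"
    using fin sub by (intro sum_mono2) (auto intro!: prod_nonneg)
  also have "\<dots> = (\<Prod>i<r. \<Sum>k\<in>{- int n..int n}. (1/2) ^ nat \<bar>k\<bar>)"
    by (rule prod_sum_PiE[symmetric]) auto
  also have "\<dots> \<le> (\<Prod>i<r. 3)"
  proof (intro prod_mono conjI)
    have "(1 / 2 :: real) ^ n \<le> 1" by (rule power_le_one) auto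
    then show "(\<Sum>k\<in>{- int n..int n}. (1/2::real) ^ nat \<bar>k\<bar>) \<ge> 0"
      "(\<Sum>k\<in>{- int n..int n}. (1/2::real) ^ nat \<bar>k\<bar>) \<le> 3"
      by (simp_all add: sum_half_powers)
  qed
  finally have "real (card (V r n)) * (1/2) ^ n \<le> 3 ^ r" by simp
  then show "real (card (V r n)) \<le> 3 ^ r * 2 ^ n"
    by (simp add: power_one_over field_simps)
qed

text \<open>Its \<open>r\<close>-th power is the bound of \<open>card_int_vectors\<close> for
  \<open>n = c r\<close>, where \<open>c\<close> is the rounded
  \<open>2 / \<delta> + 2\<close>.\<close>

definition packing_const :: "real \<Rightarrow> real" where
  "packing_const \<delta> = 3 * 2 ^ nat \<lceil>2 / \<delta> + 2\<rceil>"

lemma psd_form_packing: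
  fixes G (structure)
  assumes psd: "psd_form G b" and dim: "psd_form.dim_le G b r"
    and \<delta>: "\<delta> > 0" and R: "R > 0"
    and S: "finite S" "S \<subseteq> carrier G" "\<And>x. x \<in> S \<Longrightarrow> b x x \<le> R"
    and card: "real (card S) > real m * packing_const \<delta> ^ r"
  shows "\<exists>S' \<subseteq> S. card S' > m \<and> (\<forall>x \<in> S'. \<forall>y \<in> S'. b (x \<otimes> inv y) (x \<otimes> inv y) \<le> \<delta> * R)"
proof -
  interpret psd_form G b by (rule psd)
  from gram_schmidt_sum_squares[OF psd dim] obtain f where
    f: "\<And>i x y. i < r \<Longrightarrow> x \<in> carrier G \<Longrightarrow> y \<in> carrier G \<Longrightarrow> f i (x \<otimes> y) = f i x + f i y"
      "\<And>x. x \<in> carrier G \<Longrightarrow> b x x = (\<Sum>i<r. (f i x)\<^sup>2)" by blast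
  \<comment> \<open>If each of the \<open>r\<close> coordinates of a difference is at most
    \<open>1 / s\<close>, their squares sum to at most \<open>r / s^2 = \<delta> R\<close>. For
    \<open>r = 0\<close> the form vanishes, which is treated separately.\<close>
  define s where "s = sqrt (r / (\<delta> * R))"
  have s2: "s\<^sup>2 = r / (\<delta> * R)" using \<delta> R by (simp add: s_def)
  define c where "c = nat \<lceil>2 / \<delta> + 2\<rceil>"
  have c: "real c \<ge> 2 / \<delta> + 2" unfolding c_def by (rule real_nat_ceiling_ge)
  define z where "z = (\<lambda>x. restrict (\<lambda>i. \<lfloor>f i x * s\<rfloor>) {..<r})"
  define V where "V = {z \<in> {..<r} \<rightarrow>\<^sub>E (UNIV :: int set). (\<Sum>i<r. \<bar>z i\<bar>) \<le> int (c * r)}"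
  have V: "finite V" "real (card V) \<le> packing_const \<delta> ^ r"
    using card_int_vectors[of r "c * r"]
    by (simp_all add: V_def packing_const_def c_def power_mult_distrib power_mult)
  have zV: "z x \<in> V" if "x \<in> S" for x
  proof -
    \<comment> \<open>Bounding the floor by a square turns the sum of absolute values of a label
      into the form itself: it is at most \<open>2 s^2 R + 2 r = (2 / \<delta> + 2) r\<close>,
      linear in \<open>r\<close>.\<close>
    have "real_of_int \<bar>\<lfloor>t\<rfloor>\<bar> \<le> 2 * t\<^sup>2 + 2" for t :: real
    proof -
      have "real_of_int \<bar>\<lfloor>t\<rfloor>\<bar> \<le> \<bar>t\<bar> + 1" by linarith
      also have "\<dots> \<le> 2 * t\<^sup>2 + 2"
      proof -
        have "0 \<le> (\<bar>t\<bar> - 1)\<^sup>2" by simp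
        then have "2 * \<bar>t\<bar> \<le> t\<^sup>2 + 1" by (simp add: power2_diff)
        then show ?thesis using zero_le_power2[of t] by linarith
      qed
      finally show ?thesis .
    qed
    then have "(\<Sum>i<r. real_of_int \<bar>\<lfloor>f i x * s\<rfloor>\<bar>) \<le> (\<Sum>i<r. 2 * (f i x * s)\<^sup>2 + 2)"
      by (intro sum_mono)
    also have "\<dots> = 2 * s\<^sup>2 * b x x + 2 * r"
      using f(2)[of x] that S(2)
      by (auto simp: sum.distrib power_mult_distrib sum_distrib_left algebra_simps)
    also have "\<dots> \<le> 2 * s\<^sup>2 * R + 2 * r"
      using S(3)[OF that] by (simp add: mult_left_mono)
    also have "\<dots> = (2 / \<delta> + 2) * r" using R \<delta> by (simp add: s2 field_simps)
    also have "\<dots> \<le> real c * r" using c by (intro mult_right_mono) auto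
    finally have "real_of_int (\<Sum>i<r. \<bar>\<lfloor>f i x * s\<rfloor>\<bar>) \<le> real_of_int (int (c * r))" by simp
    then have "(\<Sum>i<r. \<bar>\<lfloor>f i x * s\<rfloor>\<bar>) \<le> int (c * r)" by linarith
    then show ?thesis by (simp add: V_def z_def)
  qed
  have close: "b (x \<otimes> inv y) (x \<otimes> inv y) \<le> \<delta> * R" if "x \<in> S" "y \<in> S" "z x = z y" for x y
  proof -
    have xy: "x \<in> carrier G" "y \<in> carrier G" using that S(2) by auto
    have diff: "f i (x \<otimes> inv y) = f i x - f i y" if "i < r" for i
      using f(1)[OF that, of "x \<otimes> inv y" y] xy by (simp add: m_assoc)
    have "(f i (x \<otimes> inv y) * s)\<^sup>2 \<le> 1" if "i < r" for i
    proof -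
      have "z x i = z y i" using \<open>z x = z y\<close> by simp
      then have "\<lfloor>f i x * s\<rfloor> = \<lfloor>f i y * s\<rfloor>" using that by (simp add: z_def)
      then have "\<bar>f i x * s - f i y * s\<bar> \<le> 1" by linarith
      then have "\<bar>(f i x - f i y) * s\<bar> \<le> 1" by (simp only: left_diff_distrib)
      then show ?thesis unfolding diff[OF that] by (rule abs_square_le_1[THEN iffD2])
    qed
    then have "(\<Sum>i<r. (f i (x \<otimes> inv y) * s)\<^sup>2) \<le> (\<Sum>i<r. 1)" by (intro sum_mono) auto
    then have *: "s\<^sup>2 * b (x \<otimes> inv y) (x \<otimes> inv y) \<le> r"
      using f(2)[of "x \<otimes> inv y"] xy
      by (simp add: power_mult_distrib sum_distrib_left algebra_simps)
    show ?thesis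
    proof (cases "r = 0")
      case True
      then show ?thesis using f(2)[of "x \<otimes> inv y"] xy \<delta> R by simp
    next
      case False
      then show ?thesis using * \<delta> R by (simp add: s2 field_simps)
    qed
  qed
  have "\<exists>v \<in> V. card {x \<in> S. z x = v} > m"
  proof (rule ccontr)
    assume "\<not> ?thesis"
    then have le: "card {x \<in> S. z x = v} \<le> m" if "v \<in> V" for v using that by force
    have "S = (\<Union>v\<in>V. {x \<in> S. z x = v})" using zV by auto
    then have "card S \<le> (\<Sum>v\<in>V. card {x \<in> S. z x = v})" using card_UN_le V(1) by metis
    also have "\<dots> \<le> (\<Sum>v\<in>V. m)" by (intro sum_mono le)
    finally have "card S \<le> m * card V" by (simp add: mult.commute)
    then have "real (card S) \<le> real m * real (card V)" using of_nat_mono by fastforce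
    also have "\<dots> \<le> real m * packing_const \<delta> ^ r" using V(2) by (intro mult_left_mono) auto
    finally show False using card by simp
  qed
  then obtain v where "card {x \<in> S. z x = v} > m" by blast
  then show ?thesis using close by (intro exI[of _ "{x \<in> S. z x = v}"]) auto
qed

section \<open>From a nearly quadratic height to a quadratic form\<close>

lemma (in comm_group) jordan_von_neumann:
  assumes nonneg: "\<And>x. x \<in> carrier G \<Longrightarrow> 0 \<le> q x"
    and par: "\<And>x y. x \<in> carrier G \<Longrightarrow> y \<in> carrier G \<Longrightarrow> q (x \<otimes> y) + q (x \<otimes> inv y) = 2 * q x + 2 * q y"
  defines "b \<equiv> \<lambda>x y. (q (x \<otimes> y) - q x - q y) / (2::real)"
  shows "psd_form G b" "\<And>x. x \<in> carrier G \<Longrightarrow> b x x = q x"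
proof -
  have q1: "q \<one> = 0" using par[of \<one> \<one>] by simp
  show b: "b x x = q x" if "x \<in> carrier G" for x
    using par[of x x] that by (simp add: b_def q1)
  show "psd_form G b"
  proof (unfold_locales, goal_cases)
    case (1 x y z)
    \<comment> \<open>In \<open>a - b + c\<close> the terms with
      \<open>x \<otimes> inv y \<otimes> z\<close> and with both inverses cancel; \<open>d\<close>
      then replaces \<open>q (x \<otimes> inv y)\<close>.\<close>
    have a: "q ((x \<otimes> z) \<otimes> y) + q ((x \<otimes> z) \<otimes> inv y) = 2 * q (x \<otimes> z) + 2 * q y"
      using 1 by (intro par) auto
    have b: "q ((x \<otimes> inv y) \<otimes> z) + q ((x \<otimes> inv y) \<otimes> inv z) = 2 * q (x \<otimes> inv y) + 2 * q z"
      using 1 by (intro par) auto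
    have c: "q (x \<otimes> (y \<otimes> z)) + q (x \<otimes> inv (y \<otimes> z)) = 2 * q x + 2 * q (y \<otimes> z)"
      using 1 by (intro par) auto
    have d: "q (x \<otimes> y) + q (x \<otimes> inv y) = 2 * q x + 2 * q y" using 1 by (intro par) auto
    have "(x \<otimes> z) \<otimes> y = x \<otimes> y \<otimes> z" "(x \<otimes> z) \<otimes> inv y = x \<otimes> inv y \<otimes> z"
      "x \<otimes> (y \<otimes> z) = x \<otimes> y \<otimes> z" "x \<otimes> inv (y \<otimes> z) = (x \<otimes> inv y) \<otimes> inv z"
      using 1 by (simp_all add: m_ac inv_mult)
    then show ?case unfolding b_def using a b c d by (simp add: field_simps)
  next
    case (2 x y)
    then show ?case by (simp add: b_def m_comm)
  next
    case (3 x)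
    then show ?case using b nonneg by simp
  qed
qed

context comm_group
begin

definition tate_limit :: "('a \<Rightarrow> real) \<Rightarrow> 'a \<Rightarrow> real" where
  "tate_limit h x = lim (\<lambda>n. h (x [^] (2 ^ n :: nat)) / 4 ^ n)"

context
  fixes h :: "'a \<Rightarrow> real" and c :: real
  assumes h_nonneg: "\<And>x. x \<in> carrier G \<Longrightarrow> 0 \<le> h x"
    and h_par: "\<And>x y. x \<in> carrier G \<Longrightarrow> y \<in> carrier G \<Longrightarrow>
        h (x \<otimes> y) + h (x \<otimes> inv y) \<le> 2 * h x + 2 * h y + c"
    and h_dup: "\<And>x. x \<in> carrier G \<Longrightarrow> h (x \<otimes> x) \<ge> 4 * h x - c"
begin

text \<open>Tate's telescoping: consecutive terms differ by at most \<open>c / 4 ^ (n + 1)\<close>,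
  so the sequence converges geometrically and moves by at most \<open>c / 3\<close> in total,
  rounded up to \<open>c\<close>.\<close>

lemma tate_limit_props:
  assumes x: "x \<in> carrier G"
  shows tate_limit_LIMSEQ: "(\<lambda>n. h (x [^] (2 ^ n :: nat)) / 4 ^ n) \<longlonglongrightarrow> tate_limit h x"
    and tate_limit_diff: "\<bar>tate_limit h x - h x\<bar> \<le> c"
proof -
  define a where "a = (\<lambda>n. h (x [^] (2 ^ n :: nat)) / 4 ^ n)"
  have h2: "\<bar>h (y \<otimes> y) - 4 * h y\<bar> \<le> c" if "y \<in> carrier G" for y
    using h_par[of y y] h_dup[of y] h_nonneg[of \<one>] that by auto
  have "c \<ge> 0" using h2[OF one_closed] by linarith
  define d where "d = (\<lambda>n. a (Suc n) - a n)"
  have dle: "\<bar>d n\<bar> \<le> c / 4 * (1/4) ^ n" for n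
  proof -
    let ?y = "x [^] (2 ^ n :: nat)"
    have "x [^] (2 ^ Suc n :: nat) = ?y \<otimes> ?y" using x by (simp add: nat_pow_mult mult_2)
    then have "d n = (h (?y \<otimes> ?y) - 4 * h ?y) / 4 ^ Suc n"
      by (simp add: d_def a_def field_simps)
    then have "\<bar>d n\<bar> \<le> c / 4 ^ Suc n" using h2[of ?y] x by (simp add: divide_right_mono)
    then show ?thesis by (simp add: power_one_over field_simps)
  qed
  have geo: "(\<lambda>n. c / 4 * (1/4::real) ^ n) sums (c / 4 * (1 / (1 - 1/4)))"
    by (intro sums_mult geometric_sums) simp
  have sd: "summable (\<lambda>n. \<bar>d n\<bar>)"
    by (rule summable_comparison_test'[OF sums_summable[OF geo], of 0]) (use dle in auto)
  have sum_d: "summable d" using sd summable_rabs_cancel by blast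
  have tel: "a n = h x + (\<Sum>k<n. d k)" for n
    using x sum_lessThan_telescope[of a n] by (simp add: d_def a_def)
  have lim: "a \<longlonglongrightarrow> h x + suminf d"
    unfolding tel by (intro tendsto_intros summable_LIMSEQ sum_d)
  then have lim': "tate_limit h x = h x + suminf d"
    unfolding tate_limit_def a_def by (rule limI)
  then show "(\<lambda>n. h (x [^] (2 ^ n :: nat)) / 4 ^ n) \<longlonglongrightarrow> tate_limit h x"
    using lim by (simp add: a_def)
  have "\<bar>suminf d\<bar> \<le> (\<Sum>n. \<bar>d n\<bar>)" by (rule summable_rabs[OF sd])
  also have "\<dots> \<le> (\<Sum>n. c / 4 * (1/4) ^ n)"
    by (intro suminf_le dle sd sums_summable[OF geo])
  also have "\<dots> = c / 3" using sums_unique[OF geo] by simp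
  also have "\<dots> \<le> c" using \<open>c \<ge> 0\<close> by simp
  finally show "\<bar>tate_limit h x - h x\<bar> \<le> c" by (simp add: lim')
qed

lemma tate_limit_nonneg: "x \<in> carrier G \<Longrightarrow> tate_limit h x \<ge> 0"
  by (rule LIMSEQ_le_const[OF tate_limit_LIMSEQ]) (auto simp: h_nonneg)

lemma tate_limit_double:
  assumes x: "x \<in> carrier G"
  shows "tate_limit h (x \<otimes> x) = 4 * tate_limit h x"
proof -
  have e: "(x \<otimes> x) [^] (2 ^ n :: nat) = x [^] (2 ^ Suc n :: nat)" for n
    using x by (simp add: nat_pow_distrib nat_pow_mult mult_2)
  have "(\<lambda>n. 4 * (h (x [^] (2 ^ Suc n :: nat)) / 4 ^ Suc n)) \<longlonglongrightarrow> 4 * tate_limit h x"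
    by (intro tendsto_intros LIMSEQ_Suc[OF tate_limit_LIMSEQ[OF x]])
  moreover have "(\<lambda>n. h ((x \<otimes> x) [^] (2 ^ n :: nat)) / 4 ^ n) \<longlonglongrightarrow> tate_limit h (x \<otimes> x)"
    using x by (intro tate_limit_LIMSEQ) simp
  ultimately show ?thesis using LIMSEQ_unique unfolding e by fastforce
qed

text \<open>Dividing by \<open>4 ^ n\<close> removes the error \<open>c\<close> and gives one
  inequality. Applied to \<open>x \<otimes> y\<close> and \<open>x \<otimes> inv y\<close>, whose
  product and quotient are \<open>x \<otimes> x\<close> and \<open>y \<otimes> y\<close>, it gives
  the other by exact duplication.\<close>

lemma tate_limit_parallelogram:
  assumes x: "x \<in> carrier G" and y: "y \<in> carrier G"
  shows "tate_limit h (x \<otimes> y) + tate_limit h (x \<otimes> inv y) = 2 * tate_limit h x + 2 * tate_limit h y"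
proof -
  have le: "tate_limit h (x \<otimes> y) + tate_limit h (x \<otimes> inv y) \<le> 2 * tate_limit h x + 2 * tate_limit h y"
    if "x \<in> carrier G" "y \<in> carrier G" for x y
  proof -
    let ?p = "\<lambda>n. 2 ^ n :: nat"
    have lim: "(\<lambda>n. 2 * (h (x [^] ?p n) / 4 ^ n) + 2 * (h (y [^] ?p n) / 4 ^ n) + c * (1/4) ^ n)
        \<longlonglongrightarrow> 2 * tate_limit h x + 2 * tate_limit h y + c * 0"
      by (intro tendsto_intros tate_limit_LIMSEQ that LIMSEQ_power_zero) simp
    have lim2: "(\<lambda>n. h ((x \<otimes> y) [^] ?p n) / 4 ^ n + h ((x \<otimes> inv y) [^] ?p n) / 4 ^ n)
        \<longlonglongrightarrow> tate_limit h (x \<otimes> y) + tate_limit h (x \<otimes> inv y)"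
      using that by (intro tendsto_intros tate_limit_LIMSEQ) auto
    have "h ((x \<otimes> y) [^] ?p n) / 4 ^ n + h ((x \<otimes> inv y) [^] ?p n) / 4 ^ n
       \<le> 2 * (h (x [^] ?p n) / 4 ^ n) + 2 * (h (y [^] ?p n) / 4 ^ n) + c * (1/4) ^ n" for n
    proof -
      have "h (x [^] ?p n \<otimes> y [^] ?p n) + h (x [^] ?p n \<otimes> inv (y [^] ?p n))
          \<le> 2 * h (x [^] ?p n) + 2 * h (y [^] ?p n) + c"
        using that by (intro h_par) auto
      then have "(h (x [^] ?p n \<otimes> y [^] ?p n) + h (x [^] ?p n \<otimes> inv (y [^] ?p n))) / 4 ^ n
          \<le> (2 * h (x [^] ?p n) + 2 * h (y [^] ?p n) + c) / 4 ^ n"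
        by (intro divide_right_mono) auto
      then show ?thesis using that
        by (simp add: nat_pow_distrib nat_pow_inv add_divide_distrib power_one_over)
    qed
    then show ?thesis using LIMSEQ_le[OF lim2 lim] by auto
  qed
  have e1: "(x \<otimes> y) \<otimes> (x \<otimes> inv y) = x \<otimes> x"
    using x y by (metis inv_closed inv_solve_right m_assoc m_closed m_comm)
  have e2: "(x \<otimes> y) \<otimes> inv (x \<otimes> inv y) = y \<otimes> y"
    using x y by (simp add: inv_mult m_ac) (metis inv_closed inv_solve_left m_closed m_comm m_lcomm)
  have "tate_limit h (x \<otimes> x) + tate_limit h (y \<otimes> y)
      \<le> 2 * tate_limit h (x \<otimes> y) + 2 * tate_limit h (x \<otimes> inv y)"
    using le[of "x \<otimes> y" "x \<otimes> inv y"] x y by (simp add: e1 e2)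
  then show ?thesis using le[OF x y] tate_limit_double x y by simp
qed

end
end

section \<open>The canonical height and the minimal model\<close>

context comm_group
begin

lemma comb_unit:
  "p \<in> set ps \<Longrightarrow> set ps \<subseteq> carrier G \<Longrightarrow> \<exists>ns. length ns = length ps \<and> comb ns ps = p"
proof (induction ps)
  case (Cons p' ps)
  show ?case
  proof (cases "p = p'")
    case True
    then have "comb (1 # replicate (length ps) 0) (p' # ps) = p"
      using Cons.prems comb_zero[of ps "replicate (length ps) 0"] by (simp add: int_pow_1)
    then show ?thesis by (intro exI[of _ "1 # replicate (length ps) 0"]) simp
  next
    case False
    then obtain ns where "length ns = length ps" "comb ns ps = p" using Cons by auto
    then show ?thesis using Cons.prems by (intro exI[of _ "0 # ns"]) auto
  qed
qed simp

text \<open>\<open>has_rank\<close> bounds distinct lists, while \<open>dim_le\<close> speaks of all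
  lists. A repeated entry supplies the relation, with coefficient -1 at one occurrence.\<close>

lemma comb_not_distinct:
  "\<not> distinct ps \<Longrightarrow> set ps \<subseteq> carrier G \<Longrightarrow>
    \<exists>ns. length ns = length ps \<and> (\<exists>n \<in> set ns. n \<noteq> 0) \<and> comb ns ps = \<one>"
proof (induction ps)
  case (Cons p ps)
  show ?case
  proof (cases "p \<in> set ps")
    case True
    then obtain ns where ns: "length ns = length ps" "comb ns ps = p"
      using comb_unit[of p ps] Cons.prems by auto
    then have "comb (- 1 # ns) (p # ps) = \<one>" using Cons.prems by (simp add: int_pow_neg int_pow_1)
    then show ?thesis using ns by (intro exI[of _ "- 1 # ns"]) simp
  next
    case False
    then obtain ns where "length ns = length ps" "\<exists>n \<in> set ns. n \<noteq> 0" "comb ns ps = \<one>"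
      using Cons by auto
    then show ?thesis using Cons.prems by (intro exI[of _ "0 # ns"]) auto
  qed
qed simp

end

context integral_curve
begin

definition can_ht :: "rat pt \<Rightarrow> real" where
  "can_ht = GG.tate_limit ht"

definition pairing :: "rat pt \<Rightarrow> rat pt \<Rightarrow> real" where
  "pairing P Q = (can_ht (P \<oplus> Q) - can_ht P - can_ht Q) / 2"

lemma ht_conditions:
  "\<And>P. P \<in> carrier GG \<Longrightarrow> 0 \<le> ht P"
  "\<And>P Q. P \<in> carrier GG \<Longrightarrow> Q \<in> carrier GG \<Longrightarrow>
     ht (P \<otimes>\<^bsub>GG\<^esub> Q) + ht (P \<otimes>\<^bsub>GG\<^esub> inv\<^bsub>GG\<^esub> Q) \<le> 2 * ht P + 2 * ht Q + 15 * ln M"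
  "\<And>P. P \<in> carrier GG \<Longrightarrow> ht (P \<otimes>\<^bsub>GG\<^esub> P) \<ge> 4 * ht P - 15 * ln M"
  using ht_parallelogram ht_double by (simp_all add: wheight_nonneg)

lemma can_ht_LIMSEQ:
  "P \<in> pts \<Longrightarrow> (\<lambda>n. ht (P [^]\<^bsub>GG\<^esub> (2 ^ n :: nat)) / 4 ^ n) \<longlonglongrightarrow> can_ht P"
  unfolding can_ht_def using GG.tate_limit_LIMSEQ[where h = ht and c = "15 * ln M", OF ht_conditions]
  by (simp only: GG_simps)

lemma can_ht_diff: "P \<in> pts \<Longrightarrow> \<bar>can_ht P - ht P\<bar> \<le> 15 * ln M"
  unfolding can_ht_def using GG.tate_limit_diff[where h = ht and c = "15 * ln M", OF ht_conditions]
  by (simp only: GG_simps)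

lemma can_ht_nonneg: "P \<in> pts \<Longrightarrow> can_ht P \<ge> 0"
  unfolding can_ht_def using GG.tate_limit_nonneg[where h = ht and c = "15 * ln M", OF ht_conditions]
  by (simp only: GG_simps)

lemma can_ht_parallelogram:
  "P \<in> pts \<Longrightarrow> Q \<in> pts \<Longrightarrow> can_ht (P \<oplus> Q) + can_ht (P \<oplus> sneg Q) = 2 * can_ht P + 2 * can_ht Q"
  unfolding can_ht_def using GG.tate_limit_parallelogram[where h = ht and c = "15 * ln M", OF ht_conditions, of P Q]
  by (simp only: GG_simps GG_inv)

lemma psd_form_pairing: "psd_form GG pairing" and pairing_self: "P \<in> pts \<Longrightarrow> pairing P P = can_ht P"
  using GG.jordan_von_neumann[of can_ht] can_ht_nonneg can_ht_parallelogram
  by (simp_all add: pairing_def[abs_def])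

lemma can_ht_None: "can_ht None = 0"
  using can_ht_parallelogram[of None None] by simp

lemma can_ht_packing:
  assumes "psd_form.dim_le GG pairing r" "\<delta> > 0" "R > 0" "finite S" "S \<subseteq> pts"
    "\<And>P. P \<in> S \<Longrightarrow> can_ht P \<le> R" "real (card S) > real m * packing_const \<delta> ^ r"
  shows "\<exists>S' \<subseteq> S. card S' > m \<and> (\<forall>P \<in> S'. \<forall>Q \<in> S'. can_ht (P \<oplus> sneg Q) \<le> \<delta> * R)"
proof -
  have "\<exists>S' \<subseteq> S. card S' > m \<and> (\<forall>P \<in> S'. \<forall>Q \<in> S'.
      pairing (P \<otimes>\<^bsub>GG\<^esub> inv\<^bsub>GG\<^esub> Q) (P \<otimes>\<^bsub>GG\<^esub> inv\<^bsub>GG\<^esub> Q) \<le> \<delta> * R)"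
    by (rule psd_form_packing[OF psd_form_pairing assms(1-4)])
      (use assms in \<open>auto simp: pairing_self subset_iff\<close>)
  then obtain S' where S': "S' \<subseteq> S" "card S' > m" and close: "\<And>P Q. P \<in> S' \<Longrightarrow> Q \<in> S' \<Longrightarrow>
      pairing (P \<otimes>\<^bsub>GG\<^esub> inv\<^bsub>GG\<^esub> Q) (P \<otimes>\<^bsub>GG\<^esub> inv\<^bsub>GG\<^esub> Q) \<le> \<delta> * R" by blast
  have "can_ht (P \<oplus> sneg Q) \<le> \<delta> * R" if "P \<in> S'" "Q \<in> S'" for P Q
  proof -
    have "P \<in> pts" "Q \<in> pts" using that S' assms(5) by blast+
    then show ?thesis using close[OF that] by (simp add: pairing_self)
  qed
  then show ?thesis using S' by blast
qed

lemma ht_sum_integral_points: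
  fixes x1 y1 x2 y2 :: int
  assumes P: "Some (of_int x1, of_int y1) \<in> pts" and Q: "Some (of_int x2, of_int y2) \<in> pts"
    and ne: "x1 \<noteq> x2" and X: "\<bar>real_of_int x1\<bar> \<le> X" "\<bar>real_of_int x2\<bar> \<le> X" "M \<le> X"
  shows "ht (Some (of_int x1, of_int y1) \<oplus> Some (of_int x2, of_int y2)) \<le> ln (14 * X ^ 3)"
proof -
  \<comment> \<open>The numerator of \<open>x(P + Q)\<close> over \<open>(x1 - x2)^2\<close>, with
    the squares of the ordinates eliminated by the curve equation. The remaining
    \<open>y1 y2\<close> is of order \<open>X^3\<close> by the arithmetic-geometric mean
    inequality.\<close>
  define n where "n = (x1 + x2) * (x1 * x2 + A) + 2 * B - 2 * (y1 * y2)"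
  have X2: "X \<ge> 2" using X M by simp
  have eq: "y1\<^sup>2 = x1 ^ 3 + A * x1 + B" "y2\<^sup>2 = x2 ^ 3 + A * x2 + B"
  proof -
    have "(of_int (y1\<^sup>2) :: rat) = of_int (x1 ^ 3 + A * x1 + B)"
      "(of_int (y2\<^sup>2) :: rat) = of_int (x2 ^ 3 + A * x2 + B)"
      using P Q by (simp_all add: on_def)
    then show "y1\<^sup>2 = x1 ^ 3 + A * x1 + B" "y2\<^sup>2 = x2 ^ 3 + A * x2 + B"
      by (simp_all only: of_int_eq_iff)
  qed
  have pw: "X \<le> X ^ 3" "X * X \<le> X ^ 3"
    using X2 power_increasing[of 1 3 X] power_increasing[of 2 3 X] by (simp_all add: power2_eq_square)
  have ysq: "(real_of_int y)\<^sup>2 \<le> 3 * X ^ 3"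
    if "y\<^sup>2 = x ^ 3 + A * x + B" "\<bar>real_of_int x\<bar> \<le> X" for x y :: int
  proof -
    have "(real_of_int y)\<^sup>2 = real_of_int (x ^ 3 + A * x + B)" using that(1) by (metis of_int_power)
    also have "\<dots> \<le> \<bar>real_of_int x ^ 3 + real_of_int A * real_of_int x + real_of_int B\<bar>" by simp
    also have "\<dots> \<le> X ^ 3 + X * X + X" using M X that(2) by (intro abs_intros) auto
    finally show ?thesis using pw by linarith
  qed
  have yy: "\<bar>real_of_int y1 * real_of_int y2\<bar> \<le> 3 * X ^ 3"
  proof -
    have "0 \<le> (\<bar>real_of_int y1\<bar> - \<bar>real_of_int y2\<bar>)\<^sup>2" by simp
    then have "2 * (\<bar>real_of_int y1\<bar> * \<bar>real_of_int y2\<bar>) \<le> (real_of_int y1)\<^sup>2 + (real_of_int y2)\<^sup>2"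
      by (simp add: power2_diff)
    then show ?thesis using ysq[OF eq(1) X(1)] ysq[OF eq(2) X(2)] by (simp add: abs_mult)
  qed
  have "\<bar>real_of_int n\<bar> \<le> (X + X) * (X * X + X) + 2 * X + 2 * (3 * X ^ 3)"
    unfolding n_def of_int_add of_int_diff of_int_mult of_int_numeral
  proof (rule abs_intros(2))
    show "\<bar>(real_of_int x1 + real_of_int x2) * (real_of_int x1 * real_of_int x2 + real_of_int A) + 2 * real_of_int B\<bar>
        \<le> (X + X) * (X * X + X) + 2 * X"
      using M X by (intro abs_intros) auto
    show "\<bar>2 * (real_of_int y1 * real_of_int y2)\<bar> \<le> 2 * (3 * X ^ 3)"
      using yy by (simp add: abs_mult)
  qed
  also have "\<dots> = 8 * X ^ 3 + 2 * (X * X) + 2 * X" by algebra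
  also have "\<dots> \<le> 14 * X ^ 3" using pw X2 by linarith
  finally have n: "\<bar>real_of_int n\<bar> \<le> 14 * X ^ 3" .
  have "\<bar>real_of_int ((x1 - x2)\<^sup>2)\<bar> \<le> (X + X)\<^sup>2"
    unfolding of_int_diff of_int_power by (intro abs_intros X)
  also have "\<dots> = 4 * (X * X)" by algebra
  also have "\<dots> \<le> 14 * X ^ 3" using pw X2 by linarith
  finally have d: "\<bar>real_of_int ((x1 - x2)\<^sup>2)\<bar> \<le> 14 * X ^ 3" .
  let ?l = "(of_int (y2 - y1) / of_int (x2 - x1) :: rat)"
  have "\<exists>y. Some (of_int x1, of_int y1) \<oplus> Some (of_int x2, of_int y2) = Some (?l\<^sup>2 - of_int x1 - of_int x2, y)"
    using ne by (simp add: Let_def slope_def)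
  then have "xcoord (Some (of_int x1, of_int y1) \<oplus> Some (of_int x2, of_int y2)) = ?l\<^sup>2 - of_int x1 - of_int x2"
    by auto
  also have "\<dots> = of_int n / of_int ((x1 - x2)\<^sup>2)"
  proof -
    define D Y t where "D = (of_int (x2 - x1) :: rat)" and "Y = (of_int (y2 - y1) :: rat)"
      and "t = (of_int x1 + of_int x2 :: rat)"
    have D: "D \<noteq> 0" using ne by (simp add: D_def)
    have "(y2 - y1)\<^sup>2 - (x1 + x2) * (x2 - x1)\<^sup>2 = n"
      unfolding n_def using eq by algebra
    then have "of_int n = Y\<^sup>2 - t * D\<^sup>2" by (auto simp: Y_def t_def D_def)
    moreover have "of_int ((x1 - x2)\<^sup>2) = D\<^sup>2" by (simp add: D_def power2_commute)
    moreover have "(Y\<^sup>2 - t * D\<^sup>2) / D\<^sup>2 = (Y / D)\<^sup>2 - t"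
      using D by (simp add: power_divide diff_divide_distrib)
    ultimately show ?thesis by (simp add: D_def Y_def t_def)
  qed
  finally show ?thesis using wheight_quotient_le[OF _ n d] ne by simp
qed

end

section \<open>Invariants of the minimal model and size of the short coefficients\<close>

definition b6 :: "wmodel \<Rightarrow> int" where
  "b6 E = a3 E ^ 2 + 4 * a6 E"

definition c6 :: "wmodel \<Rightarrow> int" where
  "c6 E = - (b2 E ^ 3) + 36 * b2 E * b4 E - 216 * b6 E"

lemma disc_c4_c6: "1728 * disc E = c4 E ^ 3 - c6 E ^ 2"
  unfolding disc_def c4_def c6_def b2_def b4_def b6_def Let_def by algebra

definition shortA :: "wmodel \<Rightarrow> int" where "shortA E = - 27 * c4 E"
definition shortB :: "wmodel \<Rightarrow> int" where "shortB E = - 54 * c6 E"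

text \<open>The constant is \<open>6 ^ 12 / 16\<close>: the substitution multiplies the discriminant
  by \<open>6 ^ 12\<close>, and the discriminant of the short model is -16 times the left
  side.\<close>

lemma short_disc: "4 * shortA E ^ 3 + 27 * (shortB E)\<^sup>2 = - 136048896 * disc E"
proof -
  have "4 * shortA E ^ 3 + 27 * (shortB E)\<^sup>2 = - 78732 * (c4 E ^ 3 - c6 E ^ 2)"
    unfolding shortA_def shortB_def by algebra
  then show ?thesis unfolding disc_c4_c6[symmetric] by simp
qed

text \<open>If \<open>5^4\<close> divides \<open>c4\<close> and \<open>5^6\<close> divides \<open>c6\<close>, then the change of variables with
  \<open>u = 5\<close> and the integers \<open>r, s, t\<close> below leads to an integral model of smaller discriminant.\<close>

lemma global_minimal_5:
  assumes E: "global_minimal E"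
  shows "\<not> (5 ^ 4 dvd shortA E \<and> 5 ^ 6 dvd shortB E)"
proof
  assume dvd: "5 ^ 4 dvd shortA E \<and> 5 ^ 6 dvd shortB E"
  have cop: "coprime (5 ^ n :: int) m" if "\<not> 5 dvd m" for n m
    using that prime_imp_coprime[OF prime_5_int] by (simp add: coprime_power_left_iff)
  have cancel: "5 ^ n dvd w" if "5 ^ n dvd m * w" "\<not> 5 dvd m" for n and m w :: int
    using that cop coprime_dvd_mult_right_iff by blast
  have "5 ^ 4 dvd (- 27) * c4 E" "5 ^ 6 dvd (- 54) * c6 E"
    using dvd by (simp_all add: shortA_def shortB_def)
  then have c4: "5 ^ 4 dvd c4 E" and c6: "5 ^ 6 dvd c6 E" using cancel by fastforce+
  \<comment> \<open>Since 5 = 1 + 2 * 2, 25 = 1 + 3 * 8 and 125 = 1 + 2 * 62, these choices make the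
    first three numerators equal to \<open>5 a1\<close>, \<open>25 e2\<close> and
    \<open>125 e3\<close>.\<close>
  define s where "s = 2 * a1 E"
  define e2 where "e2 = a2 E - s * a1 E - s\<^sup>2"
  define r where "r = 8 * e2"
  define e3 where "e3 = a3 E + r * a1 E"
  define t where "t = 62 * e3"
  define n4 where "n4 = a4 E - s * a3 E + 2 * r * a2 E - (t + r * s) * a1 E + 3 * r\<^sup>2 - 2 * s * t"
  define n6 where "n6 = a6 E + r * a4 E + r\<^sup>2 * a2 E + r ^ 3 - t * a3 E - t\<^sup>2 - r * t * a1 E"
  define f2 where "f2 = (a1 E)\<^sup>2 + 4 * e2"
  have e: "a1 E + 2 * s = 5 * a1 E" "a2 E - s * a1 E + 3 * r - s\<^sup>2 = 5 ^ 2 * e2" "a3 E + r * a1 E + 2 * t = 5 ^ 3 * e3"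
    by (simp_all add: s_def r_def e2_def t_def e3_def)
  have c4': "c4 E = (5 ^ 2 * f2)\<^sup>2 - 24 * (2 * n4 + 5 ^ 4 * (a1 E * e3))"
    unfolding c4_def b2_def b4_def n4_def f2_def t_def e3_def r_def e2_def s_def by algebra
  have c6': "c6 E = - ((5 ^ 2 * f2) ^ 3) + 36 * (5 ^ 2 * f2) * (2 * n4 + 5 ^ 4 * (a1 E * e3)) - 216 * ((5 ^ 3 * e3)\<^sup>2 + 4 * n6)"
    unfolding c6_def b2_def b4_def b6_def n6_def n4_def f2_def t_def e3_def r_def e2_def s_def by algebra
  \<comment> \<open>The numerators of the last two coefficients are recovered from \<open>c4\<close>
    and \<open>c6\<close>, where their factors 48 and 864 are prime to 5.\<close>
  have "48 * n4 = 5 ^ 4 * (f2\<^sup>2 - 24 * (a1 E * e3)) - c4 E" unfolding c4' by algebra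
  then have "5 ^ 4 dvd 48 * n4" using c4 by (metis dvd_diff dvd_triv_left)
  then have "5 ^ 4 dvd n4" by (rule cancel) simp
  then obtain m4 where m4: "n4 = 5 ^ 4 * m4" by blast
  have "864 * n6 = 5 ^ 6 * (- (f2 ^ 3) + 36 * f2 * (2 * m4 + a1 E * e3) - 216 * e3\<^sup>2) - c6 E"
    unfolding c6' m4 by algebra
  then have "5 ^ 6 dvd 864 * n6" using c6 by (metis dvd_diff dvd_triv_left)
  then have "5 ^ 6 dvd n6" by (rule cancel) simp
  then obtain m6 where m6: "n6 = 5 ^ 6 * m6" by blast
  define F where "F = \<lparr>a1 = a1 E, a2 = e2, a3 = e3, a4 = m4, a6 = m6\<rparr>"
  have "c4 F = f2\<^sup>2 - 24 * (2 * m4 + a1 E * e3)"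
    by (simp add: c4_def b2_def b4_def F_def f2_def)
  then have F4: "c4 E = 5 ^ 4 * c4 F" unfolding c4' m4 by algebra
  have "c6 F = - (f2 ^ 3) + 36 * f2 * (2 * m4 + a1 E * e3) - 216 * (e3\<^sup>2 + 4 * m6)"
    by (simp add: c6_def b2_def b4_def b6_def F_def f2_def)
  then have F6: "c6 E = 5 ^ 6 * c6 F" unfolding c6' m4 m6 by algebra
  have "1728 * disc E = 1728 * (5 ^ 12 * disc F)"
    using disc_c4_c6[of E] disc_c4_c6[of F] unfolding F4 F6 by algebra
  then have disc: "disc E = 5 ^ 12 * disc F" by simp
  have "disc_q (of_int (a1 E)) (of_int e2) (of_int e3) (of_int m4) (of_int m6) = of_int (disc F)"
    by (simp add: disc_q_def disc_def b2_def b4_def F_def Let_def)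
  moreover have "\<bar>of_int (disc E)\<bar> \<le> \<bar>disc_q (of_int (a1 E)) (of_int e2) (of_int e3) (of_int m4) (of_int m6)\<bar>"
  proof -
    let ?i = "of_int :: int \<Rightarrow> rat"
    have r1: "(?i (a1 E) + 2 * ?i s) / 5 = ?i (a1 E)"
      using arg_cong[OF e(1), of ?i] by simp
    have r2: "(?i (a2 E) - ?i s * ?i (a1 E) + 3 * ?i r - (?i s)\<^sup>2) / 5\<^sup>2 = ?i e2"
      using arg_cong[OF e(2), of ?i] by simp
    have r3: "(?i (a3 E) + ?i r * ?i (a1 E) + 2 * ?i t) / 5 ^ 3 = ?i e3"
      using arg_cong[OF e(3), of ?i] by simp
    have r4: "(?i (a4 E) - ?i s * ?i (a3 E) + 2 * ?i r * ?i (a2 E) - (?i t + ?i r * ?i s) * ?i (a1 E)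
        + 3 * (?i r)\<^sup>2 - 2 * ?i s * ?i t) / 5 ^ 4 = ?i m4"
      using arg_cong[OF m4, of ?i] by (simp add: n4_def)
    have r6: "(?i (a6 E) + ?i r * ?i (a4 E) + (?i r)\<^sup>2 * ?i (a2 E) + ?i r ^ 3 - ?i t * ?i (a3 E)
        - (?i t)\<^sup>2 - ?i r * ?i t * ?i (a1 E)) / 5 ^ 6 = ?i m6"
      using arg_cong[OF m6, of ?i] by (simp add: n6_def)
    from E have "\<forall>u r s t :: rat. u \<noteq> 0 \<longrightarrow>
        (let A1 = of_int (a1 E); A2 = of_int (a2 E); A3 = of_int (a3 E);
             A4 = of_int (a4 E); A6 = of_int (a6 E);
             a1' = (A1 + 2*s) / u;
             a2' = (A2 - s*A1 + 3*r - s^2) / u^2;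
             a3' = (A3 + r*A1 + 2*t) / u^3;
             a4' = (A4 - s*A3 + 2*r*A2 - (t + r*s)*A1 + 3*r^2 - 2*s*t) / u^4;
             a6' = (A6 + r*A4 + r^2*A2 + r^3 - t*A3 - t^2 - r*t*A1) / u^6
         in (a1' \<in> \<int> \<and> a2' \<in> \<int> \<and> a3' \<in> \<int> \<and> a4' \<in> \<int> \<and> a6' \<in> \<int>) \<longrightarrow>
            \<bar>of_int (disc E)\<bar> \<le> \<bar>disc_q a1' a2' a3' a4' a6'\<bar>)"
      unfolding global_minimal_def by blast
    from this[rule_format, of 5 "?i s" "?i r" "?i t"] show ?thesis
      unfolding Let_def r1 r2 r3 r4 r6 by simp
  qed
  ultimately have "\<bar>disc E\<bar> \<le> \<bar>disc F\<bar>" by (metis of_int_abs of_int_le_iff)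
  then have "disc E = 0" unfolding disc by (simp add: abs_mult)
  then show False using E by (simp add: global_minimal_def)
qed

lemma abs_le_exp_wheight: "\<bar>real_of_rat q\<bar> \<le> exp (wheight q)"
proof -
  obtain a b where ab: "quotient_of q = (a, b)" by (cases "quotient_of q")
  have b: "b > 0" and q: "q = of_int a / of_int b"
    using ab quotient_of_denom_pos quotient_of_div by blast+
  have "\<bar>real_of_rat q\<bar> = \<bar>real_of_int a\<bar> / real_of_int b"
    using b by (simp add: q of_rat_divide abs_divide)
  also have "\<dots> \<le> \<bar>real_of_int a\<bar> / 1" using b by (intro divide_left_mono) auto
  also have "\<dots> \<le> real_of_int (max \<bar>a\<bar> \<bar>b\<bar>)" by simp
  also have "\<dots> = exp (wheight q)" using ab b by (simp add: wheight_def)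
  finally show ?thesis .
qed

definition lang_height :: "wmodel \<Rightarrow> real" where
  "lang_height E = max (wheight (jinv E)) (wheight (of_int (disc E)))"

text \<open>Lets additive constants be absorbed into multiples of \<open>lang_height E\<close>. For
  discriminant 1 or -1 the values 0, 1, -1 of \<open>c4\<close> are excluded, as 1727, 1728 and 1729
  lie between the squares of 41 and 42; so \<open>j\<close> is an integer of absolute value at least
  8.\<close>

lemma lang_height_ge_ln2:
  assumes "disc E \<noteq> 0"
  shows "lang_height E \<ge> ln 2"
proof (cases "\<bar>disc E\<bar> \<ge> 2")
  case True
  then have "ln 2 \<le> ln (max (real_of_int \<bar>disc E\<bar>) 1)" by (subst ln_le_cancel_iff) auto
  then show ?thesis by (simp add: lang_height_def wheight_of_int le_max_iff_disj)
next
  case False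
  then have d: "disc E = 1 \<or> disc E = - 1" using assms by linarith
  have nosq: "n\<^sup>2 \<noteq> 1727 \<and> n\<^sup>2 \<noteq> 1728 \<and> n\<^sup>2 \<noteq> 1729 \<and> n\<^sup>2 > -1" for n :: int
  proof -
    have "n\<^sup>2 \<le> 41\<^sup>2 \<or> 42\<^sup>2 \<le> n\<^sup>2"
    proof (cases "\<bar>n\<bar> \<le> 41")
      case True
      then show ?thesis using power_mono[of "\<bar>n\<bar>" 41 2] by simp
    next
      case False
      then show ?thesis using power_mono[of 42 "\<bar>n\<bar>" 2] by simp
    qed
    then show ?thesis by (auto simp: less_le_trans[of "-1" 0])
  qed
  have "\<bar>c4 E\<bar> \<ge> 2"
  proof (rule ccontr)
    assume "\<not> ?thesis"
    then have "c4 E = 0 \<or> c4 E = 1 \<or> c4 E = - 1" by linarith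
    then show False using d disc_c4_c6[of E] nosq[of "c6 E"] by auto
  qed
  then have "2 \<le> \<bar>c4 E\<bar> ^ 3" using self_le_power[of "\<bar>c4 E\<bar>" 3] by linarith
  moreover have "jinv E = of_int (c4 E ^ 3 * disc E)" using d by (auto simp: jinv_def)
  moreover have "\<bar>c4 E ^ 3 * disc E\<bar> = \<bar>c4 E\<bar> ^ 3" using d by (auto simp: abs_mult power_abs)
  ultimately have "wheight (jinv E) = ln (max (real_of_int (\<bar>c4 E\<bar> ^ 3)) 1)" "2 \<le> \<bar>c4 E\<bar> ^ 3"
    by (simp_all only: wheight_of_int)
  moreover have "ln 2 \<le> ln (max (real_of_int (\<bar>c4 E\<bar> ^ 3)) 1)"
  proof (subst ln_le_cancel_iff)
    have "real_of_int 2 \<le> real_of_int (\<bar>c4 E\<bar> ^ 3)" using calculation(2) by (simp only: of_int_le_iff)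
    then show "2 \<le> max (real_of_int (\<bar>c4 E\<bar> ^ 3)) 1" by simp
  qed auto
  ultimately have "ln 2 \<le> wheight (jinv E)" by (simp only:)
  then show ?thesis by (simp add: lang_height_def le_max_iff_disj)
qed

lemma short_coeffs_le:
  assumes "disc E \<noteq> 0"
  shows "\<bar>real_of_int (shortA E)\<bar> \<le> exp (19 * lang_height E)" "\<bar>real_of_int (shortB E)\<bar> \<le> exp (19 * lang_height E)"
    "2 \<le> exp (19 * lang_height E)"
proof -
  define H where "H = exp (lang_height E)"
  have "exp (ln 2) \<le> exp (lang_height E)" using lang_height_ge_ln2[OF assms] by (simp only: exp_le_cancel_iff)
  then have H: "H \<ge> 2" by (simp add: H_def)
  have H19: "exp (19 * lang_height E) = H ^ 19" by (simp add: H_def exp_of_nat_mult[symmetric])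
  have j: "\<bar>real_of_rat (jinv E)\<bar> \<le> H"
    using abs_le_exp_wheight[of "jinv E"] by (rule order_trans) (simp add: H_def lang_height_def)
  have "\<bar>real_of_rat (of_int (disc E))\<bar> \<le> H"
    using abs_le_exp_wheight[of "of_int (disc E)"] by (rule order_trans) (simp add: H_def lang_height_def)
  then have D: "\<bar>real_of_int (disc E)\<bar> \<le> H" by simp
  have "jinv E * of_int (disc E) = of_int (c4 E ^ 3)" using assms by (simp add: jinv_def)
  then have "real_of_rat (jinv E) * real_of_int (disc E) = real_of_int (c4 E ^ 3)"
    by (metis of_rat_mult of_rat_of_int_eq)
  then have "\<bar>real_of_int (c4 E ^ 3)\<bar> \<le> H * H" using abs_intros(3)[OF j D] by simp
  then have c43: "\<bar>real_of_int (c4 E)\<bar> ^ 3 \<le> H * H" by (simp add: power_abs)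
  have ge1: "\<bar>real_of_int n\<bar> \<le> \<bar>real_of_int n\<bar> ^ k" if "k > 0" for n :: int and k :: nat
    using that by (cases "n = 0") (auto intro!: self_le_power)
  have c4: "\<bar>real_of_int (c4 E)\<bar> \<le> H * H" using ge1[of 3 "c4 E"] c43 by simp
  have "real_of_int ((c6 E)\<^sup>2) = real_of_int (c4 E ^ 3 - 1728 * disc E)"
    using disc_c4_c6[of E] by simp
  then have "\<bar>real_of_int (c6 E)\<bar> ^ 2 = real_of_int (c4 E) ^ 3 - 1728 * real_of_int (disc E)" by simp
  also have "\<dots> \<le> H * H + 1728 * H" using c43 D by (simp add: power_abs[symmetric]; linarith)
  also have "\<dots> \<le> 1729 * (H * H)" using mult_left_mono[of 1 H H] H by simp
  finally have c6: "\<bar>real_of_int (c6 E)\<bar> \<le> 1729 * (H * H)" using ge1[of 2 "c6 E"] by simp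
  \<comment> \<open>Origin of 19: \<open>54 * 1729 = 93366\<close> is below \<open>2 ^ 17\<close>,
    so both coefficients are at most \<open>2 ^ 17 * H^2\<close>, and
    \<open>H \<ge> 2\<close>.\<close>
  have "2 ^ 17 \<le> H ^ 17" using H by (intro power_mono) auto
  then have "2 ^ 17 * (H * H) \<le> H ^ 17 * (H * H)" using H by (intro mult_right_mono) auto
  also have "\<dots> = H ^ 19" by algebra
  finally have big: "131072 * (H * H) \<le> H ^ 19" by simp
  have "H * H \<ge> 0" using H by simp
  then show "\<bar>real_of_int (shortA E)\<bar> \<le> exp (19 * lang_height E)" "\<bar>real_of_int (shortB E)\<bar> \<le> exp (19 * lang_height E)"
    unfolding H19 shortA_def shortB_def using c4 c6 big by (simp_all add: abs_mult)
  show "2 \<le> exp (19 * lang_height E)" unfolding H19 using H self_le_power[of H 19] by simp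
qed

section \<open>Transport of group law and height to the short model\<close>

fun short_pt :: "wmodel \<Rightarrow> rpt \<Rightarrow> rat pt" where
  "short_pt E None = None"
| "short_pt E (Some p) = Some (shortX E p, shortY E p)"

lemma short_on:
  "(shortY E (x, y))\<^sup>2 = shortX E (x, y) ^ 3 + of_int (shortA E) * shortX E (x, y) + of_int (shortB E)
    \<longleftrightarrow> on_curve E x y"
proof -
  let ?i = "of_int :: int \<Rightarrow> rat"
  have "(shortY E (x, y))\<^sup>2 - (shortX E (x, y) ^ 3 + ?i (shortA E) * shortX E (x, y) + ?i (shortB E))
    = 46656 * ((y\<^sup>2 + ?i (a1 E) * x * y + ?i (a3 E) * y) - (x ^ 3 + ?i (a2 E) * x\<^sup>2 + ?i (a4 E) * x + ?i (a6 E)))"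
    unfolding shortX_def shortY_def shortA_def shortB_def c4_def c6_def b2_def b4_def b6_def
      fst_conv snd_conv of_int_add of_int_diff of_int_mult of_int_power of_int_minus of_int_numeral
    by algebra
  moreover have "u = v \<longleftrightarrow> p = q" if "u - v = 46656 * (p - q)" for u v p q :: rat
    using that by auto
  ultimately show ?thesis unfolding on_curve_def by blast
qed

lemma short_pt_pneg: "short_pt E (pneg E P) = sneg (short_pt E P)"
  by (cases P rule: sneg.cases) (auto simp: shortX_def shortY_def algebra_simps)

lemma short_pt_padd:
  assumes "P \<in> ratpts E" "Q \<in> ratpts E"
  shows "short_pt E (padd E P Q) = sadd (of_int (shortA E)) (short_pt E P) (short_pt E Q)"
proof (cases "P = None \<or> Q = None")
  case True
  then show ?thesis by (cases P) auto
next
  case False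
  then obtain x1 y1 x2 y2 where PQ: "P = Some (x1, y1)" "Q = Some (x2, y2)"
    and on: "on_curve E x1 y1" "on_curve E x2 y2"
    using assms by (auto simp: ratpts_def)
  let ?i = "of_int :: int \<Rightarrow> rat"
  let ?A = "?i (shortA E)"
  let ?b2 = "?i (b2 E)"
  define w1 w2 where "w1 = 2 * y1 + ?i (a1 E) * x1 + ?i (a3 E)" and "w2 = 2 * y2 + ?i (a1 E) * x2 + ?i (a3 E)"
  have X: "shortX E (x1, y1) = 36 * x1 + 3 * ?b2" "shortX E (x2, y2) = 36 * x2 + 3 * ?b2"
    by (simp_all add: shortX_def)
  have Y: "shortY E (x1, y1) = 108 * w1" "shortY E (x2, y2) = 108 * w2"
    by (simp_all add: shortY_def w1_def w2_def)
  have b2: "?b2 = ?i (a1 E) ^ 2 + 4 * ?i (a2 E)" by (simp add: b2_def)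
  have opp: "x1 = x2 \<and> y1 + y2 + ?i (a1 E) * x2 + ?i (a3 E) = 0 \<longleftrightarrow>
    shortX E (x1, y1) = shortX E (x2, y2) \<and> shortY E (x1, y1) + shortY E (x2, y2) = 0"
  proof -
    have "w1 + w2 = 2 * (y1 + y2 + ?i (a1 E) * x2 + ?i (a3 E))" if "x1 = x2"
      using that by (simp add: w1_def w2_def algebra_simps)
    moreover have "108 * w1 + 108 * w2 = 108 * (w1 + w2)" by simp
    ultimately show ?thesis unfolding X Y by auto
  qed
  show ?thesis
  proof (cases "x1 = x2 \<and> y1 + y2 + ?i (a1 E) * x2 + ?i (a3 E) = 0")
    case True
    then show ?thesis using opp unfolding PQ by simp
  next
    case ne: False
    define l where "l = (if x1 \<noteq> x2 then (y2 - y1) / (x2 - x1)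
        else (3 * x1\<^sup>2 + 2 * ?i (a2 E) * x1 + ?i (a4 E) - ?i (a1 E) * y1) / w1)"
    define L where "L = slope ?A (shortX E (x1, y1)) (shortY E (x1, y1)) (shortX E (x2, y2)) (shortY E (x2, y2))"
    \<comment> \<open>\<open>X\<close> is \<open>36 x\<close> and \<open>Y\<close> is
      \<open>216 y + 108 a1 x\<close> up to constants, so a slope \<open>l\<close> becomes
      \<open>(216 l + 108 a1) / 36\<close>.\<close>
    have L: "L = 6 * l + 3 * ?i (a1 E)"
    proof (cases "x1 = x2")
      case False
      have "(108 * w2 - 108 * w1) = 36 * (x2 - x1) * (6 * l + 3 * ?i (a1 E))"
        using False by (simp add: l_def w1_def w2_def field_simps)
      then show ?thesis using False unfolding L_def slope_def X Y by (simp add: field_simps)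
    next
      case True
      have "(y1 - y2) * (y1 + y2 + ?i (a1 E) * x2 + ?i (a3 E)) = 0"
        using on True unfolding on_curve_def by algebra
      then have "y1 = y2" using ne True by auto
      then have w: "w1 \<noteq> 0" using ne True by (auto simp: w1_def)
      have lw: "l * w1 = 3 * x1\<^sup>2 + 2 * ?i (a2 E) * x1 + ?i (a4 E) - ?i (a1 E) * y1"
        using True w by (simp add: l_def)
      have "3 * (36 * x1 + 3 * ?b2)\<^sup>2 + ?A = (6 * l + 3 * ?i (a1 E)) * (216 * w1)"
      proof -
        have "?A = - 27 * ((?i (a1 E) ^ 2 + 4 * ?i (a2 E))\<^sup>2 - 24 * (2 * ?i (a4 E) + ?i (a1 E) * ?i (a3 E)))"
          by (simp add: shortA_def c4_def b2_def b4_def)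
        then show ?thesis using lw unfolding b2 w1_def by algebra
      qed
      then show ?thesis using True w unfolding L_def slope_def X Y by (simp add: field_simps)
    qed
    define x3 where "x3 = l\<^sup>2 + ?i (a1 E) * l - ?i (a2 E) - x1 - x2"
    have "padd E P Q = Some (x3, - (l + ?i (a1 E)) * x3 - (y1 - l * x1) - ?i (a3 E))"
      unfolding PQ using ne by (simp add: Let_def x3_def l_def w1_def)
    moreover have "sadd ?A (short_pt E P) (short_pt E Q)
        = Some (L\<^sup>2 - shortX E (x1, y1) - shortX E (x2, y2),
            - (L * (L\<^sup>2 - shortX E (x1, y1) - shortX E (x2, y2) - shortX E (x1, y1)) + shortY E (x1, y1)))"
      unfolding PQ short_pt.simps sadd.simps using ne opp by (simp only: if_False Let_def L_def)
    moreover have x3': "36 * x3 + 3 * ?b2 = L\<^sup>2 - shortX E (x1, y1) - shortX E (x2, y2)"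
      unfolding X L x3_def b2 by algebra
    moreover have "108 * (2 * (- (l + ?i (a1 E)) * x3 - (y1 - l * x1) - ?i (a3 E)) + ?i (a1 E) * x3 + ?i (a3 E))
        = - (L * (36 * x3 + 3 * ?b2 - shortX E (x1, y1)) + shortY E (x1, y1))"
      unfolding X Y L w1_def by algebra
    ultimately show ?thesis by (simp only: short_pt.simps shortX_def shortY_def fst_conv snd_conv)
  qed
qed

lemma wheight_affine_le:
  fixes m n k :: int
  assumes "k \<noteq> 0"
  shows "wheight ((of_int m * x + of_int n) / of_int k) \<le> wheight x + ln (real_of_int (\<bar>m\<bar> + \<bar>n\<bar> + \<bar>k\<bar>))"
proof -
  obtain a b where ab: "quotient_of x = (a, b)" by (cases "quotient_of x")
  have b: "b > 0" and x: "x = of_int a / of_int b"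
    using ab quotient_of_denom_pos quotient_of_div by blast+
  define H where "H = real_of_int (max \<bar>a\<bar> \<bar>b\<bar>)"
  have H: "H > 0" "\<bar>real_of_int a\<bar> \<le> H" "\<bar>real_of_int b\<bar> \<le> H" using b by (auto simp: H_def)
  let ?C = "real_of_int (\<bar>m\<bar> + \<bar>n\<bar> + \<bar>k\<bar>)"
  have e: "(of_int m * x + of_int n) / of_int k = of_int (m * a + n * b) / of_int (k * b)"
    using b assms by (simp add: x field_simps)
  have 1: "\<bar>real_of_int (m * a + n * b)\<bar> \<le> ?C * H"
  proof -
    have "\<bar>real_of_int (m * a + n * b)\<bar> \<le> \<bar>real_of_int m\<bar> * H + \<bar>real_of_int n\<bar> * H"
      unfolding of_int_add of_int_mult by (intro abs_intros H) auto
    also have "\<dots> \<le> ?C * H" using H by (simp add: algebra_simps)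
    finally show ?thesis .
  qed
  have 2: "\<bar>real_of_int (k * b)\<bar> \<le> ?C * H"
  proof -
    have "\<bar>real_of_int (k * b)\<bar> \<le> \<bar>real_of_int k\<bar> * H"
      unfolding of_int_mult by (intro abs_intros H) auto
    also have "\<dots> \<le> ?C * H" using H by (intro mult_right_mono) auto
    finally show ?thesis .
  qed
  have "wheight ((of_int m * x + of_int n) / of_int k) \<le> ln (?C * H)"
    unfolding e using b assms by (intro wheight_quotient_le 1 2) auto
  also have "\<dots> = ln ?C + ln H"
  proof -
    have "\<bar>m\<bar> + \<bar>n\<bar> + \<bar>k\<bar> > 0" using assms by linarith
    then have "?C > 0" by (simp only: of_int_0_less_iff)
    then show ?thesis using H(1) by (simp only: ln_mult_pos)
  qed
  also have "ln H = wheight x" using ab by (simp add: wheight_def H_def)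
  finally show ?thesis by simp
qed

lemma wheight_short_pt_diff:
  "\<exists>c. \<forall>P. \<bar>wheight (xcoord (short_pt E P)) - wheight (xcoord P)\<bar> \<le> c"
proof -
  define c1 where "c1 = ln (real_of_int (\<bar>36\<bar> + \<bar>3 * b2 E\<bar> + \<bar>1\<bar>))"
  define c2 where "c2 = ln (real_of_int (\<bar>1\<bar> + \<bar>- (3 * b2 E)\<bar> + \<bar>36\<bar>))"
  have "\<bar>wheight (xcoord (short_pt E P)) - wheight (xcoord P)\<bar> \<le> c1 + c2" for P
  proof -
    have c: "c1 \<ge> 0" "c2 \<ge> 0" by (simp_all add: c1_def c2_def)
    show ?thesis
    proof (cases P)
      case None
      then show ?thesis using c by simp
    next
      case (Some p)
      then obtain x y where P: "P = Some (x, y)" by (cases p) auto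
      let ?X = "36 * x + 3 * of_int (b2 E)"
      have "wheight ?X \<le> wheight x + c1"
        using wheight_affine_le[of 1 36 x "3 * b2 E"] by (simp add: c1_def)
      moreover have "wheight x \<le> wheight ?X + c2"
        using wheight_affine_le[of 36 1 ?X "- (3 * b2 E)"] by (simp add: c2_def)
      ultimately show ?thesis using c by (simp add: P shortX_def)
    qed
  qed
  then show ?thesis by blast
qed

section \<open>Integral points in progression\<close>

locale minimal_curve =
  fixes E :: wmodel
  assumes minimal: "global_minimal E"
begin

lemma disc_nonzero: "disc E \<noteq> 0"
  using minimal by (simp add: global_minimal_def)

sublocale integral_curve "shortA E" "shortB E" "exp (19 * lang_height E)"
proof
  show "4 * shortA E ^ 3 + 27 * (shortB E)\<^sup>2 \<noteq> 0"
    unfolding short_disc using disc_nonzero by simp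
qed (use short_coeffs_le[OF disc_nonzero] in auto)

abbreviation short_add :: "rat pt \<Rightarrow> rat pt \<Rightarrow> rat pt"  (infixl "\<oplus>" 65) where
  "P \<oplus> Q \<equiv> sadd (of_int (shortA E)) P Q"

lemma short_pt_in_pts: "short_pt E P \<in> pts \<longleftrightarrow> P \<in> ratpts E"
proof (cases P)
  case (Some p)
  then show ?thesis using short_on[of E "fst p" "snd p"]
    by (cases p) (simp add: on_def ratpts_def)
qed (simp add: ratpts_def)

lemma short_pt_surj:
  assumes "Q \<in> pts"
  obtains P where "P \<in> ratpts E" "short_pt E P = Q"
proof (use assms in \<open>cases rule: pts_cases\<close>)
  case None
  then show ?thesis using that[of None] by (simp add: ratpts_def)
next
  case (Some X Y)
  define x where "x = (X - 3 * of_int (b2 E)) / 36"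
  define y where "y = (Y / 108 - of_int (a1 E) * x - of_int (a3 E)) / 2"
  have "short_pt E (Some (x, y)) = Q"
  proof -
    have "36 * x = X - 3 * of_int (b2 E)" by (simp add: x_def)
    moreover have "2 * y = Y / 108 - of_int (a1 E) * x - of_int (a3 E)" by (simp add: y_def)
    ultimately show ?thesis unfolding Some by (simp add: shortX_def shortY_def)
  qed
  then show ?thesis using that short_pt_in_pts assms by blast
qed

lemma padd_in_ratpts: "P \<in> ratpts E \<Longrightarrow> Q \<in> ratpts E \<Longrightarrow> padd E P Q \<in> ratpts E"
  by (metis short_pt_in_pts short_pt_padd sadd_in_pts)

lemma short_pt_pmult:
  assumes "P \<in> ratpts E"
  shows "pmult E n P \<in> ratpts E" "short_pt E (pmult E n P) = short_pt E P [^]\<^bsub>GG\<^esub> n"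
proof -
  have "pmult E n P \<in> ratpts E \<and> short_pt E (pmult E n P) = short_pt E P [^]\<^bsub>GG\<^esub> n"
  proof (induction n)
    case 0
    then show ?case by (simp add: ratpts_def)
  next
    case (Suc n)
    have "short_pt E P \<in> carrier GG" using assms short_pt_in_pts by simp
    then show ?case using Suc assms GG.nat_pow_Suc2[of "short_pt E P" n]
      by (simp only: pmult.simps padd_in_ratpts short_pt_padd GG_simps simp_thms)
  qed
  then show "pmult E n P \<in> ratpts E" "short_pt E (pmult E n P) = short_pt E P [^]\<^bsub>GG\<^esub> n" by blast+
qed

lemma short_pt_pimult:
  assumes "P \<in> ratpts E"
  shows "pimult E k P \<in> ratpts E" "short_pt E (pimult E k P) = short_pt E P [^]\<^bsub>GG\<^esub> k"
proof -
  have pts: "short_pt E P [^]\<^bsub>GG\<^esub> n \<in> pts" for n :: nat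
    using short_pt_pmult[OF assms] short_pt_in_pts by metis
  show *: "short_pt E (pimult E k P) = short_pt E P [^]\<^bsub>GG\<^esub> k"
    using assms pts by (simp only: pimult_def int_pow_def2 short_pt_pneg short_pt_pmult(2) GG_inv
        split: if_split) auto
  have "short_pt E P [^]\<^bsub>GG\<^esub> k \<in> carrier GG"
    by (rule GG.int_pow_closed) (use assms short_pt_in_pts in simp)
  then show "pimult E k P \<in> ratpts E" using * short_pt_in_pts GG_simps(1) by metis
qed

lemma short_pt_lincomb:
  assumes "set ps \<subseteq> ratpts E"
  shows "lincomb E ns ps \<in> ratpts E \<and> short_pt E (lincomb E ns ps) = GG.comb ns (map (short_pt E) ps)"
  using assms
proof (induction ps arbitrary: ns)
  case Nil
  then show ?case by (simp add: lincomb_def ratpts_def)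
next
  case (Cons p ps)
  show ?case
  proof (cases ns)
    case Nil
    then show ?thesis by (simp add: lincomb_def ratpts_def)
  next
    case (Cons n ms)
    have "lincomb E (n # ms) (p # ps) = padd E (pimult E n p) (lincomb E ms ps)"
      by (simp add: lincomb_def)
    moreover have "p \<in> ratpts E" "set ps \<subseteq> ratpts E" using Cons.prems by auto
    ultimately show ?thesis using Cons.IH[of ms] short_pt_pimult[of p n]
      unfolding Cons by (simp only: list.map GG.comb_Cons GG_simps padd_in_ratpts short_pt_padd simp_thms)
  qed
qed

lemma torsion_iff: "P \<in> ratpts E \<Longrightarrow> torsion E P \<longleftrightarrow> (\<exists>n>0. short_pt E P [^]\<^bsub>GG\<^esub> (n::nat) = None)"
proof -
  assume P: "P \<in> ratpts E"
  have "pmult E n P = None \<longleftrightarrow> short_pt E P [^]\<^bsub>GG\<^esub> n = None" for n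
    unfolding short_pt_pmult(2)[OF P, symmetric] by (cases "pmult E n P") auto
  then show ?thesis by (simp add: torsion_def)
qed

lemma dim_le_rank:
  assumes "has_rank E r"
  shows "psd_form.dim_le GG pairing r"
  unfolding psd_form.dim_le_def[OF psd_form_pairing]
proof (intro allI impI)
  fix qs assume qs: "set qs \<subseteq> carrier GG \<and> length qs = Suc r"
  define ps where "ps = map (\<lambda>Q. SOME P. P \<in> ratpts E \<and> short_pt E P = Q) qs"
  have some: "(SOME P. P \<in> ratpts E \<and> short_pt E P = Q) \<in> ratpts E \<and>
      short_pt E (SOME P. P \<in> ratpts E \<and> short_pt E P = Q) = Q" if "Q \<in> set qs" for Q
  proof (rule someI_ex)
    have "Q \<in> pts" using that qs by auto
    then show "\<exists>P. P \<in> ratpts E \<and> short_pt E P = Q" by (metis short_pt_surj)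
  qed
  have ps: "set ps \<subseteq> ratpts E" "map (short_pt E) ps = qs" "length ps = Suc r"
    using some qs by (auto simp: ps_def intro: map_idI)
  have "\<exists>ns. length ns = Suc r \<and> (\<exists>n \<in> set ns. n \<noteq> 0) \<and> GG.comb ns qs = None"
  proof (cases "distinct ps")
    case True
    then have "\<not> indep E ps" using assms ps unfolding has_rank_def by fastforce
    then obtain ns where ns: "length ns = length ps" "lincomb E ns ps = None" "\<exists>n \<in> set ns. n \<noteq> 0"
      unfolding indep_def by blast
    then show ?thesis using short_pt_lincomb[OF ps(1), of ns] ps by auto
  next
    case False
    then have "\<not> distinct qs" using ps(2) by (metis distinct_map)
    then show ?thesis using GG.comb_not_distinct[of qs] qs by simp
  qed
  then obtain ns where ns: "length ns = Suc r" "\<exists>n \<in> set ns. n \<noteq> 0" "GG.comb ns qs = None" by blast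
  have "pairing None None = 0" using pairing_self[of None] can_ht_None by simp
  then show "\<exists>ns. length ns = Suc r \<and> (\<exists>n \<in> set ns. n \<noteq> 0) \<and> pairing (GG.comb ns qs) (GG.comb ns qs) = 0"
    using ns by metis
qed

text \<open>\<open>lim\<close> carries information only for convergent sequences. The one on
  \<open>E\<close> converges because it differs from that on the short model by a bounded quantity
  over \<open>4 ^ n\<close>.\<close>

lemma canon_height_eq:
  assumes P: "P \<in> ratpts E"
  shows "canon_height E P = can_ht (short_pt E P)"
proof -
  obtain c where c: "\<And>P. \<bar>wheight (xcoord (short_pt E P)) - wheight (xcoord P)\<bar> \<le> c"
    using wheight_short_pt_diff by blast
  let ?f = "\<lambda>n. wheight (xcoord (short_pt E (pmult E (2 ^ n) P))) / 4 ^ n"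
  let ?g = "\<lambda>n. wheight (xcoord (pmult E (2 ^ n) P)) / 4 ^ n"
  have f: "?f \<longlonglongrightarrow> can_ht (short_pt E P)"
    using can_ht_LIMSEQ[of "short_pt E P"] P by (simp only: short_pt_in_pts short_pt_pmult(2)[OF P])
  have "(\<lambda>n. ?f n - ?g n) \<longlonglongrightarrow> 0"
  proof (rule tendsto_0_le)
    show "(\<lambda>n. (1/4::real) ^ n) \<longlonglongrightarrow> 0" by (intro LIMSEQ_power_zero) simp
    show "\<forall>\<^sub>F n in sequentially. norm (?f n - ?g n) \<le> norm ((1/4::real) ^ n) * c"
    proof (rule always_eventually, rule allI)
      fix n
      have "norm (?f n - ?g n) = \<bar>wheight (xcoord (short_pt E (pmult E (2 ^ n) P))) - wheight (xcoord (pmult E (2 ^ n) P))\<bar> / 4 ^ n"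
        by (simp add: diff_divide_distrib[symmetric])
      also have "\<dots> \<le> c / 4 ^ n" by (intro divide_right_mono c) simp
      finally show "norm (?f n - ?g n) \<le> norm ((1/4::real) ^ n) * c" by (simp add: power_one_over)
    qed
  qed
  from tendsto_diff[OF f this] have "?g \<longlonglongrightarrow> can_ht (short_pt E P)" by simp
  then show ?thesis unfolding canon_height_def by (rule limI)
qed

end

section \<open>Large terms of an integer progression\<close>

lemma progression_first_quarter:
  fixes a d :: int and N :: nat
  assumes d: "d \<noteq> 0" and N: "N \<ge> 2" and x: "\<And>i. x i = a + int i * d" and le: "\<bar>x (N - 1)\<bar> \<le> \<bar>x 0\<bar>"
  shows "\<bar>x 0\<bar> \<ge> 1" "\<And>i. i < N \<Longrightarrow> \<bar>x i\<bar> \<le> \<bar>x 0\<bar>"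
    "\<And>i. i \<in> {..(N - 1) div 4} \<Longrightarrow> \<bar>x 0\<bar> \<le> 2 * \<bar>x i\<bar>"
proof -
  have mono: "int i * \<bar>d\<bar> \<le> int j * \<bar>d\<bar>" if "i \<le> j" for i j
    using that by (intro mult_right_mono) auto
  show all: "\<bar>x i\<bar> \<le> \<bar>x 0\<bar>" if "i < N" for i
  proof -
    define s t where "s = int i * \<bar>d\<bar>" and "t = int (N - 1) * \<bar>d\<bar>"
    have st: "0 \<le> s" "s \<le> t" using mono[of 0 i] mono[of i "N - 1"] that by (simp_all add: s_def t_def)
    show ?thesis
    proof (cases "d > 0")
      case True
      then have "x i = x 0 + s" "x (N - 1) = x 0 + t" unfolding s_def t_def by (simp_all add: x)
      then show ?thesis using st le by linarith
    next
      case False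
      then have "x i = x 0 - s" "x (N - 1) = x 0 - t" unfolding s_def t_def by (simp_all add: x)
      then show ?thesis using st le by linarith
    qed
  qed
  show "\<bar>x 0\<bar> \<ge> 1" using all[of 1] N d by (auto simp: x)
  show "\<bar>x 0\<bar> \<le> 2 * \<bar>x i\<bar>" if "i \<in> {..(N - 1) div 4}" for i
  proof -
    \<comment> \<open>The two ends differ by at most \<open>2 |x 0|\<close>, so a quarter of the
      steps moves by at most half of \<open>|x 0|\<close>.\<close>
    have "4 * i \<le> N - 1" using that by auto
    then have "4 * (int i * \<bar>d\<bar>) \<le> int (N - 1) * \<bar>d\<bar>" using mono[of "4 * i" "N - 1"] by simp
    also have "\<dots> = \<bar>x (N - 1) - x 0\<bar>" by (simp add: x abs_mult)
    also have "\<dots> \<le> 2 * \<bar>x 0\<bar>" using le by linarith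
    finally have "2 * (int i * \<bar>d\<bar>) \<le> \<bar>x 0\<bar>" by linarith
    then have "2 * \<bar>int i * d\<bar> \<le> \<bar>x 0\<bar>" by (simp only: abs_mult abs_of_nat)
    moreover have "x i = x 0 + int i * d" by (simp add: x)
    ultimately show ?thesis by linarith
  qed
qed

lemma progression_large_terms:
  fixes a d :: int and N :: nat
  assumes d: "d \<noteq> 0" and N: "N \<ge> 2" and x: "\<And>i. x i = a + int i * d"
  obtains X S where "S \<subseteq> {..<N}" "N \<le> 4 * card S" "X \<ge> 1"
    "\<And>i. i < N \<Longrightarrow> \<bar>x i\<bar> \<le> X" "\<And>i. i \<in> S \<Longrightarrow> X \<le> 2 * \<bar>x i\<bar>"
proof -
  let ?Q = "{..(N - 1) div 4}"
  have Q: "?Q \<subseteq> {..<N}" "N \<le> 4 * card ?Q" using N by auto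
  show thesis
  proof (cases "\<bar>x (N - 1)\<bar> \<le> \<bar>x 0\<bar>")
    case True
    show thesis
      by (rule that[OF Q progression_first_quarter[OF d N x True]])
  next
    case False
    \<comment> \<open>The largest absolute value is attained at an end; if that is the last one, the
      progression is read backwards.\<close>
    define x' where "x' = (\<lambda>i. x (N - 1) + int i * (- d))"
    have x': "x' i = x (N - 1 - i)" if "i < N" for i
      using that by (simp add: x'_def x of_nat_diff algebra_simps)
    have le: "\<bar>x' (N - 1)\<bar> \<le> \<bar>x' 0\<bar>" using False N x'[of "N - 1"] x'[of 0] by simp
    have "- d \<noteq> 0" using d by simp
    note q = progression_first_quarter[OF this N x'_def[THEN fun_cong] le]
    have card: "card ((\<lambda>i. N - 1 - i) ` ?Q) = card ?Q"
      using Q by (intro card_image) (auto simp: inj_on_def)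
    show thesis
    proof (rule that[of "(\<lambda>i. N - 1 - i) ` ?Q" "\<bar>x' 0\<bar>"])
      show "N \<le> 4 * card ((\<lambda>i. N - 1 - i) ` ?Q)" using Q card by simp
      show "\<bar>x' 0\<bar> \<ge> 1" by (rule q(1))
      show "\<bar>x i\<bar> \<le> \<bar>x' 0\<bar>" if "i < N" for i
        using q(2)[of "N - 1 - i"] x'[of "N - 1 - i"] that by simp
      show "\<bar>x' 0\<bar> \<le> 2 * \<bar>x i\<bar>" if "i \<in> (\<lambda>i. N - 1 - i) ` ?Q" for i
        using that q(3) x' Q(1) by auto
    qed (use N in auto)
  qed
qed

section \<open>The two cases of the bound\<close>

locale progression_on_curve = minimal_curve +
  fixes r N :: nat and x y :: "nat \<Rightarrow> int" and a d :: int
  assumes rank: "has_rank E r" and d: "d \<noteq> 0" and x: "\<And>i. x i = a + int i * d"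
    and on_pts: "\<And>i. i < N \<Longrightarrow> Some (of_int (x i), of_int (y i)) \<in> pts" and N: "N \<ge> 2"
begin

definition pt :: "nat \<Rightarrow> rat pt" where
  "pt i = Some (of_int (x i), of_int (y i))"

lemma pt_in_pts: "i < N \<Longrightarrow> pt i \<in> pts"
  using on_pts by (simp add: pt_def)

lemma x_eq_iff: "x i = x j \<longleftrightarrow> i = j"
  using d by (simp add: x)

lemma inj_pt: "inj pt"
  by (rule injI) (simp add: pt_def x_eq_iff)

lemma lang_height_pos: "lang_height E \<ge> ln 2" "lang_height E > 0"
proof -
  show "lang_height E \<ge> ln 2" by (rule lang_height_ge_ln2[OF disc_nonzero])
  moreover have "ln 2 > (0::real)" by simp
  ultimately show "lang_height E > 0" by linarith
qed

text \<open>285 = 15 * 19, because \<open>M\<close> is instantiated with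
  \<open>exp (19 * lang_height E)\<close>.\<close>

lemma can_ht_diff': "P \<in> pts \<Longrightarrow> \<bar>can_ht P - ht P\<bar> \<le> 285 * lang_height E"
  using can_ht_diff[of P] by simp

lemma can_ht_pt_le:
  assumes "i < N" "\<bar>x i\<bar> \<le> X" "X \<ge> 1"
  shows "can_ht (pt i) \<le> ln (real_of_int X) + 285 * lang_height E"
proof -
  have "ht (pt i) = ln (max (real_of_int \<bar>x i\<bar>) 1)" by (simp only: pt_def xcoord.simps wheight_of_int)
  also have "\<dots> \<le> ln (real_of_int X)"
    using assms by (subst ln_le_cancel_iff) (auto simp: less_max_iff_disj)
  finally show ?thesis using can_ht_diff'[OF pt_in_pts[OF assms(1)]] by linarith
qed

lemma bound_of_large_terms:
  assumes X: "X \<ge> 1" "\<And>i. i < N \<Longrightarrow> \<bar>x i\<bar> \<le> X" and S: "S \<subseteq> {..<N}" "N \<le> 4 * card S"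
    and XS: "\<And>i. i \<in> S \<Longrightarrow> X \<le> 2 * \<bar>x i\<bar>" and large: "ln (real_of_int X) > 3000 * lang_height E"
  shows "real N \<le> 4 * packing_const (1 / 8) ^ r"
proof (rule ccontr)
  assume "\<not> ?thesis"
  moreover have "real N \<le> 4 * real (card S)" using S(2) by linarith
  ultimately have cardS: "real (card S) > packing_const (1 / 8) ^ r" by linarith
  let ?L = "ln (real_of_int X)"
  have lang_height: "lang_height E > 0" and L: "?L > 0" using lang_height_pos large by auto
  have card: "card (pt ` S) = card S" using inj_pt by (intro card_image) (auto simp: inj_on_def)
  have "exp (19 * lang_height E) \<le> exp ?L" using large lang_height by simp
  then have MX: "exp (19 * lang_height E) \<le> real_of_int X" using X by simp
  \<comment> \<open>All heights are at most \<open>2 * ?L\<close>, so the parameter 1/8 yields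
    differences of height at most \<open>?L / 4\<close>.\<close>
  have "\<exists>S' \<subseteq> pt ` S. card S' > 1 \<and> (\<forall>P \<in> S'. \<forall>Q \<in> S'. can_ht (P \<oplus> sneg Q) \<le> (1 / 8) * (2 * ?L))"
  proof (rule can_ht_packing[OF dim_le_rank[OF rank]])
    show "finite (pt ` S)" using S(1) finite_subset by blast
    show "pt ` S \<subseteq> pts" using S(1) pt_in_pts by auto
    show "can_ht P \<le> 2 * ?L" if "P \<in> pt ` S" for P
      using that can_ht_pt_le[OF _ X(2) X(1)] S(1) large lang_height by fastforce
  qed (use L card cardS in auto)
  then obtain S' where S': "S' \<subseteq> pt ` S" "card S' > 1"
    "\<And>P Q. P \<in> S' \<Longrightarrow> Q \<in> S' \<Longrightarrow> can_ht (P \<oplus> sneg Q) \<le> (1 / 8) * (2 * ?L)" by blast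
  then obtain P Q where "P \<in> S'" "Q \<in> S'" "P \<noteq> Q"
    by (metis One_nat_def card_le_Suc0_iff_eq card.infinite not_less zero_le leD less_imp_le_nat not_one_less_zero)
  moreover from this obtain i j where "i \<in> S" "P = pt i" "j \<in> S" "Q = pt j"
    using S'(1) by blast
  ultimately have ij: "i \<in> S" "j \<in> S" "i \<noteq> j" and close: "can_ht (pt i \<oplus> sneg (pt j)) \<le> ?L / 4"
    using S'(3)[of P Q] by auto
  have lt: "i < N" "j < N" using ij S(1) by auto
  have ge: "can_ht (pt k) \<ge> ?L - ln 2 - 285 * lang_height E" if "k \<in> S" for k
  proof -
    have k: "k < N" using that S(1) by auto
    have "?L - ln 2 = ln (real_of_int X / 2)" using X(1) by (simp add: ln_div)
    also have "\<dots> \<le> ln (max (real_of_int \<bar>x k\<bar>) 1)"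
      using XS[OF that] X(1) by (subst ln_le_cancel_iff) (auto simp: less_max_iff_disj le_max_iff_disj)
    also have "\<dots> = ht (pt k)" by (simp only: pt_def xcoord.simps wheight_of_int)
    finally show ?thesis using can_ht_diff'[OF pt_in_pts[OF k]] by linarith
  qed
  have "ht (pt i \<oplus> pt j) \<le> ln (14 * (real_of_int X) ^ 3)"
    unfolding pt_def
  proof (rule ht_sum_integral_points)
    show "x i \<noteq> x j" using ij x_eq_iff by blast
    show "\<bar>real_of_int (x i)\<bar> \<le> real_of_int X" "\<bar>real_of_int (x j)\<bar> \<le> real_of_int X"
      using X(2) lt by (metis of_int_abs of_int_le_iff)+
  qed (use on_pts lt MX in auto)
  also have "\<dots> = ln 14 + 3 * ?L" using X(1) by (simp add: ln_mult ln_realpow)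
  finally have sum: "ht (pt i \<oplus> pt j) \<le> ln 14 + 3 * ?L" .
  have "ln 14 \<le> ln (2 ^ 4 :: real)" by (subst ln_le_cancel_iff) auto
  also have "\<dots> = 4 * ln 2" by (subst ln_realpow) auto
  finally have "ht (pt i \<oplus> pt j) \<le> 4 * ln 2 + 3 * ?L" using sum by linarith
  moreover have "pt i \<oplus> pt j \<in> pts" using pt_in_pts lt by simp
  ultimately have "can_ht (pt i \<oplus> pt j) \<le> 4 * ln 2 + 3 * ?L + 285 * lang_height E"
    using can_ht_diff'[of "pt i \<oplus> pt j"] by linarith
  moreover have "can_ht (pt i \<oplus> pt j) + can_ht (pt i \<oplus> sneg (pt j)) = 2 * can_ht (pt i) + 2 * can_ht (pt j)"
    using pt_in_pts lt by (intro can_ht_parallelogram)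
  \<comment> \<open>\<open>4 (L - ln 2 - 285 H) - (3 L + 4 ln 2 + 285 H)\<close> is
    \<open>L - 8 ln 2 - 1425 H\<close>, and \<open>ln 2 \<le> H\<close> gives 1433. The threshold
    3000 makes this exceed \<open>L / 4\<close>.\<close>
  ultimately have "can_ht (pt i \<oplus> sneg (pt j)) \<ge> ?L - 1433 * lang_height E"
    using ge[OF ij(1)] ge[OF ij(2)] lang_height_pos(1) by linarith
  then show False using close large lang_height by linarith
qed

lemma bound_of_small_terms:
  assumes X: "X \<ge> 1" "\<And>i. i < N \<Longrightarrow> \<bar>x i\<bar> \<le> X"
    and small: "ln (real_of_int X) \<le> 3000 * lang_height E"
    and lang: "c > 0" "\<And>P. P \<in> ratpts E \<Longrightarrow> \<not> torsion E P \<Longrightarrow> canon_height E P \<ge> c * lang_height E"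
    and k: "packing_const (c / 6570) \<le> 25 ^ k"
  shows "real N \<le> 2506 * (25 ^ k * 125 ^ k) ^ r"
proof -
  define K where "K = (25 ^ (k * r) :: real)"
  \<comment> \<open>The largest integer strictly below \<open>N / K\<close>: the strict hypothesis
    of the packing lemma holds, and more than \<open>m\<close> points means at least
    \<open>N / K\<close>.\<close>
  define m where "m = nat \<lceil>real N / K\<rceil> - 1"
  \<comment> \<open>3285 = 3000 + 285 and 6570 = 2 * 3285, so differences have height at most half
    of Lang's lower bound and must be torsion.\<close>
  let ?R = "3285 * lang_height E"
  have K1: "K \<ge> 1" by (simp add: K_def)
  have "real N / K > 0" using N K1 by simp
  then have m: "real m < real N / K" "real N / K \<le> real m + 1"
    unfolding m_def by linarith+
  have "packing_const (c / 6570) ^ r \<le> (25 ^ k) ^ r"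
    using k by (intro power_mono) (auto simp: packing_const_def)
  then have Kr: "packing_const (c / 6570) ^ r \<le> K" by (simp add: K_def power_mult)
  have "real m * packing_const (c / 6570) ^ r \<le> real m * K" using Kr by (intro mult_left_mono) auto
  also have "\<dots> < real N" using m(1) K1 by (simp add: field_simps)
  also have "real N = real (card (pt ` {..<N}))"
    using inj_pt by (subst card_image) (auto simp: inj_on_def)
  finally have card: "real (card (pt ` {..<N})) > real m * packing_const (c / 6570) ^ r" .
  have "\<exists>S' \<subseteq> pt ` {..<N}. card S' > m \<and> (\<forall>P \<in> S'. \<forall>Q \<in> S'. can_ht (P \<oplus> sneg Q) \<le> (c / 6570) * ?R)"
  proof (rule can_ht_packing[OF dim_le_rank[OF rank] _ _ _ _ _ card])
    show "can_ht P \<le> ?R" if "P \<in> pt ` {..<N}" for P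
      using that can_ht_pt_le[OF _ X(2) X(1)] small by fastforce
  qed (use lang lang_height_pos pt_in_pts in auto)
  then obtain S' where S': "S' \<subseteq> pt ` {..<N}" "card S' > m"
    "\<And>P Q. P \<in> S' \<Longrightarrow> Q \<in> S' \<Longrightarrow> can_ht (P \<oplus> sneg Q) \<le> (c / 6570) * ?R" by blast
  define S where "S = {i. i < N \<and> pt i \<in> S'}"
  have "S' = pt ` S" using S'(1) by (auto simp: S_def)
  then have "card S = card S'" using inj_pt by (metis card_image inj_on_subset subset_UNIV)
  have bound: "card S \<le> 2 * 5 ^ (3 * h + 1) + 3 * (N div 5 ^ (2 * h + 1) + 1)" for h
  proof (rule torsion_class_bound[OF global_minimal_5[OF minimal] d x])
    show "S \<subseteq> {..<N}" by (auto simp: S_def)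
    show "Some (of_int (x i), of_int (y i)) \<in> pts" if "i \<in> S" for i
      using that on_pts by (simp add: S_def)
    show "\<exists>n>0. (Some (of_int (x i), of_int (y i)) \<oplus> sneg (Some (of_int (x j), of_int (y j)))) [^]\<^bsub>GG\<^esub> (n::nat) = None"
      if "i \<in> S" "j \<in> S" for i j
    proof -
      have "pt i \<oplus> sneg (pt j) \<in> pts" using that pt_in_pts by (simp add: S_def)
      then obtain T where T: "T \<in> ratpts E" "short_pt E T = pt i \<oplus> sneg (pt j)" by (rule short_pt_surj)
      have "can_ht (pt i \<oplus> sneg (pt j)) \<le> (c / 6570) * ?R"
        using that S'(3) by (simp add: S_def)
      also have "\<dots> < c * lang_height E" using lang(1) lang_height_pos(2) by simp
      finally have "canon_height E T < c * lang_height E" using canon_height_eq[OF T(1)] T(2) by simp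
      then have "torsion E T" using lang(2)[OF T(1)] by linarith
      then show ?thesis using torsion_iff[OF T(1)] T(2) by (simp add: pt_def)
    qed
  qed
  \<comment> \<open>This gives \<open>5 ^ (2 h + 1) = 125 K\<close>, so the density term is
    \<open>3 N / (125 K)\<close>, less than half of the lower bound \<open>N / K\<close> for
    \<open>card S\<close>. Choosing \<open>K\<close> as a power of 25 makes this fit
    exactly.\<close>
  define h where "h = k * r + 1"
  have h1: "(5::real) ^ (2 * h + 1) = 125 * K"
    by (simp add: h_def K_def power_add power_mult)
  have h2: "(5::real) ^ (3 * h + 1) = 625 * 125 ^ (k * r)"
    by (simp add: h_def power_add power_mult)
  have "real N / K \<le> real (card S)"
    using m(2) S'(2) \<open>card S = card S'\<close> by linarith
  also have "\<dots> \<le> 2 * 5 ^ (3 * h + 1) + 3 * (real (N div 5 ^ (2 * h + 1)) + 1)"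
    using of_nat_mono[OF bound[of h], where 'a = real] by simp
  also have "real (N div 5 ^ (2 * h + 1)) \<le> real N / 5 ^ (2 * h + 1)"
    using of_nat_div_le_of_nat[of N "5 ^ (2 * h + 1)"] by simp
  finally have "real N / K \<le> 1250 * 125 ^ (k * r) + 3 * (real N / (125 * K)) + 3"
    unfolding h1 h2 by simp
  moreover have "3 * (real N / (125 * K)) \<le> (real N / K) / 2" using K1 N by (simp add: field_simps)
  moreover have "(1::real) \<le> 125 ^ (k * r)" by simp
  \<comment> \<open>Absorbing \<open>z\<close> doubles the rest: 2 * (1250 + 3) = 2506.\<close>
  moreover have "v \<le> 2506 * w" if "v \<le> 1250 * w + z + 3" "z \<le> v / 2" "1 \<le> w" for v w z :: real
    using that by linarith
  ultimately have "real N / K \<le> 2506 * 125 ^ (k * r)" by blast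
  then have "real N \<le> 2506 * (K * 125 ^ (k * r))" using K1 by (simp add: field_simps)
  then show ?thesis by (simp add: K_def power_mult power_mult_distrib)
qed

end

theorem theorem6p1:
  assumes "lang_conjecture"
  shows "\<exists>A C :: real. A > 1 \<and> C > 0 \<and>
    (\<forall>E r N (P :: nat \<Rightarrow> rat \<times> rat). global_minimal E \<and> has_rank E r \<and>
       (\<forall>i<N. integral_pt E (P i)) \<and>
       (\<exists>a d. d \<noteq> 0 \<and> (\<forall>i<N. shortX E (P i) = a + of_nat i * d)) \<longrightarrow>
       real N \<le> C * A ^ r)"
proof -
  obtain c where c: "c > 0" and lang: "\<And>E P. global_minimal E \<Longrightarrow> P \<in> ratpts E \<Longrightarrow> \<not> torsion E P \<Longrightarrow>
      canon_height E P \<ge> c * lang_height E"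
    using assms unfolding lang_conjecture_def lang_height_def by blast
  obtain k where k: "packing_const (c / 6570) \<le> 25 ^ k"
    using real_arch_pow[of 25 "packing_const (c / 6570)"] by (auto intro: less_imp_le)
  \<comment> \<open>A common base for both cases, which depends only on Lang's constant
    \<open>c\<close> through \<open>k\<close>.\<close>
  define A where "A = packing_const (1 / 8) + 25 ^ k * 125 ^ k"
  have pc: "packing_const (1 / 8) \<ge> 3" by (simp add: packing_const_def)
  have "(25 ^ k * 125 ^ k :: real) \<ge> 0" by simp
  then have A1: "A > 1" using pc unfolding A_def by linarith
  have "real N \<le> 2506 * A ^ r"
    if E: "global_minimal E" "has_rank E r" and int: "\<And>i. i < N \<Longrightarrow> integral_pt E (P i)"
      and AP: "d \<noteq> 0" "\<And>i. i < N \<Longrightarrow> shortX E (P i) = a + of_nat i * d"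
    for E r N and P :: "nat \<Rightarrow> rat \<times> rat" and a d
  proof (cases "N \<ge> 2")
    case False
    then have "real N \<le> 2506 * 1" by simp
    also have "\<dots> \<le> 2506 * A ^ r" using A1 by (intro mult_left_mono one_le_power) auto
    finally show ?thesis .
  next
    case N: True
    interpret minimal_curve E by unfold_locales (rule E)
    have "\<forall>i. \<exists>u v. i < N \<longrightarrow> shortX E (P i) = of_int u \<and> shortY E (P i) = of_int v"
      using int by (metis integral_pt_def Ints_cases)
    then obtain u v where uv: "\<And>i. i < N \<Longrightarrow> shortX E (P i) = of_int (u i)"
      "\<And>i. i < N \<Longrightarrow> shortY E (P i) = of_int (v i)" by metis
    \<comment> \<open>The given progression is rational. As its first two terms are integers, so are
      \<open>a\<close> and \<open>d\<close>; this uses \<open>N \<ge> 2\<close>.\<close>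
    define a' d' where "a' = u 0" and "d' = u 1 - u 0"
    have a': "a = of_int a'" using AP(2)[of 0] uv(1)[of 0] N by (simp add: a'_def)
    have d': "d = of_int d'" using AP(2)[of 1] uv(1)[of 1] uv(1)[of 0] AP(2)[of 0] N by (simp add: d'_def)
    define x where "x = (\<lambda>i. a' + int i * d')"
    have x: "shortX E (P i) = of_int (x i)" if "i < N" for i
      using AP(2)[OF that] by (simp add: x_def a' d')
    interpret progression_on_curve E r N x v a' d'
    proof
      show "d' \<noteq> 0" using AP(1) d' by auto
      show "Some (of_int (x i), of_int (v i)) \<in> pts" if "i < N" for i
      proof -
        have "on_curve E (fst (P i)) (snd (P i))" using int[OF that] by (simp add: integral_pt_def)
        then have "Some (P i) \<in> ratpts E" by (auto simp: ratpts_def) (metis prod.collapse)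
        then have "short_pt E (Some (P i)) \<in> pts" by (simp only: short_pt_in_pts)
        then show ?thesis using x[OF that] uv(2)[OF that] by simp
      qed
    qed (use E N in \<open>simp_all add: x_def\<close>)
    obtain X S where XS: "S \<subseteq> {..<N}" "N \<le> 4 * card S" "X \<ge> 1"
      "\<And>i. i < N \<Longrightarrow> \<bar>x i\<bar> \<le> X" "\<And>i. i \<in> S \<Longrightarrow> X \<le> 2 * \<bar>x i\<bar>"
      using progression_large_terms[OF d N progression_on_curve.x[OF progression_on_curve_axioms]] by metis
    show ?thesis
    proof (cases "ln (real_of_int X) > 3000 * lang_height E")
      case True
      have "real N \<le> 4 * packing_const (1 / 8) ^ r"
        by (rule bound_of_large_terms[OF XS(3,4,1,2,5) True])
      also have "\<dots> \<le> 2506 * A ^ r"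
        using pc by (intro mult_mono power_mono) (auto simp: A_def)
      finally show ?thesis .
    next
      case False
      have "real N \<le> 2506 * (25 ^ k * 125 ^ k) ^ r"
        using False by (intro bound_of_small_terms[OF XS(3,4) _ c lang[OF E(1)] k]) auto
      also have "\<dots> \<le> 2506 * A ^ r"
        using pc by (intro mult_left_mono power_mono) (auto simp: A_def)
      finally show ?thesis .
    qed
  qed
  then show ?thesis using A1
    by (intro exI[of _ A] exI[of _ "2506 :: real"] conjI allI impI) (simp, simp, metis)
qed

end
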